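(* Let $M,N\in\mathbb{N}$ be positive integers and let $\tau$ be a finite, absolutely friendly Borel measure on $\mathbb{R}^{MN}$ whose support is a compact subset $\mathcal{K}=\operatorname{supp}(\tau)$ of $\mathbb{R}^{MN}$. Identify points of $\mathbb{R}^{MN}$ with real $M\times N$ matrices. Then $\mathcal{K}\cap \mathbf{BA}(M,N)$ is a winning set for Schmidt's game played on $\mathcal{K}$; that is, there exists $\alpha\in(0,1)$ such that for every $\beta\in(0,1)$ player White has a winning strategy in the $(\alpha,\beta)$-game on $\mathcal{K}$ with target set $\mathcal{K}\cap\mathbf{BA}(M,N)$.
   Context: **Badly approximable matrices.** For $t\in\mathbb{R}$ let $\langle t\rangle$ be the distance from $t$ to the nearest integer, and for $U=(u_1,\dots,u_D)\in\mathbb{R}^D$ put $\operatorname{dist}(U,\mathbb{Z}^D)=\max_i\langle u_i\rangle$. A real $M\times N$ matrix $A$ is badly approximable if there is a constant $C=C(A)>0$ such that $\operatorname{dist}(A\mathbf{x},\mathbb{Z}^M)>C\|\mathbf{x}\|_\infty^{-N/M}$ for every $0\neq\mathbf{x}\in\mathbb{Z}^N$. $\mathbf{BA}(M,N)$ is the set of all badly approximable $M\times N$ matrices. **Absolutely friendly measure.** For an affine hyperplane $\mathcal{P}\subset\mathbb{R}^n$ and $\epsilon>0$ let $\mathcal{P}^{(\epsilon)}$ be the set of points at Euclidean distance $<\epsilon$ from $\mathcal{P}$; $B(\mathbf{x},\rho)$ is the closed Euclidean ball. A finite Borel measure $\tau$ on $\mathbb{R}^n$ is absolutely friendly if there exist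 positive constants $\rho_0,C,D,a$ such that for every $0<\rho\le\rho_0$ and every $\mathbf{x}\in\operatorname{supp}(\tau)$: (i) for any $0<\epsilon\le\rho$ and any affine hyperplane $\mathcal{P}$, $\tau(B(\mathbf{x},\rho)\cap\mathcal{P}^{(\epsilon)})<C(\epsilon/\rho)^a\,\tau(B(\mathbf{x},\rho))$; (ii) $\tau(B(\mathbf{x},\tfrac12\rho))>D\,\tau(B(\mathbf{x},\rho))$. **Schmidt's game on a compact set $\mathcal{K}\subset\mathbb{R}^n$.** Fix $0<\alpha,\beta<1$ and a target set $\mathcal{S}\subset\mathcal{K}$. All balls are closed Euclidean balls of $\mathbb{R}^n$ with centers in $\mathcal{K}$, and containments are between balls of $\mathbb{R}^n$. Player Black first chooses a ball $U(0)$ of some radius $\rho>0$ (with $\rho\le\operatorname{diam}\mathcal{K}$, a convention costing no generality). Given Black's ball $U(k)$, White chooses a ball $W(k)\subset U(k)$ with radius $\alpha$ times that of $U(k)$; then Black chooses a ball $U(k+1)\subset W(k)$ with radius $\beta$ times that of $W(k)$; and so on. White wins if the unique point of $\bigcap_k U(k)$ lies in $\mathcal{S}$; otherwise Black wins. $\mathcal{S}$ is $(\alpha,\beta)$-winning if White has a winning strategy, $\alpha$-winning if it is $(\alpha,\beta)$-winning for all $\beta\in(0,1)$, and winning if it is $\alpha$-winning for some $\alpha\in(0,1)$. *)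

theory Defs
  imports "HOL-Analysis.Analysis"
begin

(* An M x N real matrix is an element of real^'n^'m with M = CARD('m) and N = CARD('n).  The
   library's norm on this type is the l2 norm of the row norms, i.e. the Euclidean norm on R^(MN). *)

definition dist_nearest_int :: "real \<Rightarrow> real" where
  "dist_nearest_int t = infdist t \<int>"

definition dist_int_lattice :: "real ^ 'd \<Rightarrow> real" where
  "dist_int_lattice u = Max (range (\<lambda>i. dist_nearest_int (u $ i)))"

(* On real^'n, infnorm is the maximum of the absolute values of the coordinates. *)
definition BA :: "(real ^ 'n ^ 'm) set" where
  "BA = {A. \<exists>C>0. \<forall>x :: real ^ 'n. x \<noteq> 0 \<and> (\<forall>j. x $ j \<in> \<int>) \<longrightarrow>
           dist_int_lattice (A *v x) > C * infnorm x powr (- (real CARD('n) / real CARD('m)))}"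

definition measure_supp :: "'a::topological_space measure \<Rightarrow> 'a set" where
  "measure_supp \<tau> = {x. \<forall>U. open U \<and> x \<in> U \<longrightarrow> emeasure \<tau> U > 0}"

definition affine_hyperplane :: "'a::euclidean_space set \<Rightarrow> bool" where
  "affine_hyperplane P \<longleftrightarrow> (\<exists>v c. v \<noteq> 0 \<and> P = {y. v \<bullet> y = c})"

definition open_nbhd :: "real \<Rightarrow> 'a::metric_space set \<Rightarrow> 'a set" where
  "open_nbhd \<epsilon> P = {y. infdist y P < \<epsilon>}"

definition absolutely_friendly :: "'a::euclidean_space measure \<Rightarrow> bool" where
  "absolutely_friendly \<tau> \<longleftrightarrow>
     finite_measure \<tau> \<and> sets \<tau> = sets borel \<and>
     (\<exists>\<rho>\<^sub>0 C D a :: real. \<rho>\<^sub>0 > 0 \<and> C > 0 \<and> D > 0 \<and> a > 0 \<and>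
       (\<forall>\<rho> x. 0 < \<rho> \<and> \<rho> \<le> \<rho>\<^sub>0 \<and> x \<in> measure_supp \<tau> \<longrightarrow>
         (\<forall>\<epsilon> P. 0 < \<epsilon> \<and> \<epsilon> \<le> \<rho> \<and> affine_hyperplane P \<longrightarrow>
            measure \<tau> (cball x \<rho> \<inter> open_nbhd \<epsilon> P)
              < C * (\<epsilon> / \<rho>) powr a * measure \<tau> (cball x \<rho>)) \<and>
         measure \<tau> (cball x (\<rho> / 2)) > D * measure \<tau> (cball x \<rho>)))"

(* A ball is given by its (centre, radius) pair.  In a Euclidean space of positive dimension a closed
   ball of positive radius determines both. *)
type_synonym 'a gball = "'a \<times> real"

definition set_of_ball :: "'a::metric_space gball \<Rightarrow> 'a set" where
  "set_of_ball B = cball (fst B) (snd B)"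

definition legal_opening :: "'a::metric_space set \<Rightarrow> 'a gball \<Rightarrow> bool" where
  "legal_opening K B \<longleftrightarrow> fst B \<in> K \<and> 0 < snd B \<and> snd B \<le> diameter K"

definition legal_reply :: "'a::metric_space set \<Rightarrow> real \<Rightarrow> 'a gball \<Rightarrow> 'a gball \<Rightarrow> bool" where
  "legal_reply K \<gamma> B B' \<longleftrightarrow>
     fst B' \<in> K \<and> snd B' = \<gamma> * snd B \<and> set_of_ball B' \<subseteq> set_of_ball B"

(* White's strategy maps the list of Black's balls U(0), ..., U(k) to the ball W(k). *)
definition white_ball :: "('a gball list \<Rightarrow> 'a gball) \<Rightarrow> (nat \<Rightarrow> 'a gball) \<Rightarrow> nat \<Rightarrow> 'a gball" where
  "white_ball \<sigma> U k = \<sigma> (map U [0..<Suc k])"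

definition black_legal_upto ::
  "'a::metric_space set \<Rightarrow> real \<Rightarrow> ('a gball list \<Rightarrow> 'a gball) \<Rightarrow> (nat \<Rightarrow> 'a gball) \<Rightarrow> nat \<Rightarrow> bool" where
  "black_legal_upto K \<beta> \<sigma> U k \<longleftrightarrow>
     legal_opening K (U 0) \<and> (\<forall>j<k. legal_reply K \<beta> (white_ball \<sigma> U j) (U (Suc j)))"

(* The first conjunct makes the strategy answer legally at every position reached by legal moves of
   Black; the second says that White wins every infinite play against legal moves of Black. *)
definition white_winning_strategy ::
  "real \<Rightarrow> real \<Rightarrow> 'a::metric_space set \<Rightarrow> 'a set \<Rightarrow> ('a gball list \<Rightarrow> 'a gball) \<Rightarrow> bool" where
  "white_winning_strategy \<alpha> \<beta> K S \<sigma> \<longleftrightarrow>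
     (\<forall>U k. black_legal_upto K \<beta> \<sigma> U k \<longrightarrow> legal_reply K \<alpha> (U k) (white_ball \<sigma> U k)) \<and>
     (\<forall>U. (\<forall>k. black_legal_upto K \<beta> \<sigma> U k) \<longrightarrow>
        (\<exists>p\<in>S. (\<Inter>k. set_of_ball (U k)) = {p}))"

definition schmidt_winning_pair :: "real \<Rightarrow> real \<Rightarrow> 'a::metric_space set \<Rightarrow> 'a set \<Rightarrow> bool" where
  "schmidt_winning_pair \<alpha> \<beta> K S \<longleftrightarrow> (\<exists>\<sigma>. white_winning_strategy \<alpha> \<beta> K S \<sigma>)"

definition schmidt_alpha_winning :: "real \<Rightarrow> 'a::metric_space set \<Rightarrow> 'a set \<Rightarrow> bool" where
  "schmidt_alpha_winning \<alpha> K S \<longleftrightarrow> (\<forall>\<beta>\<in>{0<..<1}. schmidt_winning_pair \<alpha> \<beta> K S)"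

definition schmidt_winning :: "'a::metric_space set \<Rightarrow> 'a set \<Rightarrow> bool" where
  "schmidt_winning K S \<longleftrightarrow> (\<exists>\<alpha>\<in>{0<..<1}. schmidt_alpha_winning \<alpha> K S)"

end

theory Submission
  imports Defs
begin

text \<open>A matrix \<open>A\<close> is badly approximable iff the lattices \<open>flow s A \<int>\<^sup>d\<close>, \<open>s \<rightarrow> 0\<close>, have no short vectors.
  White controls the covolumes of their sublattices of all ranks at once. Covolumes are submodular, so
  with thresholds that are log-convex in the rank, at any time at most one rational subspace of each
  rank is about to become too small. White then moves to a ball on which the Pluecker coordinates of
  that subspace with a maximal number of expanding directions are comparable to its covolume; whatever
  Black does afterwards, its covolume never drops below a constant multiple of the present one. Such a
  ball exists since, along the entries of \<open>A\<close>, the derivatives of Pluecker coordinates are again Pluecker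
  coordinates with one expanding direction less, and absolute friendliness lets White stay away from
  the zero hyperplane of the linear part. Only finitely many hyperplanes are avoided per move, and their
  number does not depend on \<open>\<beta>\<close>.\<close>

section \<open>Pluecker coordinates\<close>

text \<open>The order of the constants shapes the argument. \<alpha> must be fixed before \<beta>,
  but one round shrinks the scale by \<alpha>\<beta> and may cost a height a factor
  \<open>cs\<close> that depends on \<beta>. This loss is charged only once per subspace: it is
  dealt with while its height lies between \<open>cs\<close> times the threshold and the threshold,
  and from then on a coordinate that the diagonal flow cannot decrease keeps it above
  \<open>c * cs\<close> times the threshold. Only \<open>c\<close> and \<alpha> come from the
  geometry of the support. The loss \<open>c * cs\<close> is absorbed by \<kappa>, chosen last,
  after \<beta> and the opening ball: the exponent j(d - j) is strictly concave, so two distinct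
  small subspaces of one rank would force (c cs)^2 \<le> const \<kappa>^2. Friendliness speaks of
  hyperplanes, whereas minors vanish on algebraic hypersurfaces; hence White escapes at a scale
  where the quadratic error is negligible, and repeats this until a top minor is reached. Frames are
  indexed by sets \<open>J\<close> of row labels, so that enlarging a frame replaces a single row of
  a determinant.\<close>

text \<open>The coordinates of the wedge product of the vectors \<open>x i\<close>, \<open>i \<in> J\<close>, are obtained by completing
  them with standard basis vectors to a square matrix.\<close>

definition pluecker :: "'k set \<Rightarrow> ('k \<Rightarrow> real ^ 'k) \<Rightarrow> ('k \<Rightarrow> 'k) \<Rightarrow> real" where
  "pluecker J x z = det (\<chi> i. if i \<in> J then x i else axis (z i) 1)"

text \<open>The sup norm of the wedge product stands in for the covolume, to which it is comparable.
  Completions \<open>z\<close> that are not injective off \<open>J\<close> contribute 0, and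
  permuting a completion only changes the sign.\<close>

definition height :: "'k set \<Rightarrow> ('k \<Rightarrow> real ^ 'k) \<Rightarrow> real" where
  "height J x = Max (range (\<lambda>z. \<bar>pluecker J x z\<bar>))"

lemma pluecker_le_height: "\<bar>pluecker J x z\<bar> \<le> height J x"
  unfolding height_def by (intro Max_ge) auto

lemma height_attained: obtains z where "\<bar>pluecker J x z\<bar> = height J x"
proof -
  have "height J x \<in> range (\<lambda>z. \<bar>pluecker J x z\<bar>)"
    unfolding height_def by (intro Max_in) auto
  then show ?thesis using that by force
qed

lemma height_nonneg: "0 \<le> height J x"
  using pluecker_le_height[of J x id] by linarith

lemma height_pos_iff: "0 < height J x \<longleftrightarrow> (\<exists>z. pluecker J x z \<noteq> 0)"
proof
  assume "0 < height J x"
  then show "\<exists>z. pluecker J x z \<noteq> 0" using height_attained[of J x] by (metis abs_zero less_irrefl)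
next
  assume "\<exists>z. pluecker J x z \<noteq> 0"
  then show "0 < height J x"
    using pluecker_le_height by (metis abs_le_zero_iff linorder_not_less order_trans)
qed

lemma height_leI: "(\<And>z. \<bar>pluecker J x z\<bar> \<le> B) \<Longrightarrow> height J x \<le> B"
  by (metis height_attained)

lemma pluecker_cong: "(\<And>i. i \<in> J \<Longrightarrow> x i = y i) \<Longrightarrow> pluecker J x z = pluecker J y z"
  unfolding pluecker_def by (rule arg_cong[where f = det]) (auto simp: vec_eq_iff)

lemma height_cong: "(\<And>i. i \<in> J \<Longrightarrow> x i = y i) \<Longrightarrow> height J x = height J y"
  unfolding height_def using pluecker_cong[of J x y] by presburger

lemma linear_det_row:
  fixes R :: "'k::finite \<Rightarrow> real ^ 'k"
  shows "linear (\<lambda>y. det (\<chi> k. if k = i then y else R k))"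
proof (rule linearI)
  show "det (\<chi> k. if k = i then a + b else R k) =
     det (\<chi> k. if k = i then a else R k) + det (\<chi> k. if k = i then b else R k)" for a b
    by (rule det_row_add)
  show "det (\<chi> k. if k = i then c *\<^sub>R a else R k) = c *\<^sub>R det (\<chi> k. if k = i then a else R k)"
    for c a
    using det_row_mul[of i c "\<lambda>_. a" R] by (simp add: scalar_mult_eq_scaleR cong: if_cong)
qed

lemma det_row_span_zero:
  fixes R :: "'k::finite \<Rightarrow> real ^ 'k"
  assumes "y \<in> span (R ` (- {i}))"
  shows "det (\<chi> k. if k = i then y else R k) = 0"
proof -
  have "det (\<chi> k. if k = i then y else R k) = (\<lambda>_. 0) y" using assms
  proof (rule linear_eq_on[OF linear_det_row, rotated])
    show "linear (\<lambda>_::real ^ 'k. 0::real)" by (simp add: linear_iff)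
    fix b assume "b \<in> R ` (- {i})"
    then obtain j where j: "j \<noteq> i" "b = R j" by auto
    show "det (\<chi> k. if k = i then b else R k) = 0"
      by (rule det_identical_rows[OF j(1)]) (use j in \<open>simp add: row_def vec_eq_iff\<close>)
  qed
  then show ?thesis by simp
qed

lemma pluecker_not_inj:
  assumes "i \<noteq> j" "i \<notin> J" "j \<notin> J" "z i = z j"
  shows "pluecker J x z = 0"
  unfolding pluecker_def
  by (rule det_identical_rows[OF assms(1)]) (use assms in \<open>simp add: row_def vec_eq_iff\<close>)

lemma pluecker_nonzero_inj: "pluecker J x z \<noteq> 0 \<Longrightarrow> inj_on z (- J)"
  unfolding inj_on_def using pluecker_not_inj[of _ _ J z x] by (metis ComplD)

text \<open>Multilinearity in the rows outside \<open>J\<close>. A coordinate ignores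
  \<open>z\<close> on \<open>J\<close>, so the condition \<open>z i = i\<close> there counts every
  completion once.\<close>

lemma det_pluecker_expand:
  fixes x w :: "'k::finite \<Rightarrow> real ^ 'k"
  shows "det (\<chi> i. if i \<in> J then x i else w i) =
    (\<Sum>z | \<forall>i\<in>J. z i = i. (\<Prod>i\<in>-J. w i $ z i) * pluecker J x z)"
proof -
  have "det (\<chi> i. if i \<in> J then x i else w i) =
     det (\<chi> i. if i \<in> -J then (\<Sum>p\<in>UNIV. (w i $ p) *s axis p 1) else x i)"
    by (rule arg_cong[where f = det]) (auto simp: vec_eq_iff basis_expansion)
  also have "\<dots> = (\<Sum>z | (\<forall>i\<in>-J. z i \<in> UNIV) \<and> (\<forall>i. i \<notin> -J \<longrightarrow> z i = i).
      det (\<chi> i. if i \<in> -J then (w i $ z i) *s axis (z i) 1 else x i))"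
    by (rule det_linear_rows_sum_lemma) auto
  also have "\<dots> = (\<Sum>z | \<forall>i\<in>J. z i = i. (\<Prod>i\<in>-J. w i $ z i) * pluecker J x z)"
  proof (rule sum.cong)
    fix z
    have "(\<chi> i. if i \<in> -J then (w i $ z i) *s axis (z i) 1 else x i) =
       (\<chi> i. (if i \<in> J then 1 else w i $ z i) *s (if i \<in> J then x i else axis (z i) 1))"
      by (auto simp: vec_eq_iff)
    then have "det (\<chi> i. if i \<in> -J then (w i $ z i) *s axis (z i) 1 else x i) =
       (\<Prod>i\<in>UNIV. if i \<in> J then 1 else w i $ z i) * pluecker J x z"
      by (simp only: det_rows_mul pluecker_def)
    also have "(\<Prod>i\<in>UNIV. if i \<in> J then 1 else w i $ z i) = (\<Prod>i\<in>-J. w i $ z i)"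
      by (rule prod.mono_neutral_cong_right) auto
    finally show "det (\<chi> i. if i \<in> -J then (w i $ z i) *s axis (z i) 1 else x i) =
       (\<Prod>i\<in>-J. w i $ z i) * pluecker J x z" .
  qed auto
  finally show ?thesis .
qed

text \<open>The number d^d of self-maps of the index type, a crude bound for the number of terms in
  \<open>det_pluecker_expand\<close>.\<close>

definition fun_count :: "'k itself \<Rightarrow> real" where
  "fun_count _ = real (card (UNIV :: ('k \<Rightarrow> 'k) set))"

lemma fun_count_ge_1: "1 \<le> fun_count TYPE('k::finite)"
  unfolding fun_count_def using finite_UNIV_card_ge_0[where 'a = "'k \<Rightarrow> 'k"] by simp

lemma det_le_height:
  fixes x w :: "'k::finite \<Rightarrow> real ^ 'k"
  assumes "\<And>i p. i \<notin> J \<Longrightarrow> \<bar>w i $ p\<bar> \<le> B i"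
  shows "\<bar>det (\<chi> i. if i \<in> J then x i else w i)\<bar> \<le> fun_count TYPE('k) * (\<Prod>i\<in>-J. B i) * height J x"
proof -
  have B: "0 \<le> B i" if "i \<notin> J" for i using assms[OF that] abs_ge_zero order_trans by blast
  have "\<bar>det (\<chi> i. if i \<in> J then x i else w i)\<bar> \<le>
     (\<Sum>z | \<forall>i\<in>J. z i = i. \<bar>(\<Prod>i\<in>-J. w i $ z i) * pluecker J x z\<bar>)"
    unfolding det_pluecker_expand by (rule sum_abs)
  also have "\<dots> \<le> (\<Sum>z::'k\<Rightarrow>'k | \<forall>i\<in>J. z i = i. (\<Prod>i\<in>-J. B i) * height J x)"
    by (intro sum_mono) (auto simp: abs_mult abs_prod intro!: mult_mono prod_mono assms
      pluecker_le_height prod_nonneg B)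
  also have "\<dots> \<le> (\<Sum>z\<in>(UNIV::('k\<Rightarrow>'k) set). (\<Prod>i\<in>-J. B i) * height J x)"
    by (rule sum_mono2) (auto intro!: mult_nonneg_nonneg prod_nonneg B height_nonneg)
  finally show ?thesis by (simp add: fun_count_def mult.assoc)
qed

text \<open>Subtracting from row \<open>i\<close> a vector \<open>p\<close> of the span leaves every
  determinant unchanged, so only the remainder \<open>x i - p\<close> matters. With
  \<open>height_insert_ge\<close> this makes the quotient of the two heights comparable to the
  distance from \<open>x i\<close> to the span.\<close>

lemma height_insert_le:
  fixes x :: "'k::finite \<Rightarrow> real ^ 'k"
  assumes "i \<notin> J" "p \<in> span (x ` J)" "\<And>q. \<bar>(x i - p) $ q\<bar> \<le> B"
  shows "height (insert i J) x \<le> fun_count TYPE('k) * B * height J x"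
proof (rule height_leI)
  fix z :: "'k \<Rightarrow> 'k"
  define R where "R k = (if k \<in> J then x k else axis (z k) 1)" for k
  have lin: "linear (\<lambda>y. det (\<chi> k. if k = i then y else R k))" by (rule linear_det_row)
  have "p \<in> span (R ` (- {i}))"
    using assms(1,2) span_mono[of "x ` J" "R ` (- {i})"] by (force simp: R_def)
  then have "det (\<chi> k. if k = i then p else R k) = 0" by (rule det_row_span_zero)
  then have "det (\<chi> k. if k = i then x i else R k) = det (\<chi> k. if k = i then x i - p else R k)"
    using linear_diff[OF lin, of "x i" p] by simp
  moreover have "pluecker (insert i J) x z = det (\<chi> k. if k = i then x i else R k)"
    unfolding pluecker_def R_def by (rule arg_cong[where f = det]) (auto simp: vec_eq_iff)
  moreover have "det (\<chi> k. if k = i then x i - p else R k) =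
     det (\<chi> k. if k \<in> J then x k else (if k = i then x i - p else axis (z k) 1))"
    unfolding R_def using assms(1) by (intro arg_cong[where f = det]) (auto simp: vec_eq_iff)
  moreover have "\<bar>det (\<chi> k. if k \<in> J then x k else (if k = i then x i - p else axis (z k) 1))\<bar> \<le>
     fun_count TYPE('k) * (\<Prod>k\<in>-J. if k = i then B else 1) * height J x"
    by (rule det_le_height) (use assms(3) in \<open>auto simp: axis_def\<close>)
  moreover have "(\<Prod>k\<in>-J. if k = i then B else 1) = B"
    using assms(1) by simp
  ultimately show "\<bar>pluecker (insert i J) x z\<bar> \<le> fun_count TYPE('k) * B * height J x" by simp
qed

text \<open>The maximal coordinate completes the frame to a basis. Expand \<open>y\<close> in this
  basis and let \<open>p\<close> be the part along the frame; Cramer's rule gives the remaining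
  coefficients as quotients of coordinates whose denominator is, up to sign, the height
  itself.\<close>

lemma height_insert_ge:
  fixes x :: "'k::finite \<Rightarrow> real ^ 'k"
  assumes "i \<notin> J" "0 < height J x"
  obtains p where "p \<in> span (x ` J)" "\<And>q. \<bar>(y - p) $ q\<bar> * height J x \<le> height (insert i J) (x(i := y))"
proof -
  obtain z where z: "\<bar>pluecker J x z\<bar> = height J x" by (rule height_attained)
  define R where "R k = (if k \<in> J then x k else axis (z k) 1)" for k
  define A where "A = (\<chi> k. R k)"
  have detA: "det A = pluecker J x z" unfolding A_def R_def pluecker_def ..
  then have nz: "det A \<noteq> 0" using z assms(2) by auto
  have inj: "inj_on z (-J)" using nz detA pluecker_nonzero_inj by metis
  have "invertible (transpose A)" using nz by (simp add: invertible_det_nz)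
  then obtain c where c: "transpose A *v c = y"
    by (metis invertible_def matrix_vector_mul_assoc matrix_vector_mul_lid)
  then have y: "y = (\<Sum>k\<in>UNIV. c $ k *s R k)"
    by (auto simp: vec_eq_iff matrix_vector_mult_def transpose_def A_def mult.commute)
  have rowA: "row l A = R l" for l by (simp add: A_def row_def vec_eq_iff)
  define p where "p = (\<Sum>k\<in>J. c $ k *s R k)"
  have p: "p \<in> span (x ` J)" unfolding p_def
    by (intro span_sum) (simp add: R_def scalar_mult_eq_scaleR span_scale span_base)
  have yp: "y - p = (\<Sum>k\<in>-J. c $ k *s axis (z k) 1)"
  proof -
    have "y = p + (\<Sum>k\<in>-J. c $ k *s R k)" unfolding y p_def
      using sum.Int_Diff[of UNIV "\<lambda>k. c $ k *s R k" J] by (simp add: Compl_eq_Diff_UNIV)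
    then show ?thesis by (simp add: R_def)
  qed
  have ck: "\<bar>c $ k\<bar> * height J x \<le> height (insert i J) (x(i := y))" if k: "k \<notin> J" for k
  proof -
    have "det (\<chi> l. if l = k then y else R l) = c $ k * det A"
      using cramer_lemma_transpose[of k c A] by (simp add: rowA y[symmetric] cong: if_cong)
    \<comment> \<open>Cramer's rule puts \<open>y\<close> into row \<open>k\<close>, but the larger
      frame keeps it in row \<open>i\<close>; exchanging the two rows leaves the completing vector
      of slot \<open>i\<close> in row \<open>k\<close>.\<close>
    moreover have "\<bar>det (\<chi> l. if l = k then y else R l)\<bar> =
        \<bar>pluecker (insert i J) (x(i := y)) (z(k := z i))\<bar>"
    proof -
      define S where "S = (\<chi> l. if l = k then y else R l)"
      have perm: "Transposition.transpose i k permutes UNIV" by (simp add: permutes_swap_id)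
      have "det (\<chi> l. S $ (Transposition.transpose i k l)) = of_int (sign (Transposition.transpose i k)) * det S"
        by (rule det_permute_rows[OF perm])
      moreover have "(\<chi> l. S $ (Transposition.transpose i k l)) =
         (\<chi> l. if l \<in> insert i J then (x(i := y)) l else axis ((z(k := z i)) l) 1)"
        using k assms(1) by (auto simp: vec_eq_iff S_def R_def Transposition.transpose_def)
      ultimately have "pluecker (insert i J) (x(i := y)) (z(k := z i)) =
          of_int (sign (Transposition.transpose i k)) * det S"
        unfolding pluecker_def by simp
      then show ?thesis unfolding S_def by (simp add: abs_mult sign_def)
    qed
    ultimately have "\<bar>c $ k\<bar> * height J x = \<bar>pluecker (insert i J) (x(i := y)) (z(k := z i))\<bar>"
      using z detA by (simp add: abs_mult)
    then show ?thesis using pluecker_le_height by metis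
  qed
  show ?thesis
  proof (rule that[OF p])
    fix q
    have q: "(y - p) $ q = (\<Sum>k\<in>-J. if z k = q then c $ k else 0)"
      unfolding yp by (auto simp: axis_def intro!: sum.cong)
    show "\<bar>(y - p) $ q\<bar> * height J x \<le> height (insert i J) (x(i := y))"
    proof (cases "q \<in> z ` (-J)")
      case True
      then obtain k where k: "k \<in> -J" "q = z k" by auto
      have "(y - p) $ q = (\<Sum>l\<in>-J. if l = k then c $ l else 0)"
        unfolding q using k inj by (intro sum.cong) (auto simp: inj_on_def)
      then have "(y - p) $ q = c $ k" using k by simp
      then show ?thesis using ck k by simp
    next
      case False
      then have "(y - p) $ q = 0" unfolding q by (intro sum.neutral) auto
      then show ?thesis using height_nonneg by simp
    qed
  qed
qed

section \<open>Positivity and submodularity of heights\<close>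

lemma det_nonzero_spans:
  fixes R :: "'k::finite \<Rightarrow> real ^ 'k"
  assumes "det (\<chi> k. R k) \<noteq> 0"
  obtains c where "y = (\<Sum>k\<in>UNIV. c k *\<^sub>R R k)"
proof -
  have "invertible (transpose (\<chi> k. R k))" using assms by (simp add: invertible_det_nz)
  then obtain c where c: "transpose (\<chi> k. R k) *v c = y"
    by (metis invertible_def matrix_vector_mul_assoc matrix_vector_mul_lid)
  then have "y = (\<Sum>k\<in>UNIV. c $ k *\<^sub>R R k)"
    by (auto simp: vec_eq_iff matrix_vector_mult_def transpose_def mult.commute)
  then show ?thesis using that by blast
qed

lemma span_image_sum:
  assumes "finite B" "y \<in> span (b ` B)"
  obtains c where "y = (\<Sum>i\<in>B. c i *\<^sub>R b i)"
proof -
  have "\<exists>c. y = (\<Sum>i\<in>B. c i *\<^sub>R b i)" using assms(2)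
  proof (induction rule: span_induct_alt)
    case base
    show ?case by (rule exI[of _ "\<lambda>_. 0"]) simp
  next
    case (step a v y)
    then obtain i c where i: "i \<in> B" "v = b i" "y = (\<Sum>i\<in>B. c i *\<^sub>R b i)" by auto
    have "(\<Sum>j\<in>B. (c j + (if j = i then a else 0)) *\<^sub>R b j) = a *\<^sub>R v + y"
      using i assms(1) by (simp add: scaleR_add_left sum.distrib if_distrib[of "\<lambda>t. t *\<^sub>R _"] cong: if_cong)
    then show ?case by metis
  qed
  then show ?thesis using that by blast
qed

lemma height_insert_pos:
  fixes x :: "'k::finite \<Rightarrow> real ^ 'k"
  assumes "i \<notin> J" "0 < height J x" "y \<notin> span (x ` J)"
  shows "0 < height (insert i J) (x(i := y))"
proof -
  obtain p where p: "p \<in> span (x ` J)"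
      "\<And>q. \<bar>(y - p) $ q\<bar> * height J x \<le> height (insert i J) (x(i := y))"
    using height_insert_ge[OF assms(1,2)] by blast
  have "y - p \<noteq> 0" using p(1) assms(3) by auto
  then obtain q where "(y - p) $ q \<noteq> 0" by (auto simp: vec_eq_iff)
  then have "0 < \<bar>(y - p) $ q\<bar> * height J x" using assms(2) by simp
  then show ?thesis using p(2)[of q] by linarith
qed

lemma height_pos_antimono:
  fixes x :: "'k::finite \<Rightarrow> real ^ 'k"
  assumes "0 < height J x" "I \<subseteq> J"
  shows "0 < height I x"
proof -
  have "0 < height (D \<union> I) x \<Longrightarrow> 0 < height I x" if "finite D" for D using that
  proof (induction D rule: finite_induct)
    case (insert i D)
    show ?case
    proof (cases "i \<in> I")
      case True
      then show ?thesis using insert by (simp add: insert_absorb)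
    next
      case False
      then have i: "i \<notin> D \<union> I" using insert by auto
      have "height (insert i (D \<union> I)) x \<le> fun_count TYPE('k) * norm (x i) * height (D \<union> I) x"
        by (rule height_insert_le[OF i, of 0]) (simp_all add: span_zero component_le_norm_cart)
      moreover have "0 < height (insert i (D \<union> I)) x" using insert.prems by simp
      ultimately have "height (D \<union> I) x \<noteq> 0" by auto
      then show ?thesis using insert.IH height_nonneg[of "D \<union> I" x] by linarith
    qed
  qed simp
  from this[of "J - I"] show ?thesis using assms by (simp add: Un_absorb2)
qed

text \<open>With V the span of \<open>x\<close> and W that of \<open>b\<close>, this bounds the
  product of the heights of V \<inter> W and V + W by that of V and W: the rows \<open>J - B\<close>
  of \<open>b\<close> lie in both spaces, and \<open>J'\<close> carries \<open>x\<close> together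
  with the \<open>b i\<close> for i \<in> \<open>B\<close>, whose slots are recorded by
  \<open>h\<close>. The rows in \<open>B\<close> are added one at a time to both small frames; a new
  vector is, up to a constant, no further from the larger span than from the smaller one.\<close>

lemma height_submodular:
  fixes x b :: "'k::finite \<Rightarrow> real ^ 'k"
  assumes x: "0 < height J x" and b: "0 < height J b" and BJ: "B \<subseteq> J"
    and bV: "\<And>i. i \<in> J - B \<Longrightarrow> b i \<in> span (x ` J)"
    and indep: "\<And>c. (\<Sum>i\<in>B. c i *\<^sub>R b i) \<in> span (x ` J) \<Longrightarrow> \<forall>i\<in>B. c i = 0"
  obtains J' h where "J \<subseteq> J'" "card J' = card J + card B" "h ` (J' - J) = B"
    "0 < height J' (\<lambda>k. if k \<in> J then x k else b (h k))"
    "height (J - B) b * height J' (\<lambda>k. if k \<in> J then x k else b (h k))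
       \<le> fun_count TYPE('k) ^ card B * height J x * height J b"
proof -
  define X where "X h k = (if k \<in> J then x k else b (h k))" for h k
  define C where "C = fun_count TYPE('k)"
  have C: "1 \<le> C" unfolding C_def by (rule fun_count_ge_1)
  have "\<exists>J' h. J \<subseteq> J' \<and> card J' = card J + card B0 \<and> h ` (J' - J) = B0 \<and> 0 < height J' (X h) \<and>
      height (J - B) b * height J' (X h) \<le> C ^ card B0 * height J x * height (J - B \<union> B0) b"
    if "finite B0" "B0 \<subseteq> B" for B0 using that
  proof (induction B0 rule: finite_induct)
    case empty
    have "height J (X h) = height J x" for h by (rule height_cong) (simp add: X_def)
    then show ?case using x by (intro exI[of _ J]) (simp add: mult.commute)
  next
    case (insert l B0)
    then obtain J' h where J': "J \<subseteq> J'" "card J' = card J + card B0" "h ` (J' - J) = B0"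
        "0 < height J' (X h)"
        "height (J - B) b * height J' (X h) \<le> C ^ card B0 * height J x * height (J - B \<union> B0) b"
      by auto
    define U where "U = J - B \<union> B0"
    have lU: "l \<notin> U" "insert l U \<subseteq> J" "U \<subseteq> J" using insert BJ by (auto simp: U_def)
    have sub: "X h ` J' \<subseteq> x ` J \<union> b ` B0"
      using J'(3) by (auto simp: X_def)
    have sup: "x ` J \<subseteq> X h ` J'" using J'(1) by (force simp: X_def)
    have supb: "b ` B0 \<subseteq> X h ` J'"
    proof
      fix y assume "y \<in> b ` B0"
      then obtain k where "k \<in> J' - J" "y = b (h k)" using J'(3) by auto
      then show "y \<in> X h ` J'" by (force simp: X_def)
    qed
    have bl: "b l \<notin> span (X h ` J')"
    proof
      assume "b l \<in> span (X h ` J')"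
      then have "b l \<in> span (x ` J \<union> b ` B0)" using span_mono[OF sub] by auto
      then obtain v y where vy: "b l = v + y" "v \<in> span (x ` J)" "y \<in> span (b ` B0)"
        by (auto simp: span_Un)
      obtain c where c: "y = (\<Sum>i\<in>B0. c i *\<^sub>R b i)"
        using span_image_sum[OF insert.hyps(1) vy(3)] by blast
      define c' where "c' i = (if i = l then 1 else if i \<in> B0 then - c i else 0)" for i
      have "(\<Sum>i\<in>B. c' i *\<^sub>R b i) = (\<Sum>i\<in>insert l B0. c' i *\<^sub>R b i)"
        by (rule sum.mono_neutral_right) (use insert in \<open>auto simp: c'_def\<close>)
      also have "\<dots> = b l + (\<Sum>i\<in>B0. c' i *\<^sub>R b i)"
        using insert by (simp add: c'_def)
      also have "(\<Sum>i\<in>B0. c' i *\<^sub>R b i) = (\<Sum>i\<in>B0. - (c i *\<^sub>R b i))"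
        using insert by (intro sum.cong) (auto simp: c'_def)
      also have "b l + \<dots> = v" using vy(1) c by (simp add: sum_negf)
      finally have "\<forall>i\<in>B. c' i = 0" using vy(2) indep by auto
      then show False using insert by (auto simp: c'_def)
    qed
    \<comment> \<open>A further slot is free: a full frame would span the whole space, including
      \<open>b l\<close>.\<close>
    have "J' \<noteq> UNIV"
    proof
      assume "J' = UNIV"
      then have "det (\<chi> k. X h k) \<noteq> 0"
        using J'(4) by (auto simp: height_pos_iff pluecker_def)
      then obtain c where "b l = (\<Sum>k\<in>UNIV. c k *\<^sub>R X h k)"
        using det_nonzero_spans[of "X h" "b l"] by blast
      then have "b l \<in> span (X h ` J')" using \<open>J' = UNIV\<close>
        by (simp add: span_sum span_scale span_base)
      then show False using bl by simp
    qed
    then obtain i where i: "i \<notin> J'" by auto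
    have Xi: "X (h(i := l)) = (X h)(i := b l)"
      using i J'(1) by (auto simp: X_def fun_eq_iff)
    have pos: "0 < height (insert i J') (X (h(i := l)))"
      unfolding Xi by (rule height_insert_pos[OF i J'(4) bl])
    have bU: "0 < height U b" using height_pos_antimono[OF b lU(3)] .
    \<comment> \<open>The same \<open>p\<close> serves both frames: its distance estimate comes from
      the rows \<open>U\<close> of \<open>b\<close>, and these lie in the span of the frame on
      \<open>J'\<close>.\<close>
    obtain p where p: "p \<in> span (b ` U)"
        "\<And>q. \<bar>(b l - p) $ q\<bar> * height U b \<le> height (insert l U) (b(l := b l))"
      using height_insert_ge[OF lU(1) bU] by blast
    have "b i \<in> span (X h ` J')" if "i \<in> U" for i
    proof (cases "i \<in> B0")
      case True
      then show ?thesis using supb span_base by blast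
    next
      case False
      then show ?thesis using that bV[of i] span_mono[OF sup] by (auto simp: U_def)
    qed
    then have "b ` U \<subseteq> span (X h ` J')" by blast
    then have pJ: "p \<in> span (X h ` J')" using p(1) span_minimal[OF _ subspace_span] by blast
    have "height (insert i J') ((X h)(i := b l)) \<le>
       C * (height (insert l U) b / height U b) * height J' ((X h)(i := b l))"
      unfolding C_def
    proof (rule height_insert_le[OF i])
      have "(X h)(i := b l) ` J' = X h ` J'" using i by auto
      then show "p \<in> span ((X h)(i := b l) ` J')" using pJ by simp
      show "\<bar>(((X h)(i := b l)) i - p) $ q\<bar> \<le> height (insert l U) b / height U b" for q
        using p(2)[of q] bU by (simp add: field_simps)
    qed
    also have "height J' ((X h)(i := b l)) = height J' (X h)"
      by (rule height_cong) (use i in auto)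
    finally have "height (J - B) b * height (insert i J') (X (h(i := l))) \<le>
       height (J - B) b * (C * (height (insert l U) b / height U b) * height J' (X h))"
      unfolding Xi by (rule mult_left_mono) (rule height_nonneg)
    also have "\<dots> = (height (J - B) b * height J' (X h)) * (C * (height (insert l U) b / height U b))"
      by simp
    also have "\<dots> \<le> (C ^ card B0 * height J x * height U b) * (C * (height (insert l U) b / height U b))"
      using J'(5) C by (intro mult_right_mono) (auto simp: U_def height_nonneg)
    also have "\<dots> = C ^ card (insert l B0) * height J x * height (insert l U) b"
      using bU insert.hyps by (simp add: field_simps)
    also have "insert l U = J - B \<union> insert l B0" by (auto simp: U_def)
    finally have ineq: "height (J - B) b * height (insert i J') (X (h(i := l))) \<le>
       C ^ card (insert l B0) * height J x * height (J - B \<union> insert l B0) b" .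
    have "(h(i := l)) ` (insert i J' - J) = insert l B0"
      using i J'(1,3) by (auto simp: image_iff)
    moreover have "card (insert i J') = card J + card (insert l B0)"
      using i J'(2) insert.hyps by simp
    moreover have "J \<subseteq> insert i J'" using J'(1) by auto
    ultimately show ?case using ineq pos by blast
  qed
  from this[of B] obtain J' h where "J \<subseteq> J'" "card J' = card J + card B" "h ` (J' - J) = B"
      "0 < height J' (X h)"
      "height (J - B) b * height J' (X h) \<le> C ^ card B * height J x * height J b"
    using BJ by (auto simp: Un_absorb1 Diff_partition Un_commute)
  then show ?thesis using that[of J' h] by (auto simp: X_def[abs_def] C_def)
qed

section \<open>Integer row operations\<close>

definition integral_vec :: "real ^ 'k \<Rightarrow> bool" where
  "integral_vec v \<longleftrightarrow> (\<forall>p. v $ p \<in> \<int>)"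

text \<open>Transvections alone generate the relation, without swaps or sign changes, so every
  Pluecker coordinate is preserved exactly. \<open>P\<close> is the set of rows that may be altered
  or used.\<close>

inductive row_equiv :: "'k set \<Rightarrow> ('k \<Rightarrow> 'a::real_vector) \<Rightarrow> ('k \<Rightarrow> 'a) \<Rightarrow> bool" for P x where
  refl: "row_equiv P x x"
| step: "row_equiv P x y \<Longrightarrow> i \<in> P \<Longrightarrow> l \<in> P \<Longrightarrow> i \<noteq> l \<Longrightarrow>
    row_equiv P x (y(i := y i + of_int n *\<^sub>R y l))"

lemma row_equiv_trans: "row_equiv P y w \<Longrightarrow> row_equiv P x y \<Longrightarrow> row_equiv P x w"
  by (induction rule: row_equiv.induct) (auto intro: row_equiv.intros)

lemma row_equiv_mono: "row_equiv P x y \<Longrightarrow> P \<subseteq> Q \<Longrightarrow> row_equiv Q x y"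
  by (induction rule: row_equiv.induct) (auto intro: row_equiv.intros)

lemma row_equiv_outside: "row_equiv P x y \<Longrightarrow> i \<notin> P \<Longrightarrow> y i = x i"
  by (induction rule: row_equiv.induct) auto

lemma row_equiv_subspace:
  "row_equiv P x y \<Longrightarrow> subspace V \<Longrightarrow> (\<And>i. i \<in> P \<Longrightarrow> x i \<in> V) \<Longrightarrow> i \<in> P \<Longrightarrow> y i \<in> V"
  by (induction arbitrary: i rule: row_equiv.induct) (auto simp: subspace_add subspace_scale)

lemma row_equiv_integral:
  "row_equiv P x y \<Longrightarrow> (\<And>i. i \<in> P \<Longrightarrow> integral_vec (x i)) \<Longrightarrow> i \<in> P \<Longrightarrow> integral_vec (y i)"
  by (induction arbitrary: i rule: row_equiv.induct) (auto simp: integral_vec_def)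

lemma pluecker_row_equiv:
  assumes "row_equiv P x y" "P \<subseteq> J" "linear T"
  shows "pluecker J (\<lambda>i. T (y i)) z = pluecker J (\<lambda>i. T (x i)) z"
  using assms(1)
proof (induction rule: row_equiv.induct)
  case (step y i l n)
  define A where "A = (\<chi> k. if k \<in> J then T (y k) else axis (z k) 1)"
  have rowA: "row k A = A $ k" for k by (simp add: row_def vec_eq_iff)
  have "pluecker J (\<lambda>k. T ((y(i := y i + of_int n *\<^sub>R y l)) k)) z =
      det (\<chi> k. if k = i then row i A + of_int n *s row l A else row k A)"
    unfolding pluecker_def rowA unfolding A_def using step.hyps assms(2)
    by (intro arg_cong[where f = det])
       (auto simp: vec_eq_iff linear_add[OF assms(3)] linear_scale[OF assms(3)])
  also have "\<dots> = det A" by (rule det_row_operation[OF step.hyps(4)])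
  also have "\<dots> = pluecker J (\<lambda>i. T (x i)) z" using step.IH by (simp add: A_def pluecker_def)
  finally show ?case .
qed simp

lemma height_row_equiv:
  "row_equiv P x y \<Longrightarrow> P \<subseteq> J \<Longrightarrow> linear T \<Longrightarrow> height J (\<lambda>i. T (y i)) = height J (\<lambda>i. T (x i))"
  unfolding height_def using pluecker_row_equiv[of P x y J T] by presburger

text \<open>Euclid's algorithm on the integers \<open>\<phi> (x i)\<close>: while two of them are
  nonzero, the sum of the absolute values can be lowered. Nothing is claimed about which row
  survives.\<close>

lemma euclid_row_equiv:
  fixes \<phi> :: "'a::real_vector \<Rightarrow> real"
  assumes "linear \<phi>" "finite P" "\<And>i. i \<in> P \<Longrightarrow> \<phi> (x i) \<in> \<int>" "i0 \<in> P" "\<phi> (x i0) \<noteq> 0"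
  obtains y l where "row_equiv P x y" "l \<in> P" "\<phi> (y l) \<noteq> 0" "\<And>i. i \<in> P - {l} \<Longrightarrow> \<phi> (y i) = 0"
proof -
  have "\<exists>y l. row_equiv P x y \<and> l \<in> P \<and> \<phi> (y l) \<noteq> 0 \<and> (\<forall>i\<in>P - {l}. \<phi> (y i) = 0)"
    using assms(3-5)
  proof (induction "\<Sum>i\<in>P. nat \<lfloor>\<bar>\<phi> (x i)\<bar>\<rfloor>" arbitrary: x i0 rule: less_induct)
    case less
    show ?case
    proof (cases "\<exists>i\<in>P. \<exists>l\<in>P. i \<noteq> l \<and> \<phi> (x i) \<noteq> 0 \<and> \<phi> (x l) \<noteq> 0")
      case False
      then show ?thesis using less.prems by (intro exI[of _ x] exI[of _ i0]) (auto intro: row_equiv.refl)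
    next
      case True
      then obtain i l where il: "i \<in> P" "l \<in> P" "i \<noteq> l" "\<phi> (x i) \<noteq> 0" "\<phi> (x l) \<noteq> 0"
          "\<bar>\<phi> (x l)\<bar> \<le> \<bar>\<phi> (x i)\<bar>"
        by (metis linorder_linear)
      obtain a b :: int where ab: "\<phi> (x i) = of_int a" "\<phi> (x l) = of_int b"
        using less.prems(1) il by (meson Ints_cases)
      \<comment> \<open>The subtractive form of the algorithm: \<open>a\<close> is moved towards 0
        once by |b|, which is at most |a|.\<close>
      define n where "n = - sgn a * sgn b"
      have "\<bar>b\<bar> \<le> \<bar>a\<bar>" using il(6) unfolding ab by (metis of_int_abs of_int_le_iff)
      moreover have "a \<noteq> 0" "b \<noteq> 0" using il(4,5) ab by auto
      ultimately have less_abs: "\<bar>a + n * b\<bar> < \<bar>a\<bar>"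
        unfolding n_def by (auto simp: sgn_if)
      define y where "y = x(i := x i + of_int n *\<^sub>R x l)"
      have re: "row_equiv P x y" unfolding y_def by (intro row_equiv.intros il)
      have phi: "\<phi> (y i) = of_int (a + n * b)"
        using ab by (simp add: y_def linear_add[OF assms(1)] linear_scale[OF assms(1)])
      have "(\<Sum>i\<in>P. nat \<lfloor>\<bar>\<phi> (y i)\<bar>\<rfloor>) < (\<Sum>i\<in>P. nat \<lfloor>\<bar>\<phi> (x i)\<bar>\<rfloor>)"
      proof (rule sum_strict_mono_ex1[OF assms(2)])
        have less_i: "nat \<lfloor>\<bar>\<phi> (y i)\<bar>\<rfloor> < nat \<lfloor>\<bar>\<phi> (x i)\<bar>\<rfloor>"
          using less_abs unfolding phi ab of_int_abs[symmetric] floor_of_int by simp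
        then show "\<exists>i\<in>P. nat \<lfloor>\<bar>\<phi> (y i)\<bar>\<rfloor> < nat \<lfloor>\<bar>\<phi> (x i)\<bar>\<rfloor>" using il by blast
        show "\<forall>i\<in>P. nat \<lfloor>\<bar>\<phi> (y i)\<bar>\<rfloor> \<le> nat \<lfloor>\<bar>\<phi> (x i)\<bar>\<rfloor>"
          using less_i by (auto simp: y_def)
      qed
      moreover have "\<phi> (y j) \<in> \<int>" if "j \<in> P" for j
        using less.prems(1) that phi by (cases "j = i") (auto simp: y_def)
      moreover have "\<phi> (y l) \<noteq> 0" using il by (simp add: y_def)
      ultimately obtain w m where "row_equiv P y w" "m \<in> P" "\<phi> (w m) \<noteq> 0" "\<forall>i\<in>P - {m}. \<phi> (w i) = 0"
        using less.hyps[of y l] il(2) by blast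
      then show ?thesis using row_equiv_trans[OF _ re] by blast
    qed
  qed
  then show ?thesis using that by blast
qed

text \<open>A Hermite-type reduction modulo \<open>V\<close>; the rationality of \<open>V\<close>
  enters through the integral functionals of the last assumption. Such a functional is concentrated
  on one row \<open>l\<close>, which joins \<open>B\<close>, and the other rows are reduced further.
  Only integer operations are allowed, as rows must stay integral and heights unchanged.\<close>

lemma echelon_row_equiv:
  fixes x :: "'k \<Rightarrow> real ^ 'd"
  assumes "finite P" and V: "subspace V"
    and "\<And>i. i \<in> P \<Longrightarrow> integral_vec (x i)"
    and ex: "\<And>y. integral_vec y \<Longrightarrow> y \<notin> V \<Longrightarrow>
      \<exists>\<phi>::real ^ 'd \<Rightarrow> real. linear \<phi> \<and> (\<forall>v\<in>V. \<phi> v = 0) \<and> \<phi> y \<noteq> 0 \<and> (\<forall>w. integral_vec w \<longrightarrow> \<phi> w \<in> \<int>)"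
  obtains y B where "row_equiv P x y" "B \<subseteq> P" "\<And>i. i \<in> P - B \<Longrightarrow> y i \<in> V"
    "\<And>c. (\<Sum>i\<in>B. c i *\<^sub>R y i) \<in> V \<Longrightarrow> \<forall>i\<in>B. c i = 0"
proof -
  have "\<exists>y B. row_equiv P x y \<and> B \<subseteq> P \<and> (\<forall>i\<in>P - B. y i \<in> V) \<and>
    (\<forall>c. (\<Sum>i\<in>B. c i *\<^sub>R y i) \<in> V \<longrightarrow> (\<forall>i\<in>B. c i = 0))"
    using assms(1,3)
  proof (induction P arbitrary: x rule: finite_psubset_induct)
    case (psubset P)
    show ?case
    proof (cases "\<forall>i\<in>P. x i \<in> V")
      case True
      then show ?thesis by (intro exI[of _ x] exI[of _ "{}"]) (auto intro: row_equiv.refl)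
    next
      case False
      then obtain i0 where i0: "i0 \<in> P" "x i0 \<notin> V" by auto
      then obtain \<phi> :: "real ^ 'd \<Rightarrow> real" where \<phi>: "linear \<phi>" "\<And>v. v \<in> V \<Longrightarrow> \<phi> v = 0" "\<phi> (x i0) \<noteq> 0"
          "\<And>w. integral_vec w \<Longrightarrow> \<phi> w \<in> \<int>"
        using ex[OF psubset.prems[OF i0(1)] i0(2)] by blast
      obtain y l where y: "row_equiv P x y" "l \<in> P" "\<phi> (y l) \<noteq> 0" "\<And>i. i \<in> P - {l} \<Longrightarrow> \<phi> (y i) = 0"
        using euclid_row_equiv[OF \<phi>(1) psubset.hyps, of x i0] \<phi> psubset.prems i0 by metis
      have int_y: "integral_vec (y i)" if "i \<in> P - {l}" for i
        using row_equiv_integral[OF y(1) psubset.prems] that by simp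
      have "P - {l} \<subset> P" using y(2) by auto
      from psubset.IH[OF this, of y] int_y obtain w B where w: "row_equiv (P - {l}) y w" "B \<subseteq> P - {l}" "\<forall>i\<in>P - {l} - B. w i \<in> V"
          "\<forall>c. (\<Sum>i\<in>B. c i *\<^sub>R w i) \<in> V \<longrightarrow> (\<forall>i\<in>B. c i = 0)"
        by blast
      have finB: "finite B" "l \<notin> B" using w(2) psubset.hyps finite_subset by auto
      have wl: "w l = y l" using row_equiv_outside[OF w(1)] by simp
      have "subspace {v. \<phi> v = 0}"
        using \<phi>(1) by (auto simp: subspace_def linear_add linear_scale linear_0)
      then have phi0: "\<phi> (w i) = 0" if "i \<in> P - {l}" for i
        using row_equiv_subspace[OF w(1), of "{v. \<phi> v = 0}" i] y(4) that by auto
      \<comment> \<open>The functional sees only row \<open>l\<close>, which forces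
        \<open>c l = 0\<close>; independence of the rest is the induction hypothesis.\<close>
      have "\<forall>i\<in>insert l B. c i = 0" if c: "(\<Sum>i\<in>insert l B. c i *\<^sub>R w i) \<in> V" for c
      proof -
        have "0 = \<phi> (\<Sum>i\<in>insert l B. c i *\<^sub>R w i)" using \<phi>(2)[OF c] by simp
        also have "\<dots> = c l * \<phi> (y l) + (\<Sum>i\<in>B. c i * \<phi> (w i))"
          using finB by (simp add: linear_add[OF \<phi>(1)] linear_scale[OF \<phi>(1)] linear_sum[OF \<phi>(1)] wl)
        also have "(\<Sum>i\<in>B. c i * \<phi> (w i)) = 0" by (rule sum.neutral) (use phi0 w(2) in auto)
        finally have "c l = 0" using y(3) by simp
        moreover then have "(\<Sum>i\<in>B. c i *\<^sub>R w i) \<in> V" using c finB by simp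
        ultimately show ?thesis using w(4) by blast
      qed
      moreover have "row_equiv P x w"
        using row_equiv_trans[OF row_equiv_mono[OF w(1), of P] y(1)] by blast
      ultimately show ?thesis using w(2,3) y(2)
        by (intro exI[of _ w] exI[of _ "insert l B"]) auto
    qed
  qed
  then show ?thesis using that by blast
qed

lemma det_Ints:
  fixes A :: "real ^ 'k ^ 'k"
  assumes "\<And>i j. A $ i $ j \<in> \<int>"
  shows "det A \<in> \<int>"
  unfolding det_def by (intro Ints_sum Ints_mult Ints_prod assms) auto

lemma pluecker_Ints:
  "(\<And>i. i \<in> J \<Longrightarrow> integral_vec (x i)) \<Longrightarrow> pluecker J x z \<in> \<int>"
  unfolding pluecker_def by (rule det_Ints) (auto simp: integral_vec_def axis_def)

lemma height_ge_1:
  assumes "\<And>i. i \<in> J \<Longrightarrow> integral_vec (x i)" "0 < height J x"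
  shows "1 \<le> height J x"
proof -
  obtain z where z: "\<bar>pluecker J x z\<bar> = height J x" by (rule height_attained)
  then have "1 \<le> \<bar>pluecker J x z\<bar>"
    using pluecker_Ints[OF assms(1)] assms(2) by (intro Ints_nonzero_abs_ge1) auto
  then show ?thesis using z by simp
qed

text \<open>The functional is a minor with one free row: integral because the other rows are, zero
  on the span because these rows are among them, and nonzero at \<open>y\<close> for a suitable
  completion since adding \<open>y\<close> to the frame keeps the height positive.\<close>

lemma integral_separation:
  fixes v :: "'k::finite \<Rightarrow> real ^ 'k"
  assumes "\<And>i. i \<in> J \<Longrightarrow> integral_vec (v i)" "0 < height J v" "J \<noteq> UNIV" "y \<notin> span (v ` J)"
  shows "\<exists>\<phi>::real ^ 'k \<Rightarrow> real. linear \<phi> \<and> (\<forall>u\<in>span (v ` J). \<phi> u = 0) \<and> \<phi> y \<noteq> 0 \<and>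
    (\<forall>w. integral_vec w \<longrightarrow> \<phi> w \<in> \<int>)"
proof -
  obtain i where i: "i \<notin> J" using assms(3) by auto
  obtain z where z: "pluecker (insert i J) (v(i := y)) z \<noteq> 0"
    using height_insert_pos[OF i assms(2,4)] height_pos_iff by blast
  define R where "R k = (if k \<in> J then v k else axis (z k) 1)" for k
  define \<phi> where "\<phi> w = det (\<chi> k. if k = i then w else R k)" for w
  have \<phi>: "\<phi> w = pluecker (insert i J) (v(i := w)) z" for w
    unfolding \<phi>_def pluecker_def R_def using i by (intro arg_cong[where f = det]) (auto simp: vec_eq_iff)
  have "linear \<phi>" unfolding \<phi>_def by (rule linear_det_row)
  moreover have "\<phi> u = 0" if "u \<in> span (v ` J)" for u
    unfolding \<phi>_def
  proof (rule det_row_span_zero)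
    have "v ` J \<subseteq> R ` (- {i})" using i by (force simp: R_def)
    then show "u \<in> span (R ` (- {i}))" using that span_mono by blast
  qed
  moreover have "\<phi> w \<in> \<int>" if "integral_vec w" for w
    unfolding \<phi> by (rule pluecker_Ints) (use assms(1) that in auto)
  ultimately show ?thesis using z \<phi> by metis
qed

text \<open>The integral form of submodularity. The frame \<open>w\<close> is reduced modulo the
  span of \<open>v\<close> before \<open>T\<close> destroys integrality; \<open>I\<close> then
  belongs to the intersection and \<open>J'\<close> to the sum of the two subspaces. The rank shift
  \<open>s\<close> is positive because \<open>w i0\<close> lies outside the span of
  \<open>v\<close>.\<close>

lemma height_exchange:
  fixes v w :: "'k::finite \<Rightarrow> real ^ 'k"
  assumes v: "\<And>i. i \<in> J \<Longrightarrow> integral_vec (v i)" "0 < height J v"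
    and w: "\<And>i. i \<in> J \<Longrightarrow> integral_vec (w i)"
    and "J \<noteq> UNIV" and T: "linear T" "inj T"
    and Tv: "0 < height J (\<lambda>i. T (v i))" and Tw: "0 < height J (\<lambda>i. T (w i))"
    and "i0 \<in> J" "w i0 \<notin> span (v ` J)"
  obtains I J' v' w' s where "card I + s = card J" "card J' = card J + s" "0 < s"
    "\<And>i. i \<in> I \<Longrightarrow> integral_vec (w' i)" "\<And>i. i \<in> J' \<Longrightarrow> integral_vec (v' i)"
    "0 < height I (\<lambda>i. T (w' i))" "0 < height J' (\<lambda>i. T (v' i))"
    "height I (\<lambda>i. T (w' i)) * height J' (\<lambda>i. T (v' i)) \<le>
      fun_count TYPE('k) ^ CARD('k) * (height J (\<lambda>i. T (v i)) * height J (\<lambda>i. T (w i)))"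
proof -
  obtain y B where y: "row_equiv J w y" "B \<subseteq> J" "\<And>i. i \<in> J - B \<Longrightarrow> y i \<in> span (v ` J)"
      "\<And>c. (\<Sum>i\<in>B. c i *\<^sub>R y i) \<in> span (v ` J) \<Longrightarrow> \<forall>i\<in>B. c i = 0"
  proof (rule echelon_row_equiv[of J "span (v ` J)" w])
    show "\<exists>\<phi>::real ^ 'k \<Rightarrow> real. linear \<phi> \<and> (\<forall>u\<in>span (v ` J). \<phi> u = 0) \<and> \<phi> y \<noteq> 0 \<and>
        (\<forall>w. integral_vec w \<longrightarrow> \<phi> w \<in> \<int>)" if "y \<notin> span (v ` J)" for y
      by (rule integral_separation[OF v assms(4) that])
  qed (simp_all add: w)
  have "B \<noteq> {}"
  proof
    assume "B = {}"
    then have yV: "\<And>i. i \<in> J \<Longrightarrow> y i \<in> span (v ` J)" using y(3) by auto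
    \<comment> \<open>Row operations are invertible: if all reduced rows lie in a subspace, so do
      the original ones.\<close>
    have "row_equiv P x x' \<Longrightarrow> (\<And>i. i \<in> P \<Longrightarrow> x' i \<in> V) \<Longrightarrow> subspace V \<Longrightarrow> i \<in> P \<Longrightarrow> x i \<in> V"
      for P :: "'k set" and x x' :: "'k \<Rightarrow> real ^ 'k" and V i
    proof (induction rule: row_equiv.induct)
      case (step x' i l n)
      have "x' j \<in> V" if "j \<in> P" for j
      proof (cases "j = i")
        case True
        have "x' i + of_int n *\<^sub>R x' l \<in> V" "x' l \<in> V"
          using step.prems(1)[of i] step.prems(1)[of l] step.hyps by auto
        then have "(x' i + of_int n *\<^sub>R x' l) - of_int n *\<^sub>R x' l \<in> V"
          using step.prems(2) subspace_diff subspace_scale by blast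
        then show ?thesis using True by simp
      next
        case False
        then show ?thesis using step.prems(1)[OF that] by simp
      qed
      then show ?case using step by blast
    qed
    from this[OF y(1) yV subspace_span] show False using assms(9,10) by blast
  qed
  have sTv: "span ((\<lambda>i. T (v i)) ` J) = T ` span (v ` J)"
    using linear_span_image[OF T(1), of "v ` J"] by (simp add: image_image)
  have hTy: "height J (\<lambda>i. T (y i)) = height J (\<lambda>i. T (w i))"
    by (rule height_row_equiv[OF y(1) _ T(1)]) simp
  have "0 < height J (\<lambda>i. T (y i))" using hTy Tw by simp
  then obtain J' h where J': "J \<subseteq> J'" "card J' = card J + card B" "h ` (J' - J) = B"
    "0 < height J' (\<lambda>k. if k \<in> J then T (v k) else T (y (h k)))"
    "height (J - B) (\<lambda>i. T (y i)) * height J' (\<lambda>k. if k \<in> J then T (v k) else T (y (h k)))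
       \<le> fun_count TYPE('k) ^ card B * height J (\<lambda>i. T (v i)) * height J (\<lambda>i. T (y i))"
  proof (rule height_submodular[OF Tv _ y(2)])
    show "T (y i) \<in> span ((\<lambda>i. T (v i)) ` J)" if "i \<in> J - B" for i
      using y(3)[OF that] unfolding sTv by blast
    fix c assume "(\<Sum>i\<in>B. c i *\<^sub>R T (y i)) \<in> span ((\<lambda>i. T (v i)) ` J)"
    then have "T (\<Sum>i\<in>B. c i *\<^sub>R y i) \<in> T ` span (v ` J)"
      unfolding sTv by (simp add: linear_sum[OF T(1)] linear_scale[OF T(1)])
    then show "\<forall>i\<in>B. c i = 0" using y(4) T(2) by (simp add: inj_image_mem_iff)
  qed blast
  define v' where "v' k = (if k \<in> J then v k else y (h k))" for k
  have v': "(\<lambda>k. if k \<in> J then T (v k) else T (y (h k))) = (\<lambda>k. T (v' k))"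
    by (auto simp: v'_def)
  have yint: "\<And>i. i \<in> J \<Longrightarrow> integral_vec (y i)" using row_equiv_integral[OF y(1) w] by blast
  show ?thesis
  proof (rule that[of "J - B" "card B" J' y v'])
    show "card (J - B) + card B = card J"
      using y(2) by (metis card_Diff_subset card_mono finite le_add_diff_inverse2)
    show "card J' = card J + card B" by fact
    show "0 < card B" using \<open>B \<noteq> {}\<close> by (simp add: card_gt_0_iff)
    show "integral_vec (y i)" if "i \<in> J - B" for i using that yint by auto
    show "integral_vec (v' i)" if "i \<in> J'" for i
      unfolding v'_def using that v(1) yint J'(3) y(2) by auto
    show "0 < height (J - B) (\<lambda>i. T (y i))"
      using height_pos_antimono[of J "\<lambda>i. T (y i)" "J - B"] hTy Tw by auto
    show "0 < height J' (\<lambda>i. T (v' i))" using J'(4) unfolding v' .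
    have "fun_count TYPE('k) ^ card B \<le> fun_count TYPE('k) ^ CARD('k)"
      by (intro power_increasing fun_count_ge_1 card_mono) auto
    then have "fun_count TYPE('k) ^ card B * (height J (\<lambda>i. T (v i)) * height J (\<lambda>i. T (w i))) \<le>
       fun_count TYPE('k) ^ CARD('k) * (height J (\<lambda>i. T (v i)) * height J (\<lambda>i. T (w i)))"
      by (intro mult_right_mono mult_nonneg_nonneg height_nonneg)
    then show "height (J - B) (\<lambda>i. T (y i)) * height J' (\<lambda>i. T (v' i)) \<le>
      fun_count TYPE('k) ^ CARD('k) * (height J (\<lambda>i. T (v i)) * height J (\<lambda>i. T (w i)))"
      using J'(5) unfolding v' hTy by (simp add: mult.assoc)
  qed
qed

text \<open>The factor is the determinant of the change of frame, padded with identity rows outside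
  \<open>J\<close>. It depends neither on \<open>z\<close> nor on \<open>T\<close>, so a comparison
  made at one time of the flow carries over to all others.\<close>

lemma pluecker_span_proportional:
  fixes v w :: "'k::finite \<Rightarrow> real ^ 'k"
  assumes "\<And>i. i \<in> J \<Longrightarrow> w i \<in> span (v ` J)"
  obtains r where "\<And>T z. linear T \<Longrightarrow> pluecker J (\<lambda>i. T (w i)) z = r * pluecker J (\<lambda>i. T (v i)) z"
proof -
  have "\<forall>i\<in>J. \<exists>c. w i = (\<Sum>l\<in>J. c l *\<^sub>R v l)"
    using span_image_sum[OF finite assms] by metis
  then obtain c where c: "\<And>i. i \<in> J \<Longrightarrow> w i = (\<Sum>l\<in>J. c i l *\<^sub>R v l)" by metis
  define M :: "real ^ 'k ^ 'k" where
    "M = (\<chi> i l. if i \<in> J then if l \<in> J then c i l else 0 else if l = i then 1 else 0)"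
  show ?thesis
  proof (rule that[of "det M"])
    fix T :: "real ^ 'k \<Rightarrow> real ^ 'k" and z :: "'k \<Rightarrow> 'k"
    assume T: "linear T"
    define R where "R = (\<chi> i. if i \<in> J then T (v i) else axis (z i) 1)"
    have row: "(M ** R) $ i = (\<Sum>l\<in>UNIV. M $ i $ l *\<^sub>R R $ l)" for i
      by (simp add: vec_eq_iff matrix_matrix_mult_def)
    have "M ** R = (\<chi> i. if i \<in> J then T (w i) else axis (z i) 1)"
    proof -
      have "(M ** R) $ i = T (w i)" if "i \<in> J" for i
      proof -
        have "(M ** R) $ i = (\<Sum>l\<in>J. c i l *\<^sub>R T (v l))" unfolding row
          by (rule sum.mono_neutral_cong_right) (use that in \<open>auto simp: M_def R_def\<close>)
        then show ?thesis using c[OF that] by (simp add: linear_sum[OF T] linear_scale[OF T])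
      qed
      moreover have "(M ** R) $ i = axis (z i) 1" if "i \<notin> J" for i
      proof -
        have "(M ** R) $ i = (\<Sum>l\<in>{i}. R $ l)" unfolding row
          by (rule sum.mono_neutral_cong_right) (use that in \<open>auto simp: M_def\<close>)
        then show ?thesis using that by (simp add: R_def)
      qed
      ultimately show ?thesis by (simp add: vec_eq_iff)
    qed
    then show "pluecker J (\<lambda>i. T (w i)) z = det M * pluecker J (\<lambda>i. T (v i)) z"
      unfolding pluecker_def R_def[symmetric] by (metis det_mul)
  qed
qed

section \<open>The diagonal flow\<close>

text \<open>\<open>flow s A\<close> applies \<open>(y, x) \<mapsto> (y + A x, x)\<close> and then a diagonal matrix of determinant one that
  expands the \<open>y\<close>-coordinates when \<open>s < 1\<close>; matrices at distance \<open>s\<close> are then told apart at unit scale.\<close>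

definition flow :: "real \<Rightarrow> real ^ 'n ^ 'm \<Rightarrow> real ^ ('m + 'n) \<Rightarrow> real ^ ('m::finite + 'n::finite)" where
  "flow s A w = (\<chi> k. case k of
      Inl i \<Rightarrow> s powr (- (real CARD('n) / (real CARD('m) + real CARD('n)))) *
        (w $ Inl i + (\<Sum>j\<in>UNIV. A $ i $ j * w $ Inr j))
    | Inr j \<Rightarrow> s powr (real CARD('m) / (real CARD('m) + real CARD('n))) * w $ Inr j)"

lemma linear_flow: "linear (flow s A)"
proof (rule linearI)
  show "flow s A (v + w) = flow s A v + flow s A w" for v w
    by (auto simp: vec_eq_iff flow_def distrib_left sum.distrib split: sum.split)
  show "flow s A (c *\<^sub>R w) = c *\<^sub>R flow s A w" for c w
    by (auto simp: vec_eq_iff flow_def distrib_left sum_distrib_left sum_distrib_right mult_ac split: sum.split)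
qed

text \<open>The diagonal part normalises the unipotent part: the expansion and contraction rates of
  \<open>flow r\<close> have quotient 1/r, so conjugation scales the matrix by \<open>r\<close>. A
  ball of radius \<open>r\<close> thereby becomes the unit ball.\<close>

lemma flow_flow:
  fixes A X :: "real ^ 'n ^ 'm"
  assumes "0 < s" "0 < r"
  shows "flow s X (flow r A w) = flow (s * r) (A + r *\<^sub>R X) w"
proof -
  define D where "D = real CARD('m) + real CARD('n)"
  have D: "0 < D" unfolding D_def by (intro add_pos_pos) simp_all
  have "r powr (real CARD('m) / D) = r powr (- (real CARD('n) / D)) * r"
  proof -
    have "r powr (- (real CARD('n) / D)) * r powr 1 = r powr (- (real CARD('n) / D) + 1)"
      by (simp only: powr_add)
    also have "- (real CARD('n) / D) + 1 = real CARD('m) / D"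
      using D by (simp add: field_simps) (simp add: D_def)
    finally show ?thesis using assms by simp
  qed
  then show ?thesis
    unfolding flow_def D_def[symmetric] using assms
    by (auto simp: vec_eq_iff powr_mult algebra_simps sum.distrib sum_distrib_left split: sum.split)
qed

lemma flow_1_0: "flow 1 0 w = w"
  by (auto simp: vec_eq_iff flow_def split: sum.split)

lemma flow_inverse:
  assumes "0 < s"
  shows "flow (1 / s) (- (1 / s) *\<^sub>R X) (flow s X w) = w" "flow s X (flow (1 / s) (- (1 / s) *\<^sub>R X) w) = w"
  using assms flow_1_0 by (simp_all add: flow_flow)

lemma inj_flow: "0 < s \<Longrightarrow> inj (flow s X)"
  by (metis flow_inverse(1) injI)

lemma flow_rebase: "0 < r \<Longrightarrow> flow r A w = flow 1 ((1 / r) *\<^sub>R (A - A0)) (flow r A0 w)"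
  by (simp add: flow_flow)

lemma flow_axis:
  "flow s (0 :: real ^ 'n ^ 'm) (axis p 1) = (flow s (0 :: real ^ 'n ^ 'm) (axis p 1) $ p) *\<^sub>R axis p 1"
  by (auto simp: vec_eq_iff flow_def axis_def split: sum.split)

lemma flow_0_diag:
  fixes p :: "'m::finite + 'n::finite"
  shows "flow s 0 (axis p 1) $ p = (case p of
      Inl i \<Rightarrow> s powr (- (real CARD('n) / (real CARD('m) + real CARD('n))))
    | Inr j \<Rightarrow> s powr (real CARD('m) / (real CARD('m) + real CARD('n))))"
  by (auto simp: flow_def axis_def split: sum.split)

lemma prod_flow_diag:
  assumes "0 < s"
  shows "(\<Prod>p\<in>UNIV. flow s (0 :: real ^ 'n ^ 'm) (axis p 1) $ p) = 1"
proof -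
  define D where "D = real CARD('m) + real CARD('n)"
  have "(\<Prod>p\<in>UNIV. flow s (0 :: real ^ 'n ^ 'm) (axis p 1) $ p) =
     (s powr (- (real CARD('n) / D))) ^ CARD('m) * (s powr (real CARD('m) / D)) ^ CARD('n)"
    unfolding flow_0_diag D_def
    by (subst UNIV_Plus_UNIV[symmetric], subst prod.Plus) simp_all
  also have "\<dots> = s powr (- (real CARD('n) / D) * real CARD('m)) * s powr (real CARD('m) / D * real CARD('n))"
    using assms by (simp add: powr_power mult.commute del: powr_minus)
  also have "\<dots> = 1" using assms by (simp add: powr_add[symmetric])
  finally show ?thesis .
qed

lemma det_rows_linear:
  fixes f :: "real ^ 'k \<Rightarrow> real ^ 'k" and R :: "'k::finite \<Rightarrow> real ^ 'k"
  assumes "linear f"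
  shows "det (\<chi> k. f (R k)) = det (\<chi> k. R k) * det (matrix f)"
proof -
  have "(\<chi> k. f (R k)) = (\<chi> k. R k) ** transpose (matrix f)"
  proof -
    have "f (R k) = matrix f *v R k" for k using assms by (simp add: matrix_works)
    then show ?thesis
      by (simp add: vec_eq_iff matrix_matrix_mult_def matrix_vector_mult_def transpose_def mult.commute)
  qed
  then show ?thesis by (simp add: det_mul)
qed

lemma det_flow:
  fixes X :: "real ^ 'n ^ 'm"
  assumes "0 < s"
  shows "det (matrix (flow s X)) = 1"
proof -
  have comp: "det (matrix (flow (s * r) (A + r *\<^sub>R X))) = det (matrix (flow s X)) * det (matrix (flow r A))"
    if "0 < s" "0 < r" for s r and A X :: "real ^ 'n ^ 'm"
  proof -
    have "flow (s * r) (A + r *\<^sub>R X) = flow s X \<circ> flow r A"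
      using that by (simp add: fun_eq_iff flow_flow)
    then show ?thesis by (simp add: matrix_compose linear_flow det_mul)
  qed
  have diag: "det (matrix (flow s 0 :: real ^ ('m + 'n) \<Rightarrow> _)) = 1" if "0 < s" for s
  proof -
    have "det (matrix (flow s 0 :: real ^ ('m + 'n) \<Rightarrow> _)) =
       (\<Prod>p\<in>UNIV. matrix (flow s (0 :: real ^ 'n ^ 'm)) $ p $ p)"
    proof (rule det_diagonal)
      fix i j :: "'m + 'n" assume "i \<noteq> j"
      have "flow s (0 :: real ^ 'n ^ 'm) (axis j 1) $ i = ((flow s (0 :: real ^ 'n ^ 'm) (axis j 1) $ j) *\<^sub>R axis j 1) $ i"
        by (rule arg_cong[where f = "\<lambda>v. v $ i", OF flow_axis])
      then show "matrix (flow s (0 :: real ^ 'n ^ 'm)) $ i $ j = 0"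
        using \<open>i \<noteq> j\<close> by (simp add: matrix_def axis_def)
    qed
    also have "\<dots> = 1" using prod_flow_diag[OF that, where 'm = 'm and 'n = 'n] by (simp add: matrix_def)
    finally show ?thesis .
  qed
  define f where "f X = det (matrix (flow 1 X))" for X :: "real ^ 'n ^ 'm"
  \<comment> \<open>\<open>f\<close> is a homomorphism into the multiplicative group, and conjugation with the diagonal part
    makes it invariant under scaling.\<close>
  have "f X * f X = f (2 *\<^sub>R X)" using comp[of 1 1 X X] by (simp add: f_def scaleR_2)
  also have "\<dots> = f X" using comp[of 1 2 0 X] comp[of 2 1 "2 *\<^sub>R X" 0] diag[of 2]
    by (simp add: f_def)
  finally have "f X = 0 \<or> f X = 1" by auto
  moreover have "f X * f (- X) = 1" using comp[of 1 1 "- X" X] diag[of 1] by (simp add: f_def)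
  ultimately have "f X = 1" by auto
  then show ?thesis using comp[of s 1 X 0] assms diag[of s] by (simp add: f_def)
qed

lemma det_rows_flow: "0 < s \<Longrightarrow> det (\<chi> k. flow s X (R k)) = det (\<chi> k. R k)"
  by (simp add: det_rows_linear linear_flow det_flow)

text \<open>As the flow has determinant one, it may be applied to the completed matrix as a whole;
  it then also acts on the completing vectors, where its effect is explicit.\<close>

lemma pluecker_flow:
  assumes "0 < s"
  shows "pluecker J x z = det (\<chi> i. if i \<in> J then flow s X (x i) else flow s X (axis (z i) 1))"
proof -
  have "pluecker J x z = det (\<chi> i. flow s X (if i \<in> J then x i else axis (z i) 1))"
    unfolding pluecker_def by (rule det_rows_flow[OF assms, symmetric])
  also have "\<dots> = det (\<chi> i. if i \<in> J then flow s X (x i) else flow s X (axis (z i) 1))"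
    by (rule arg_cong[where f = det]) (auto simp: vec_eq_iff)
  finally show ?thesis .
qed

lemma height_UNIV_flow: "0 < s \<Longrightarrow> height UNIV (\<lambda>i. flow s X (x i)) = height UNIV x"
  unfolding height_def pluecker_def by (simp add: det_rows_flow)

text \<open>Each coordinate of the original frame is a determinant of the flowed frame completed by
  flowed basis vectors, whose entries are bounded in terms of \<open>s\<close> and \<open>r\<close>.
  The constant bounds both the loss in one round and the loss of passing to another matrix of the
  same ball.\<close>

lemma height_flow_ge:
  assumes "0 < s"
  obtains c where "0 < c"
    "\<And>J x (X :: real ^ 'n ^ 'm). norm X \<le> r \<Longrightarrow> c * height J x \<le> height J (\<lambda>i. flow s X (x i))"
proof -
  define B where "B = max 1 (s powr (- (real CARD('n) / (real CARD('m) + real CARD('n)))) * max 1 r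
    + s powr (real CARD('m) / (real CARD('m) + real CARD('n))))"
  define C where "C = fun_count TYPE('m + 'n)"
  have B: "1 \<le> B" by (simp add: B_def)
  have C: "1 \<le> C" unfolding C_def by (rule fun_count_ge_1)
  show ?thesis
  proof (rule that[of "1 / (C * B ^ CARD('m + 'n))"])
    show "0 < 1 / (C * B ^ CARD('m + 'n))" using B C by simp
    fix J and x :: "'m + 'n \<Rightarrow> real ^ ('m + 'n)" and X :: "real ^ 'n ^ 'm" assume X: "norm X \<le> r"
    have "\<bar>X $ i $ j\<bar> \<le> max 1 r" for i j
      using component_le_norm_cart[of "X $ i" j] Finite_Cartesian_Product.norm_nth_le[of X i] X by linarith
    then have entry: "\<bar>flow s X (axis p 1) $ q\<bar> \<le> B" for p q
    proof -
      define a where "a = s powr (- (real CARD('n) / (real CARD('m) + real CARD('n))))"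
      define b where "b = s powr (real CARD('m) / (real CARD('m) + real CARD('n)))"
      have ab: "0 \<le> a" "0 \<le> b" by (simp_all add: a_def b_def)
      have Bab: "B = max 1 (a * max 1 r + b)" by (simp add: B_def a_def b_def)
      show ?thesis
      proof (cases q)
        case (Inl i)
        have "\<bar>axis p 1 $ Inl i + (\<Sum>j\<in>UNIV. X $ i $ j * axis p 1 $ Inr j)\<bar> \<le> max 1 r"
          using \<open>\<And>i j. \<bar>X $ i $ j\<bar> \<le> max 1 r\<close>
          by (cases p) (auto simp: axis_def if_distrib[of "\<lambda>t. _ * t"] cong: if_cong)
        then have "\<bar>flow s X (axis p 1) $ q\<bar> \<le> a * max 1 r"
          unfolding flow_def using ab(1) by (simp add: Inl a_def abs_mult mult_left_mono)
        then show ?thesis using ab unfolding Bab by linarith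
      next
        case (Inr j)
        have "\<bar>flow s X (axis p 1) $ q\<bar> \<le> b"
          unfolding flow_def using ab(2) by (simp add: Inr b_def axis_def)
        moreover have "0 \<le> a * max 1 r" using ab by simp
        ultimately show ?thesis unfolding Bab by linarith
      qed
    qed
    have "height J x \<le> C * B ^ CARD('m + 'n) * height J (\<lambda>i. flow s X (x i))"
    proof (rule height_leI)
      fix z
      have "\<bar>pluecker J x z\<bar> \<le> C * (\<Prod>i\<in>-J. B) * height J (\<lambda>i. flow s X (x i))"
        unfolding pluecker_flow[OF assms, of J x z X] C_def
        by (rule det_le_height) (rule entry)
      also have "\<dots> \<le> C * B ^ CARD('m + 'n) * height J (\<lambda>i. flow s X (x i))"
        unfolding prod_constant using C B
        by (intro mult_right_mono mult_left_mono power_increasing card_mono height_nonneg) auto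
      finally show "\<bar>pluecker J x z\<bar> \<le> C * B ^ CARD('m + 'n) * height J (\<lambda>i. flow s X (x i))" .
    qed
    then show "1 / (C * B ^ CARD('m + 'n)) * height J x \<le> height J (\<lambda>i. flow s X (x i))"
      using B C by (simp add: field_simps)
  qed
qed

lemma height_flow_pos:
  assumes "0 < s" "0 < height J x"
  shows "0 < height J (\<lambda>i. flow s X (x i))"
proof -
  obtain c where c: "0 < c" "c * height J x \<le> height J (\<lambda>i. flow s X (x i))"
    using height_flow_ge[OF assms(1), of "norm X"] by (metis order_refl)
  have "0 < c * height J x" using c(1) assms(2) by simp
  then show ?thesis using c(2) by linarith
qed

text \<open>For injective completions this means as many contracting completing vectors as possible,
  hence as many expanding directions as possible in the minor itself. The first alternative belongs
  to ranks at least \<open>CARD('m)\<close>, the second to ranks at most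
  \<open>CARD('m)\<close>.\<close>

definition top_minor :: "('m + 'n) set \<Rightarrow> ('m + 'n \<Rightarrow> 'm + 'n) \<Rightarrow> bool" where
  "top_minor J z \<longleftrightarrow> z ` (- J) \<subseteq> range Inr \<or> range Inr \<subseteq> z ` (- J)"

text \<open>The flow divides a coordinate by the product of the diagonal entries at the completing
  indices. That product is at most 1: either its factors are all contracting, or the complementary
  factors are all expanding while the full product is 1.\<close>

lemma pluecker_flow_mono:
  fixes x :: "'m::finite + 'n::finite \<Rightarrow> real ^ ('m + 'n)"
  assumes s: "0 < s" "s \<le> 1" and z: "top_minor J z"
  shows "\<bar>pluecker J x z\<bar> \<le> \<bar>pluecker J (\<lambda>i. flow s 0 (x i)) z\<bar>"
proof (cases "inj_on z (- J)")
  case False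
  then show ?thesis using pluecker_nonzero_inj[of J x z] by force
next
  case inj: True
  define h where "h p = flow s (0 :: real ^ 'n ^ 'm) (axis p 1) $ p" for p
  have h: "0 < h p" for p unfolding h_def flow_0_diag using s by (simp split: sum.split)
  have hax: "flow s 0 (axis p 1) = h p *s axis p 1" for p
    unfolding h_def scalar_mult_eq_scaleR by (rule flow_axis)
  have hInl: "1 \<le> h (Inl i)" for i
    unfolding h_def flow_0_diag using s powr_mono'[of 0 _ s]
    by (simp add: powr_mono_both' powr_minus_divide powr_le1)
  have hInr: "h (Inr j) \<le> 1" for j
    unfolding h_def flow_0_diag using s by (simp add: powr_le1)
  have "pluecker J x z = det (\<chi> i. if i \<in> J then flow s 0 (x i) else flow s 0 (axis (z i) 1))"
    using pluecker_flow[OF s(1)] .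
  also have "(\<chi> i. if i \<in> J then flow s 0 (x i) else flow s 0 (axis (z i) 1)) =
      (\<chi> i. (if i \<in> J then 1 else h (z i)) *s (if i \<in> J then flow s 0 (x i) else axis (z i) 1))"
    by (auto simp: vec_eq_iff hax)
  also have "det \<dots> = (\<Prod>i\<in>UNIV. if i \<in> J then 1 else h (z i)) * pluecker J (\<lambda>i. flow s 0 (x i)) z"
    unfolding pluecker_def det_rows_mul ..
  also have "(\<Prod>i\<in>UNIV. if i \<in> J then 1 else h (z i)) = (\<Prod>i\<in>-J. h (z i))"
    by (rule prod.mono_neutral_cong_right) auto
  also have "\<dots> = (\<Prod>p\<in>z ` (-J). h p)" using inj by (simp add: prod.reindex)
  finally have eq: "\<bar>pluecker J x z\<bar> = (\<Prod>p\<in>z ` (-J). h p) * \<bar>pluecker J (\<lambda>i. flow s 0 (x i)) z\<bar>"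
    using h by (simp add: abs_mult abs_prod less_imp_le)
  have "(\<Prod>p\<in>z ` (-J). h p) \<le> 1"
  proof (cases "z ` (- J) \<subseteq> range Inr")
    case True
    then show ?thesis using h hInr by (intro prod_le_1) (auto simp: less_imp_le)
  next
    case False
    then have "range Inr \<subseteq> z ` (- J)" using z by (simp add: top_minor_def)
    then have "p \<in> range Inl" if "p \<in> - z ` (- J)" for p
      using that by (cases p) auto
    then have "1 \<le> (\<Prod>p\<in>- z ` (-J). h p)" using hInl by (intro prod_ge_1) blast
    moreover have "(\<Prod>p\<in>z ` (-J). h p) * (\<Prod>p\<in>- z ` (-J). h p) = 1"
      using prod_flow_diag[OF s(1), where 'm = 'm and 'n = 'n]
        prod.Int_Diff[of UNIV h "z ` (- J)"] by (simp add: h_def[abs_def] Compl_eq_Diff_UNIV)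
    moreover have "0 \<le> (\<Prod>p\<in>z ` (-J). h p)" using h by (simp add: prod_nonneg less_imp_le)
    ultimately show ?thesis using mult_left_mono[of 1 "\<Prod>p\<in>- z ` (-J). h p" "\<Prod>p\<in>z ` (-J). h p"] by simp
  qed
  then show ?thesis unfolding eq by (simp add: mult_left_le_one_le prod_nonneg h less_imp_le)
qed

section \<open>Avoiding zeros of minors\<close>

text \<open>One constant bounds the value, a gradient and the quadratic remainder; such bounds pass
  to sums and products without computing derivatives. Radius 2 leaves room for a unit step from any
  point of the unit ball.\<close>

definition taylor2 :: "real \<Rightarrow> ('a::euclidean_space \<Rightarrow> real) \<Rightarrow> bool" where
  "taylor2 L f \<longleftrightarrow> (\<forall>X\<in>cball 0 2. \<bar>f X\<bar> \<le> L \<and>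
     (\<exists>v. norm v \<le> L \<and> (\<forall>Y\<in>cball 0 2. \<bar>f Y - f X - v \<bullet> (Y - X)\<bar> \<le> L * (norm (Y - X))\<^sup>2)))"

lemma taylor2_nonneg: "taylor2 L f \<Longrightarrow> 0 \<le> L"
  unfolding taylor2_def using order_trans[OF abs_ge_zero[of "f 0"], of L] by simp

lemma taylor2_mono:
  assumes "taylor2 L f" "L \<le> L'"
  shows "taylor2 L' f"
  unfolding taylor2_def
proof (intro ballI conjI)
  fix X :: 'a assume X: "X \<in> cball 0 2"
  then obtain v where v: "\<bar>f X\<bar> \<le> L" "norm v \<le> L"
      "\<forall>Y\<in>cball 0 2. \<bar>f Y - f X - v \<bullet> (Y - X)\<bar> \<le> L * (norm (Y - X))\<^sup>2"
    using assms(1) unfolding taylor2_def by blast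
  show "\<bar>f X\<bar> \<le> L'" using v(1) assms(2) by linarith
  have "\<bar>f Y - f X - v \<bullet> (Y - X)\<bar> \<le> L' * (norm (Y - X))\<^sup>2" if "Y \<in> cball 0 2" for Y
    using v(3) that mult_right_mono[OF assms(2), of "(norm (Y - X))\<^sup>2"] by fastforce
  then show "\<exists>v. norm v \<le> L' \<and> (\<forall>Y\<in>cball 0 2. \<bar>f Y - f X - v \<bullet> (Y - X)\<bar> \<le> L' * (norm (Y - X))\<^sup>2)"
    using v(2) assms(2) by (meson order_trans)
qed

lemma taylor2_const: "taylor2 \<bar>c\<bar> (\<lambda>_. c)"
  unfolding taylor2_def by (auto intro!: exI[of _ 0])

lemma taylor2_add:
  assumes "taylor2 L f" "taylor2 M g"
  shows "taylor2 (L + M) (\<lambda>X. f X + g X)"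
  unfolding taylor2_def
proof (intro ballI conjI)
  fix X :: 'a assume X: "X \<in> cball 0 2"
  obtain v where v: "\<bar>f X\<bar> \<le> L" "norm v \<le> L"
      "\<forall>Y\<in>cball 0 2. \<bar>f Y - f X - v \<bullet> (Y - X)\<bar> \<le> L * (norm (Y - X))\<^sup>2"
    using assms(1) X unfolding taylor2_def by blast
  obtain w where w: "\<bar>g X\<bar> \<le> M" "norm w \<le> M"
      "\<forall>Y\<in>cball 0 2. \<bar>g Y - g X - w \<bullet> (Y - X)\<bar> \<le> M * (norm (Y - X))\<^sup>2"
    using assms(2) X unfolding taylor2_def by blast
  show "\<bar>f X + g X\<bar> \<le> L + M" using v(1) w(1) by linarith
  have "\<bar>f Y + g Y - (f X + g X) - (v + w) \<bullet> (Y - X)\<bar> \<le> (L + M) * (norm (Y - X))\<^sup>2"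
    if Y: "Y \<in> cball 0 2" for Y
  proof -
    have "\<bar>(f Y - f X - v \<bullet> (Y - X)) + (g Y - g X - w \<bullet> (Y - X))\<bar> \<le>
        L * (norm (Y - X))\<^sup>2 + M * (norm (Y - X))\<^sup>2"
      using v(3) w(3) Y by (intro order_trans[OF abs_triangle_ineq] add_mono) auto
    then show ?thesis by (simp add: algebra_simps)
  qed
  moreover have "norm (v + w) \<le> L + M" using norm_triangle_ineq[of v w] v(2) w(2) by linarith
  ultimately show "\<exists>v. norm v \<le> L + M \<and>
      (\<forall>Y\<in>cball 0 2. \<bar>f Y + g Y - (f X + g X) - v \<bullet> (Y - X)\<bar> \<le> (L + M) * (norm (Y - X))\<^sup>2)"
    by blast
qed

text \<open>5 = 1 + 4: the gradient contributes \<open>L\<close>, and the remainder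
  \<open>L * h\<^sup>2\<close> is at most \<open>4 * L * h\<close>, as two points of the ball have
  distance at most 4.\<close>

lemma taylor2_lipschitz:
  assumes "taylor2 L f" "X \<in> cball 0 2" "Y \<in> cball 0 2"
  shows "\<bar>f Y - f X\<bar> \<le> 5 * L * norm (Y - X)"
proof -
  obtain v where v: "norm v \<le> L" "\<bar>f Y - f X - v \<bullet> (Y - X)\<bar> \<le> L * (norm (Y - X))\<^sup>2"
    using assms unfolding taylor2_def by blast
  define h where "h = norm (Y - X)"
  have h: "0 \<le> h" "h \<le> 4"
    using assms(2,3) norm_triangle_ineq4[of Y X] by (auto simp: h_def)
  have "\<bar>v \<bullet> (Y - X)\<bar> \<le> norm v * h" unfolding h_def by (rule Cauchy_Schwarz_ineq2)
  also have "\<dots> \<le> L * h" using v(1) h by (intro mult_right_mono)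
  finally have 1: "\<bar>v \<bullet> (Y - X)\<bar> \<le> L * h" .
  have "L * h\<^sup>2 \<le> L * (4 * h)"
    unfolding power2_eq_square using h taylor2_nonneg[OF assms(1)] by (intro mult_left_mono mult_right_mono)
  then show ?thesis using 1 v(2) unfolding h_def[symmetric] by linarith
qed

text \<open>The gradient is given by Leibniz' rule. Of the 27, two come from the remainders of the
  factors and 25 from the product of their increments.\<close>

lemma taylor2_mult:
  assumes "taylor2 L f" "taylor2 M g"
  shows "taylor2 (27 * L * M) (\<lambda>X. f X * g X)"
  unfolding taylor2_def
proof (intro ballI conjI)
  fix X :: 'a assume X: "X \<in> cball 0 2"
  have LM: "0 \<le> L" "0 \<le> M" using assms taylor2_nonneg by auto
  obtain v where v: "\<bar>f X\<bar> \<le> L" "norm v \<le> L"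
      "\<forall>Y\<in>cball 0 2. \<bar>f Y - f X - v \<bullet> (Y - X)\<bar> \<le> L * (norm (Y - X))\<^sup>2"
    using assms(1) X unfolding taylor2_def by blast
  obtain w where w: "\<bar>g X\<bar> \<le> M" "norm w \<le> M"
      "\<forall>Y\<in>cball 0 2. \<bar>g Y - g X - w \<bullet> (Y - X)\<bar> \<le> M * (norm (Y - X))\<^sup>2"
    using assms(2) X unfolding taylor2_def by blast
  have fgX: "\<bar>f X * g X\<bar> \<le> L * M" unfolding abs_mult using v(1) w(1) LM by (intro mult_mono) auto
  then show "\<bar>f X * g X\<bar> \<le> 27 * L * M" using mult_nonneg_nonneg[OF LM] by linarith
  define u where "u = f X *\<^sub>R w + g X *\<^sub>R v"
  have "norm u \<le> norm (f X *\<^sub>R w) + norm (g X *\<^sub>R v)" unfolding u_def by (rule norm_triangle_ineq)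
  also have "\<dots> \<le> L * M + M * L" unfolding norm_scaleR real_norm_def
    using v(1,2) w(1,2) LM by (intro add_mono mult_mono) auto
  finally have "norm u \<le> L * M + L * M" by (simp only: mult.commute)
  then have "norm u \<le> 27 * L * M" using mult_nonneg_nonneg[OF LM] by linarith
  moreover have "\<bar>f Y * g Y - f X * g X - u \<bullet> (Y - X)\<bar> \<le> 27 * L * M * (norm (Y - X))\<^sup>2"
    if Y: "Y \<in> cball 0 2" for Y
  proof -
    define h where "h = norm (Y - X)"
    have h: "0 \<le> h" by (simp add: h_def)
    have bounds: "\<bar>f Y - f X\<bar> \<le> 5 * L * h" "\<bar>g Y - g X\<bar> \<le> 5 * M * h"
        "\<bar>f Y - f X - v \<bullet> (Y - X)\<bar> \<le> L * h\<^sup>2" "\<bar>g Y - g X - w \<bullet> (Y - X)\<bar> \<le> M * h\<^sup>2"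
      using taylor2_lipschitz[OF assms(1) X Y] taylor2_lipschitz[OF assms(2) X Y] v(3) w(3) Y
      unfolding h_def by blast+
    have "f Y * g Y - f X * g X - u \<bullet> (Y - X) =
       f X * (g Y - g X - w \<bullet> (Y - X)) + g X * (f Y - f X - v \<bullet> (Y - X)) + (f Y - f X) * (g Y - g X)"
      by (simp add: u_def inner_add_left algebra_simps)
    also have "\<bar>\<dots>\<bar> \<le> \<bar>f X * (g Y - g X - w \<bullet> (Y - X))\<bar> + \<bar>g X * (f Y - f X - v \<bullet> (Y - X))\<bar>
         + \<bar>(f Y - f X) * (g Y - g X)\<bar>" by linarith
    also have "\<dots> \<le> L * (M * h\<^sup>2) + M * (L * h\<^sup>2) + (5 * L * h) * (5 * M * h)"
      unfolding abs_mult by (intro add_mono mult_mono v(1) w(1) bounds) (use LM h in auto)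
    also have "\<dots> = 27 * L * M * h\<^sup>2" by (simp add: power2_eq_square algebra_simps)
    finally show ?thesis unfolding h_def .
  qed
  ultimately show "\<exists>v. norm v \<le> 27 * L * M \<and>
      (\<forall>Y\<in>cball 0 2. \<bar>f Y * g Y - f X * g X - v \<bullet> (Y - X)\<bar> \<le> 27 * L * M * (norm (Y - X))\<^sup>2)"
    by blast
qed

lemma taylor2_sum:
  assumes "finite S" "\<And>i. i \<in> S \<Longrightarrow> taylor2 L (f i)"
  shows "taylor2 (real (card S) * L) (\<lambda>X. \<Sum>i\<in>S. f i X)"
  using assms
proof (induction S rule: finite_induct)
  case empty
  show ?case using taylor2_const[of 0] by simp
next
  case (insert i S)
  then have "taylor2 (L + real (card S) * L) (\<lambda>X. f i X + (\<Sum>i\<in>S. f i X))"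
    by (intro taylor2_add) auto
  then show ?case using insert by (simp add: algebra_simps)
qed

lemma taylor2_prod:
  assumes "finite S" "\<And>i. i \<in> S \<Longrightarrow> taylor2 L (f i)"
  shows "taylor2 ((27 * L) ^ card S) (\<lambda>X. \<Prod>i\<in>S. f i X)"
  using assms
proof (induction S rule: finite_induct)
  case empty
  show ?case using taylor2_const[of 1] by simp
next
  case (insert i S)
  then have "taylor2 (27 * L * (27 * L) ^ card S) (\<lambda>X. f i X * (\<Prod>i\<in>S. f i X))"
    by (intro taylor2_mult) auto
  then show ?case using insert by simp
qed

lemma taylor2_entry: "taylor2 2 (\<lambda>X :: real ^ 'n ^ 'm. - X $ i $ j)"
  unfolding taylor2_def
proof (intro ballI conjI)
  fix X :: "real ^ 'n ^ 'm" assume X: "X \<in> cball 0 2"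
  show "\<bar>- X $ i $ j\<bar> \<le> 2"
    using component_le_norm_cart[of "X $ i" j] Finite_Cartesian_Product.norm_nth_le[of X i] X by simp
  show "\<exists>v :: real ^ 'n ^ 'm. norm v \<le> 2 \<and>
      (\<forall>Y\<in>cball 0 2. \<bar>- Y $ i $ j - - X $ i $ j - v \<bullet> (Y - X)\<bar> \<le> 2 * (norm (Y - X))\<^sup>2)"
    by (rule exI[of _ "axis i (axis j (- 1))"])
       (simp add: inner_axis' norm_axis_1 norm_eq_sqrt_inner inner_axis_axis)
qed

text \<open>With the flow moved to the completing vectors the frame is constant, and
  \<open>X\<close> enters through a unipotent matrix with entries 0, 1 and
  \<open>- X $ i $ j\<close>.\<close>

lemma pluecker_flow_1:
  "pluecker J (\<lambda>i. flow 1 X (b i)) z =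
    det (\<chi> i. if i \<in> J then b i else flow 1 (- X) (axis (z i) 1))"
proof -
  have "flow 1 (- X) (flow 1 X (b i)) = b i" for i by (simp add: flow_flow flow_1_0)
  then show ?thesis
    using pluecker_flow[of 1 J "\<lambda>i. flow 1 X (b i)" z "- X"] by (simp cong: if_cong)
qed

text \<open>By multilinear expansion the minor is a combination of coordinates of \<open>b\<close>,
  with coefficients polynomial in \<open>X\<close> that do not involve \<open>b\<close>. Hence the
  bound is proportional to \<open>height J b\<close>.\<close>

lemma taylor2_pluecker:
  obtains L where "1 \<le> L"
    "\<And>J b z. taylor2 (L * height J b) (\<lambda>X :: real ^ 'n ^ 'm. pluecker J (\<lambda>i. flow 1 X (b i)) z)"
proof -
  define C where "C = fun_count TYPE('m + 'n)"
  define P where "P = (27 * 2 :: real) ^ CARD('m + 'n)"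
  define L where "L = C * (27 * P)"
  have C: "1 \<le> C" unfolding C_def by (rule fun_count_ge_1)
  have P: "1 \<le> P" unfolding P_def by (rule one_le_power) simp
  have "1 * 1 \<le> C * (27 * P)" using C P by (intro mult_mono) auto
  then have L: "1 \<le> L" by (simp add: L_def)
  show ?thesis
  proof (rule that[OF L])
    fix J z and b :: "'m + 'n \<Rightarrow> real ^ ('m + 'n)"
    have entry: "taylor2 2 (\<lambda>X :: real ^ 'n ^ 'm. flow 1 (- X) (axis p 1) $ q)" for p q
    proof -
      consider "p = q" | i j where "q = Inl i" "p = Inr j" | "p \<noteq> q" "\<not> (\<exists>i j. q = Inl i \<and> p = Inr j)"
        by blast
      then show ?thesis
      proof cases
        case 1
        then have "(\<lambda>X :: real ^ 'n ^ 'm. flow 1 (- X) (axis p 1) $ q) = (\<lambda>_. 1)"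
          by (auto simp: flow_def axis_def fun_eq_iff split: sum.split)
        then show ?thesis using taylor2_mono[OF taylor2_const[of 1], of 2] by simp
      next
        case 2
        then have "(\<lambda>X :: real ^ 'n ^ 'm. flow 1 (- X) (axis p 1) $ q) = (\<lambda>X. - X $ i $ j)"
          by (auto simp: flow_def axis_def fun_eq_iff if_distrib[of "\<lambda>t. _ * t"] cong: if_cong)
        then show ?thesis using taylor2_entry by simp
      next
        case 3
        then have "(\<lambda>X :: real ^ 'n ^ 'm. flow 1 (- X) (axis p 1) $ q) = (\<lambda>_. 0)"
          by (cases p; cases q) (auto simp: flow_def axis_def fun_eq_iff)
        then show ?thesis using taylor2_mono[OF taylor2_const[of 0], of 2] by simp
      qed
    qed
    have monomial: "taylor2 (27 * P * height J b)
       (\<lambda>X :: real ^ 'n ^ 'm. (\<Prod>i\<in>-J. flow 1 (- X) (axis (z i) 1) $ f i) * pluecker J b f)" for f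
    proof -
      have "taylor2 (27 * (27 * 2) ^ card (-J) * \<bar>pluecker J b f\<bar>)
         (\<lambda>X :: real ^ 'n ^ 'm. (\<Prod>i\<in>-J. flow 1 (- X) (axis (z i) 1) $ f i) * pluecker J b f)"
        by (intro taylor2_mult taylor2_prod taylor2_const entry) auto
      moreover have "27 * (27 * 2) ^ card (-J) * \<bar>pluecker J b f\<bar> \<le> 27 * P * height J b"
        unfolding P_def by (intro mult_mono pluecker_le_height power_increasing card_mono) auto
      ultimately show ?thesis by (rule taylor2_mono)
    qed
    let ?S = "{f :: 'm + 'n \<Rightarrow> 'm + 'n. \<forall>i\<in>J. f i = i}"
    have "taylor2 (real (card ?S) * (27 * P * height J b))
      (\<lambda>X :: real ^ 'n ^ 'm. \<Sum>f\<in>?S. (\<Prod>i\<in>-J. flow 1 (- X) (axis (z i) 1) $ f i) * pluecker J b f)"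
      by (intro taylor2_sum monomial) simp
    then have "taylor2 (real (card ?S) * (27 * P * height J b))
      (\<lambda>X :: real ^ 'n ^ 'm. pluecker J (\<lambda>i. flow 1 X (b i)) z)"
      unfolding pluecker_flow_1 det_pluecker_expand .
    moreover have "real (card ?S) * (27 * P * height J b) \<le> L * height J b"
    proof -
      have "real (card ?S) \<le> C" unfolding C_def fun_count_def by (intro of_nat_mono card_mono) auto
      then have "real (card ?S) * (27 * P * height J b) \<le> C * (27 * P * height J b)"
        using P height_nonneg[of J b] by (intro mult_right_mono) auto
      then show ?thesis by (simp add: L_def mult.assoc)
    qed
    ultimately show "taylor2 (L * height J b) (\<lambda>X :: real ^ 'n ^ 'm. pluecker J (\<lambda>i. flow 1 X (b i)) z)"
      by (rule taylor2_mono)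
  qed
qed

text \<open>Changing the entry in row \<open>m\<close> and column \<open>n\<close> affects only the
  image of the completing vector \<open>Inr n\<close>, which moves by \<open>- t\<close> times the
  basis vector \<open>Inl m\<close>. As that vector is used in slot \<open>i\<close> only, the minor
  is exactly affine in \<open>t\<close>.\<close>

lemma pluecker_flow_directional:
  fixes X :: "real ^ 'n ^ 'm"
  assumes "i \<notin> J" "z i = Inr n" "\<And>k. k \<notin> J \<Longrightarrow> k \<noteq> i \<Longrightarrow> z k \<noteq> Inr n"
  shows "pluecker J (\<lambda>k. flow 1 (X + t *\<^sub>R axis m (axis n 1)) (b k)) z =
    pluecker J (\<lambda>k. flow 1 X (b k)) z - t * pluecker J (\<lambda>k. flow 1 X (b k)) (z(i := Inl m))"
proof -
  define E :: "real ^ 'n ^ 'm" where "E = axis m (axis n 1)"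
  define R where "R k = (if k \<in> J then b k else flow 1 (- X) (axis (z k) 1))" for k
  define \<phi> where "\<phi> y = det (\<chi> k. if k = i then y else R k)" for y
  have lin: "linear \<phi>" unfolding \<phi>_def by (rule linear_det_row)
  have E: "flow 1 (- (X + t *\<^sub>R E)) (axis p 1) = flow 1 (- X) (axis p 1)" if "p \<noteq> Inr n" for p
  proof -
    have "(\<Sum>c\<in>UNIV. E $ a $ c * axis p 1 $ Inr c) = 0" for a
      by (rule sum.neutral) (use that in \<open>auto simp: E_def axis_def\<close>)
    then show ?thesis
      by (auto simp: vec_eq_iff flow_def algebra_simps sum.distrib sum_subtractf split: sum.split)
         (simp add: sum_distrib_left[symmetric] mult.assoc)
  qed
  have En: "flow 1 (- (X + t *\<^sub>R E)) (axis (Inr n) 1) = flow 1 (- X) (axis (Inr n) 1) - t *\<^sub>R axis (Inl m) 1"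
    by (auto simp: vec_eq_iff flow_def E_def axis_def if_distrib[of "\<lambda>t. _ * t"] split: sum.split cong: if_cong)
  have Inl: "flow 1 (- X) (axis (Inl m) 1) = axis (Inl m) 1"
    by (auto simp: vec_eq_iff flow_def axis_def split: sum.split)
  have "pluecker J (\<lambda>k. flow 1 (X + t *\<^sub>R E) (b k)) z = \<phi> (flow 1 (- X) (axis (Inr n) 1) - t *\<^sub>R axis (Inl m) 1)"
    unfolding pluecker_flow_1 \<phi>_def En[symmetric]
    by (rule arg_cong[where f = det]) (use assms E in \<open>auto simp: vec_eq_iff R_def\<close>)
  also have "\<dots> = \<phi> (flow 1 (- X) (axis (Inr n) 1)) - t * \<phi> (axis (Inl m) 1)"
    using linear_diff[OF lin] linear_scale[OF lin] by simp
  also have "\<phi> (flow 1 (- X) (axis (Inr n) 1)) = pluecker J (\<lambda>k. flow 1 X (b k)) z"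
    unfolding pluecker_flow_1 \<phi>_def
    by (rule arg_cong[where f = det]) (use assms in \<open>auto simp: vec_eq_iff R_def\<close>)
  also have "\<phi> (axis (Inl m) 1) = \<phi> (flow 1 (- X) (axis (Inl m) 1))" unfolding Inl ..
  also have "\<dots> = pluecker J (\<lambda>k. flow 1 X (b k)) (z(i := Inl m))"
    unfolding pluecker_flow_1 \<phi>_def
    by (rule arg_cong[where f = det]) (use assms in \<open>auto simp: vec_eq_iff R_def\<close>)
  finally show ?thesis unfolding E_def .
qed

section \<open>Escape from zeros of minors inside a diffuse set\<close>

text \<open>All that remains of the measure in the game: around every point, at every scale up to 1,
  the set is not contained in a thin strip along a hyperplane. The factor \<open>norm v\<close>
  spares a normalisation and makes \<open>v = 0\<close> harmless.\<close>

definition diffuse :: "real \<Rightarrow> 'a::euclidean_space set \<Rightarrow> bool" where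
  "diffuse \<gamma> K \<longleftrightarrow> (\<forall>X\<in>K. \<forall>s v c. 0 < s \<and> s \<le> 1 \<longrightarrow> (\<exists>Y\<in>K. dist X Y \<le> s \<and> \<gamma> * s * norm v \<le> \<bar>v \<bullet> Y - c\<bar>))"

text \<open>Near \<open>X\<close> the function is affine up to \<open>L * H * s\<^sup>2\<close>.
  Some point of \<open>K\<close> at distance at most \<open>s\<close> makes the affine part at least
  \<open>4 * c' * H\<close>, the choice of \<open>s\<close> keeps the error within
  \<open>c' * H\<close>, and the Lipschitz bound loses at most another \<open>c' * H\<close> on the
  ball around that point. The final halving in \<open>s\<close> keeps this ball inside
  \<open>cball X r\<close>.\<close>

lemma diffuse_escape:
  fixes f :: "'a::euclidean_space \<Rightarrow> real"
  assumes "diffuse \<gamma> K" "0 < \<gamma>" and f: "taylor2 (L * H) f" and H: "0 < H" and L: "0 < L"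
    and X: "X \<in> K" "cball X r \<subseteq> cball 0 1" and r: "0 < r" "r \<le> 1" and c: "0 < c" "c \<le> 1"
    and e: "norm e \<le> 1" and fg: "\<And>t. f (X + t *\<^sub>R e) = f X - t * g" and g: "c * H \<le> \<bar>g\<bar>"
  defines "s \<equiv> r * min 1 (c * \<gamma> / (2 * L)) / 2"
  defines "c' \<equiv> c * \<gamma> * s / 4"
  shows "\<exists>Y\<in>K. cball Y (min s (c' / (5 * L))) \<subseteq> cball X r \<and>
    (\<forall>Z\<in>cball Y (min s (c' / (5 * L))). c' * H \<le> \<bar>f Z\<bar>)"
proof -
  have s: "0 < s" "s \<le> r / 2" "s \<le> c * \<gamma> / (2 * L) / 2"
  proof -
    show "0 < s" unfolding s_def using r c assms(2) L by simp
    have m: "0 < min 1 (c * \<gamma> / (2 * L))" using c assms(2) L by simp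
    have "r * min 1 (c * \<gamma> / (2 * L)) \<le> r * 1" using r by (intro mult_left_mono) auto
    then show "s \<le> r / 2" by (simp add: s_def)
    have "r * min 1 (c * \<gamma> / (2 * L)) \<le> 1 * (c * \<gamma> / (2 * L))" using r m by (intro mult_mono) auto
    then show "s \<le> c * \<gamma> / (2 * L) / 2" unfolding s_def mult_1 by (rule divide_right_mono) simp
  qed
  have c': "0 < c'" unfolding c'_def using s c assms(2) by simp
  have X1: "norm X \<le> 1" using X(2) r by (auto dest!: subsetD[of _ _ X])
  obtain v where v: "\<And>Y. norm Y \<le> 2 \<Longrightarrow> \<bar>f Y - f X - v \<bullet> (Y - X)\<bar> \<le> L * H * (norm (Y - X))\<^sup>2"
    using f X1 unfolding taylor2_def by (metis mem_cball_0 one_le_numeral order_trans)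
  \<comment> \<open>The gradient is known only through the remainder bound. Along \<open>e\<close>
    the function is exactly affine with slope \<open>- g\<close>, and small \<open>t\<close>
    identify \<open>v \<bullet> e\<close> with \<open>- g\<close>; this bounds \<open>norm v\<close>
    from below.\<close>
  have small: "\<bar>g + v \<bullet> e\<bar> \<le> L * H * t" if t: "0 < t" "t \<le> 1" for t
  proof -
    have "norm (X + t *\<^sub>R e) \<le> norm X + t * norm e" using norm_triangle_ineq[of X "t *\<^sub>R e"] t by simp
    also have "\<dots> \<le> 1 + 1 * 1" using X1 t e by (intro add_mono mult_mono) auto
    finally have "\<bar>f (X + t *\<^sub>R e) - f X - v \<bullet> (t *\<^sub>R e)\<bar> \<le> L * H * (norm (t *\<^sub>R e))\<^sup>2"
      using v[of "X + t *\<^sub>R e"] by simp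
    also have "f (X + t *\<^sub>R e) - f X - v \<bullet> (t *\<^sub>R e) = - (t * (g + v \<bullet> e))"
      unfolding fg by (simp add: algebra_simps)
    also have "L * H * (norm (t *\<^sub>R e))\<^sup>2 \<le> L * H * t\<^sup>2"
      using t e L H by (intro mult_left_mono power_mono) (auto simp: mult_left_le)
    finally have "t * \<bar>g + v \<bullet> e\<bar> \<le> t * (L * H * t)"
      using t by (simp add: abs_mult power2_eq_square mult_ac)
    then show ?thesis using t by simp
  qed
  have "g + v \<bullet> e = 0"
  proof (rule ccontr)
    assume nz: "g + v \<bullet> e \<noteq> 0"
    define t where "t = min 1 (\<bar>g + v \<bullet> e\<bar> / (2 * L * H))"
    have "0 < t" "t \<le> 1" using nz L H by (auto simp: t_def)
    moreover have "L * H * t \<le> L * H * (\<bar>g + v \<bullet> e\<bar> / (2 * L * H))"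
      unfolding t_def using L H by (intro mult_left_mono) auto
    ultimately have "\<bar>g + v \<bullet> e\<bar> \<le> \<bar>g + v \<bullet> e\<bar> / 2" using small[of t] L H by simp
    then show False using nz by simp
  qed
  then have "\<bar>g\<bar> = \<bar>v \<bullet> e\<bar>" by linarith
  also have "\<dots> \<le> norm v * norm e" by (rule Cauchy_Schwarz_ineq2)
  also have "\<dots> \<le> norm v" using e by (simp add: mult_left_le)
  finally have nv: "c * H \<le> norm v" using g by linarith
  have "s \<le> 1" using s r by linarith
  then obtain Y where Y: "Y \<in> K" "dist X Y \<le> s" "\<gamma> * s * norm v \<le> \<bar>v \<bullet> Y - (v \<bullet> X - f X)\<bar>"
    using assms(1) X(1) s(1) unfolding diffuse_def by blast
  have nYX: "norm (Y - X) \<le> s" using Y(2) by (simp add: dist_norm norm_minus_commute)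
  have Y1: "norm Y \<le> 1"
  proof -
    have "Y \<in> cball X r" using Y(2) s r by simp
    then show ?thesis using X(2) by auto
  qed
  have "\<bar>f Y - f X - v \<bullet> (Y - X)\<bar> \<le> L * H * (norm (Y - X))\<^sup>2" using v Y1 by simp
  also have "\<dots> \<le> L * H * (s * (c * \<gamma> / (2 * L) / 2))"
    unfolding power2_eq_square using L H s nYX by (intro mult_left_mono mult_mono) auto
  also have "\<dots> = c' * H" unfolding c'_def using L by (simp add: field_simps)
  finally have e1: "\<bar>f Y - f X - v \<bullet> (Y - X)\<bar> \<le> c' * H" .
  have "4 * (c' * H) = \<gamma> * s * (c * H)" by (simp add: c'_def)
  also have "\<dots> \<le> \<gamma> * s * norm v" using nv s assms(2) by (intro mult_left_mono) auto
  also have "\<dots> \<le> \<bar>f X + v \<bullet> (Y - X)\<bar>" using Y(3) by (simp add: inner_diff_right algebra_simps)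
  finally have e2: "4 * (c' * H) \<le> \<bar>f X + v \<bullet> (Y - X)\<bar>" .
  have cH: "0 \<le> c' * H" using c' H by simp
  have fY: "2 * (c' * H) \<le> \<bar>f Y\<bar>" using e1 e2 cH by linarith
  show ?thesis
  proof (intro bexI[OF _ Y(1)] conjI ballI)
    show sub: "cball Y (min s (c' / (5 * L))) \<subseteq> cball X r"
    proof
      fix Z assume "Z \<in> cball Y (min s (c' / (5 * L)))"
      then have "dist Y Z \<le> s" by simp
      then show "Z \<in> cball X r" using dist_triangle[of X Z Y] Y(2) s by simp
    qed
    fix Z assume Z: "Z \<in> cball Y (min s (c' / (5 * L)))"
    then have "Z \<in> cball 0 1" using sub X(2) by blast
    then have "\<bar>f Z - f Y\<bar> \<le> 5 * (L * H) * norm (Z - Y)"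
      using taylor2_lipschitz[OF f, of Y Z] Y1 by simp
    also have "\<dots> \<le> 5 * (L * H) * (c' / (5 * L))"
      using Z L H by (intro mult_left_mono) (auto simp: dist_norm norm_minus_commute)
    also have "\<dots> = c' * H" using L by simp
    finally show "c' * H \<le> \<bar>f Z\<bar>" using fY by linarith
  qed
qed

text \<open>Replacing a completing vector \<open>Inl m\<close> by \<open>Inr n\<close> gives a Pluecker coordinate whose derivative in the
  entry \<open>(m, n)\<close> is, up to sign, the previous one; hence the induction on the number of \<open>Inl\<close>'s.\<close>

lemma minor_climb:
  fixes \<gamma> c r :: real
  assumes "0 < \<gamma>" "\<gamma> \<le> 1" "0 < c" "c \<le> 1" "0 < r" "r \<le> 1"
  shows "\<exists>c' r'. 0 < c' \<and> 0 < r' \<and> (\<forall>(K :: (real ^ 'n ^ 'm) set) J b z X. diffuse \<gamma> K \<longrightarrow> 0 < height J b \<longrightarrow>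
      inj_on z (- J) \<longrightarrow> card {i. i \<notin> J \<and> z i \<in> range Inl} \<le> q \<longrightarrow> X \<in> K \<longrightarrow> cball X r \<subseteq> cball 0 1 \<longrightarrow>
      (\<forall>Y\<in>cball X r. c * height J b \<le> \<bar>pluecker J (\<lambda>i. flow 1 Y (b i)) z\<bar>) \<longrightarrow>
      (\<exists>z' Y. top_minor J z' \<and> Y \<in> K \<and> cball Y r' \<subseteq> cball X r \<and>
        (\<forall>Z\<in>cball Y r'. c' * height J b \<le> \<bar>pluecker J (\<lambda>i. flow 1 Z (b i)) z'\<bar>)))"
  using assms(3-6)
proof (induction q arbitrary: c r)
  case 0
  show ?case
  proof (rule exI[of _ c], rule exI[of _ r], intro conjI allI impI 0)
    fix K :: "(real ^ 'n ^ 'm) set" and J b and z :: "'m + 'n \<Rightarrow> 'm + 'n" and X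
    assume "card {i. i \<notin> J \<and> z i \<in> range (Inl :: 'm \<Rightarrow> 'm + 'n)} \<le> 0"
    then have "{i. i \<notin> J \<and> z i \<in> range (Inl :: 'm \<Rightarrow> 'm + 'n)} = {}" by simp
    then have "z i \<in> range Inr" if "i \<in> - J" for i
      using that by (cases "z i") auto
    then have "top_minor J z" unfolding top_minor_def by blast
    moreover assume "X \<in> K" "\<forall>Y\<in>cball X r. c * height J b \<le> \<bar>pluecker J (\<lambda>i. flow 1 Y (b i)) z\<bar>"
    ultimately show "\<exists>z' Y. top_minor J z' \<and> Y \<in> K \<and> cball Y r \<subseteq> cball X r \<and>
        (\<forall>Z\<in>cball Y r. c * height J b \<le> \<bar>pluecker J (\<lambda>i. flow 1 Z (b i)) z'\<bar>)" by blast
  qed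
next
  case (Suc q)
  obtain L where L: "1 \<le> L" "\<And>J b z. taylor2 (L * height J b)
      (\<lambda>X :: real ^ 'n ^ 'm. pluecker J (\<lambda>i. flow 1 X (b i)) z)"
    using taylor2_pluecker by blast
  define s where "s = r * min 1 (c * \<gamma> / (2 * L)) / 2"
  define c1 where "c1 = c * \<gamma> * s / 4"
  define r1 where "r1 = min s (c1 / (5 * L))"
  have s: "0 < s" "s \<le> 1"
  proof -
    show "0 < s" unfolding s_def using Suc.prems assms L by simp
    have "r * min 1 (c * \<gamma> / (2 * L)) \<le> 1 * 1" using Suc.prems assms L(1) by (intro mult_mono) auto
    then show "s \<le> 1" unfolding s_def by simp
  qed
  have c1: "0 < c1" unfolding c1_def using s Suc.prems assms by simp
  have "c * \<gamma> * s \<le> 1 * 1 * 1" using s Suc.prems assms by (intro mult_mono) auto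
  then have c1': "c1 \<le> 1" by (simp add: c1_def)
  have r1: "0 < r1" "r1 \<le> 1" using s c1 L(1) by (auto simp: r1_def)
  obtain c' r' where IH: "0 < c'" "0 < r'"
    "\<And>(K :: (real ^ 'n ^ 'm) set) J b z X. diffuse \<gamma> K \<Longrightarrow> 0 < height J b \<Longrightarrow>
      inj_on z (- J) \<Longrightarrow> card {i. i \<notin> J \<and> z i \<in> range Inl} \<le> q \<Longrightarrow> X \<in> K \<Longrightarrow> cball X r1 \<subseteq> cball 0 1 \<Longrightarrow>
      (\<forall>Y\<in>cball X r1. c1 * height J b \<le> \<bar>pluecker J (\<lambda>i. flow 1 Y (b i)) z\<bar>) \<Longrightarrow>
      (\<exists>z' Y. top_minor J z' \<and> Y \<in> K \<and> cball Y r' \<subseteq> cball X r1 \<and>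
        (\<forall>Z\<in>cball Y r'. c' * height J b \<le> \<bar>pluecker J (\<lambda>i. flow 1 Z (b i)) z'\<bar>))"
    using Suc.IH[OF c1 c1' r1] by blast
  show ?case
  \<comment> \<open>The minima allow the climb to stop early: a minor may be a top minor although
    its completion still contains some \<open>Inl\<close>.\<close>
  proof (rule exI[of _ "min c c'"], rule exI[of _ "min r r'"], intro conjI allI impI)
    show "0 < min c c'" "0 < min r r'" using IH Suc.prems by auto
    fix K :: "(real ^ 'n ^ 'm) set" and J b and z :: "'m + 'n \<Rightarrow> 'm + 'n" and X
    assume K: "diffuse \<gamma> K" and H: "0 < height J b" and inj: "inj_on z (- J)"
      and card: "card {i. i \<notin> J \<and> z i \<in> range Inl} \<le> Suc q" and X: "X \<in> K" "cball X r \<subseteq> cball 0 1"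
      and large: "\<forall>Y\<in>cball X r. c * height J b \<le> \<bar>pluecker J (\<lambda>i. flow 1 Y (b i)) z\<bar>"
    have min_le: "min c c' * height J b \<le> c * height J b" "min c c' * height J b \<le> c' * height J b"
      using H by (auto intro!: mult_right_mono)
    show "\<exists>z' Y. top_minor J z' \<and> Y \<in> K \<and> cball Y (min r r') \<subseteq> cball X r \<and>
        (\<forall>Z\<in>cball Y (min r r'). min c c' * height J b \<le> \<bar>pluecker J (\<lambda>i. flow 1 Z (b i)) z'\<bar>)"
    proof (cases "top_minor J z")
      case True
      moreover have "cball X (min r r') \<subseteq> cball X r" by (rule subset_cball) simp
      ultimately show ?thesis using X(1) large min_le(1) by (meson order_trans subsetD)
    next
      case False
      \<comment> \<open>Failing to be a top minor means that some \<open>Inl m\<close> is used while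
        some \<open>Inr n\<close> is free; since \<open>Inr n\<close> is free, the exchange keeps
        the completion injective.\<close>
      then obtain i where i: "i \<notin> J" "z i \<notin> range Inr" unfolding top_minor_def by blast
      then obtain m where m: "z i = Inl m" by (cases "z i") auto
      obtain n where n: "Inr n \<notin> z ` (- J)" using False unfolding top_minor_def by blast
      define z' where "z' = z(i := Inr n)"
      have zz: "z'(i := Inl m) = z" using m by (auto simp: z'_def)
      define f where "f Y = pluecker J (\<lambda>k. flow 1 Y (b k)) z'" for Y :: "real ^ 'n ^ 'm"
      define e :: "real ^ 'n ^ 'm" where "e = axis m (axis n 1)"
      have "\<exists>Y\<in>K. cball Y (min s (c1 / (5 * L))) \<subseteq> cball X r \<and>
          (\<forall>Z\<in>cball Y (min s (c1 / (5 * L))). c1 * height J b \<le> \<bar>f Z\<bar>)"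
        unfolding c1_def s_def
      proof (rule diffuse_escape[OF K assms(1) _ H _ X])
        show "taylor2 (L * height J b) f" unfolding f_def by (rule L(2))
        show "0 < L" using L(1) by simp
        show "0 < r" "r \<le> 1" "0 < c" "c \<le> 1" by fact+
        show "norm e \<le> 1" by (simp add: e_def norm_eq_sqrt_inner inner_axis_axis)
        show "f (X + t *\<^sub>R e) = f X - t * pluecker J (\<lambda>k. flow 1 X (b k)) z" for t
          unfolding f_def e_def zz[symmetric]
          using pluecker_flow_directional[of i J z' n X t m b] i n
          unfolding zz by (force simp: z'_def)
        show "c * height J b \<le> \<bar>pluecker J (\<lambda>k. flow 1 X (b k)) z\<bar>"
          using large Suc.prems by simp
      qed
      then obtain Y where Y: "Y \<in> K" "cball Y r1 \<subseteq> cball X r" "\<forall>Z\<in>cball Y r1. c1 * height J b \<le> \<bar>f Z\<bar>"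
        unfolding r1_def by blast
      have "z k \<noteq> Inr n" if "k \<notin> J" for k using n that by (metis ComplI image_eqI)
      then have inj': "inj_on z' (- J)"
        using inj unfolding z'_def inj_on_def by (metis ComplD fun_upd_apply)
      have "{k. k \<notin> J \<and> z' k \<in> range Inl} \<subset> {k. k \<notin> J \<and> z k \<in> range Inl}"
      proof
        show "{k. k \<notin> J \<and> z' k \<in> range Inl} \<subseteq> {k. k \<notin> J \<and> z k \<in> range Inl}" by (auto simp: z'_def)
        have "i \<in> {k. k \<notin> J \<and> z k \<in> range Inl}" "i \<notin> {k. k \<notin> J \<and> z' k \<in> range Inl}"
          using i m by (auto simp: z'_def)
        then show "{k. k \<notin> J \<and> z' k \<in> range Inl} \<noteq> {k. k \<notin> J \<and> z k \<in> range Inl}" by blast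
      qed
      then have "card {k. k \<notin> J \<and> z' k \<in> range Inl} < card {k. k \<notin> J \<and> z k \<in> range Inl}"
        by (intro psubset_card_mono) auto
      then have "card {k. k \<notin> J \<and> z' k \<in> range Inl} \<le> q" using card by simp
      moreover have "cball Y r1 \<subseteq> cball 0 1" using Y(2) X(2) by blast
      ultimately obtain z'' W where W: "top_minor J z''" "W \<in> K" "cball W r' \<subseteq> cball Y r1"
          "\<forall>Z\<in>cball W r'. c' * height J b \<le> \<bar>pluecker J (\<lambda>i. flow 1 Z (b i)) z''\<bar>"
        using IH(3)[OF K H inj' _ Y(1)] Y(3) unfolding f_def by blast
      have "cball W (min r r') \<subseteq> cball W r'" by (rule subset_cball) simp
      then show ?thesis using W Y(2) min_le(2) by (meson order_trans subsetD)
    qed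
  qed
qed

text \<open>The climb starts from the largest coordinate at \<open>X\<close>, which is comparable to
  \<open>height J b\<close> by \<open>height_flow_ge\<close>.\<close>

lemma top_minor_step:
  fixes \<gamma> r :: real
  assumes "0 < \<gamma>" "\<gamma> \<le> 1" "0 < r" "r \<le> 1"
  shows "\<exists>c r'. 0 < c \<and> 0 < r' \<and> (\<forall>(K :: (real ^ 'n ^ 'm) set) J b X. diffuse \<gamma> K \<longrightarrow>
      0 < height J b \<longrightarrow> X \<in> K \<longrightarrow> cball X r \<subseteq> cball 0 1 \<longrightarrow>
      (\<exists>z Y. top_minor J z \<and> Y \<in> K \<and> cball Y r' \<subseteq> cball X r \<and>
        (\<forall>Z\<in>cball Y r'. c * height J b \<le> \<bar>pluecker J (\<lambda>i. flow 1 Z (b i)) z\<bar>)))"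
proof -
  obtain L where L: "1 \<le> L" "\<And>J b z. taylor2 (L * height J b)
      (\<lambda>X :: real ^ 'n ^ 'm. pluecker J (\<lambda>i. flow 1 X (b i)) z)"
    using taylor2_pluecker by blast
  obtain c1 where c1: "0 < c1" "\<And>J x (X :: real ^ 'n ^ 'm). norm X \<le> 1 \<Longrightarrow>
      c1 * height J x \<le> height J (\<lambda>i. flow 1 X (x i))"
    using height_flow_ge[of 1 1] by auto
  define c0 where "c0 = min 1 (c1 / 2)"
  \<comment> \<open>Within this radius the Lipschitz bound allows a change of at most half of
    \<open>c1 * height J b\<close>.\<close>
  define r0 where "r0 = min r (c1 / (10 * L))"
  have c0: "0 < c0" "c0 \<le> 1" using c1(1) by (auto simp: c0_def)
  have r0: "0 < r0" "r0 \<le> 1" using assms c1(1) L(1) by (auto simp: r0_def)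
  obtain c r' where climb: "0 < c" "0 < r'"
    "\<And>(K :: (real ^ 'n ^ 'm) set) J b z X. diffuse \<gamma> K \<Longrightarrow> 0 < height J b \<Longrightarrow>
      inj_on z (- J) \<Longrightarrow> card {i. i \<notin> J \<and> z i \<in> range Inl} \<le> CARD('m + 'n) \<Longrightarrow> X \<in> K \<Longrightarrow> cball X r0 \<subseteq> cball 0 1 \<Longrightarrow>
      (\<forall>Y\<in>cball X r0. c0 * height J b \<le> \<bar>pluecker J (\<lambda>i. flow 1 Y (b i)) z\<bar>) \<Longrightarrow>
      (\<exists>z' Y. top_minor J z' \<and> Y \<in> K \<and> cball Y r' \<subseteq> cball X r0 \<and>
        (\<forall>Z\<in>cball Y r'. c * height J b \<le> \<bar>pluecker J (\<lambda>i. flow 1 Z (b i)) z'\<bar>))"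
    using minor_climb[OF assms(1,2) c0 r0, where q = "CARD('m + 'n)"] by blast
  show ?thesis
  proof (rule exI[of _ c], rule exI[of _ r'], intro conjI allI impI climb)
    fix K :: "(real ^ 'n ^ 'm) set" and J X and b :: "'m + 'n \<Rightarrow> real ^ ('m + 'n)"
    assume K: "diffuse \<gamma> K" and H: "0 < height J b" and X: "X \<in> K" "cball X r \<subseteq> cball 0 1"
    have X1: "norm X \<le> 1" using X(2) assms(3) by (auto dest!: subsetD[of _ _ X])
    have sub: "cball X r0 \<subseteq> cball X r" by (rule subset_cball) (simp add: r0_def)
    obtain z where z: "\<bar>pluecker J (\<lambda>i. flow 1 X (b i)) z\<bar> = height J (\<lambda>i. flow 1 X (b i))"
      by (rule height_attained)
    have zX: "c1 * height J b \<le> \<bar>pluecker J (\<lambda>i. flow 1 X (b i)) z\<bar>"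
      using c1(2)[OF X1] z by simp
    have "0 < c1 * height J b" using c1(1) H by simp
    then have "pluecker J (\<lambda>i. flow 1 X (b i)) z \<noteq> 0" using zX by auto
    then have inj: "inj_on z (- J)" by (rule pluecker_nonzero_inj)
    have near: "\<forall>Y\<in>cball X r0. c0 * height J b \<le> \<bar>pluecker J (\<lambda>i. flow 1 Y (b i)) z\<bar>"
    proof
      fix Y assume Y: "Y \<in> cball X r0"
      then have "Y \<in> cball 0 1" using sub X(2) by blast
      then have "\<bar>pluecker J (\<lambda>i. flow 1 Y (b i)) z - pluecker J (\<lambda>i. flow 1 X (b i)) z\<bar> \<le>
         5 * (L * height J b) * norm (Y - X)"
        using taylor2_lipschitz[OF L(2), of X Y] X1 by simp
      also have "\<dots> \<le> 5 * (L * height J b) * (c1 / (10 * L))"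
        using Y L(1) H by (intro mult_left_mono) (auto simp: r0_def dist_norm norm_minus_commute)
      also have "\<dots> = c1 / 2 * height J b" using L(1) by simp
      finally have "c1 / 2 * height J b \<le> \<bar>pluecker J (\<lambda>i. flow 1 Y (b i)) z\<bar>" using zX by linarith
      moreover have "c0 * height J b \<le> c1 / 2 * height J b"
        using H by (intro mult_right_mono) (auto simp: c0_def)
      ultimately show "c0 * height J b \<le> \<bar>pluecker J (\<lambda>i. flow 1 Y (b i)) z\<bar>" by linarith
    qed
    have "card {i. i \<notin> J \<and> z i \<in> range Inl} \<le> CARD('m + 'n)" by (rule card_mono) auto
    then show "\<exists>z Y. top_minor J z \<and> Y \<in> K \<and> cball Y r' \<subseteq> cball X r \<and>
        (\<forall>Z\<in>cball Y r'. c * height J b \<le> \<bar>pluecker J (\<lambda>i. flow 1 Z (b i)) z\<bar>)"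
      using climb(3)[OF K H inj _ X(1) _ near] sub X(2) by (meson order_trans)
  qed
qed

text \<open>The index sets \<open>J\<close> are treated one after another; a bound obtained on a
  ball survives on every smaller one. \<alpha> and \<open>c\<close> depend on \<gamma> and the
  dimensions only, so they can serve for all \<beta>.\<close>

lemma top_minor_simultaneous:
  fixes \<gamma> :: real
  assumes "0 < \<gamma>" "\<gamma> \<le> 1"
  obtains \<alpha> c where "0 < \<alpha>" "\<alpha> < 1" "0 < c" "c \<le> 1"
    "\<And>(K :: (real ^ 'n ^ 'm) set) b. diffuse \<gamma> K \<Longrightarrow> 0 \<in> K \<Longrightarrow>
      \<exists>Y\<in>K. cball Y \<alpha> \<subseteq> cball 0 1 \<and> (\<forall>J. 0 < height J (b J) \<longrightarrow>
        (\<exists>z. top_minor J z \<and> (\<forall>Z\<in>cball Y \<alpha>. c * height J (b J) \<le> \<bar>pluecker J (\<lambda>i. flow 1 Z (b J i)) z\<bar>)))"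
proof -
  have "\<exists>c r. 0 < c \<and> 0 < r \<and> r \<le> 1 \<and> (\<forall>(K :: (real ^ 'n ^ 'm) set) b. diffuse \<gamma> K \<longrightarrow> 0 \<in> K \<longrightarrow>
      (\<exists>Y\<in>K. cball Y r \<subseteq> cball 0 1 \<and> (\<forall>J\<in>F. 0 < height J (b J) \<longrightarrow>
        (\<exists>z. top_minor J z \<and> (\<forall>Z\<in>cball Y r. c * height J (b J) \<le> \<bar>pluecker J (\<lambda>i. flow 1 Z (b J i)) z\<bar>)))))"
    if "finite F" for F :: "('m + 'n) set set"
    using that
  proof (induction F rule: finite_induct)
    case empty
    show ?case by (intro exI[of _ 1]) auto
  next
    case (insert J0 F)
    obtain c1 r1 where 1: "0 < c1" "0 < r1" "r1 \<le> 1"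
      "\<And>(K :: (real ^ 'n ^ 'm) set) b. diffuse \<gamma> K \<Longrightarrow> 0 \<in> K \<Longrightarrow>
      (\<exists>Y\<in>K. cball Y r1 \<subseteq> cball 0 1 \<and> (\<forall>J\<in>F. 0 < height J (b J) \<longrightarrow>
        (\<exists>z. top_minor J z \<and> (\<forall>Z\<in>cball Y r1. c1 * height J (b J) \<le> \<bar>pluecker J (\<lambda>i. flow 1 Z (b J i)) z\<bar>))))"
      using insert.IH by blast
    obtain c2 r2 where 2: "0 < c2" "0 < r2"
      "\<And>(K :: (real ^ 'n ^ 'm) set) J b X. diffuse \<gamma> K \<Longrightarrow> 0 < height J b \<Longrightarrow> X \<in> K \<Longrightarrow> cball X r1 \<subseteq> cball 0 1 \<Longrightarrow>
      (\<exists>z Y. top_minor J z \<and> Y \<in> K \<and> cball Y r2 \<subseteq> cball X r1 \<and>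
        (\<forall>Z\<in>cball Y r2. c2 * height J b \<le> \<bar>pluecker J (\<lambda>i. flow 1 Z (b i)) z\<bar>))"
      using top_minor_step[OF assms 1(2,3)] by blast
    define c where "c = min c1 c2"
    define r where "r = min r1 r2"
    show ?case
    proof (rule exI[of _ c], rule exI[of _ r], intro conjI allI impI)
      show "0 < c" "0 < r" "r \<le> 1" using 1 2 by (auto simp: c_def r_def)
      fix K :: "(real ^ 'n ^ 'm) set" and b assume K: "diffuse \<gamma> K" "0 \<in> K"
      obtain X where X: "X \<in> K" "cball X r1 \<subseteq> cball 0 1" "\<forall>J\<in>F. 0 < height J (b J) \<longrightarrow>
        (\<exists>z. top_minor J z \<and> (\<forall>Z\<in>cball X r1. c1 * height J (b J) \<le> \<bar>pluecker J (\<lambda>i. flow 1 Z (b J i)) z\<bar>))"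
        using 1(4)[OF K] by blast
      obtain Y where Y: "Y \<in> K" "cball Y r \<subseteq> cball X r1" "0 < height J0 (b J0) \<longrightarrow>
        (\<exists>z. top_minor J0 z \<and> (\<forall>Z\<in>cball Y r. c * height J0 (b J0) \<le> \<bar>pluecker J0 (\<lambda>i. flow 1 Z (b J0 i)) z\<bar>))"
      proof (cases "0 < height J0 (b J0)")
        case False
        moreover have "cball X r \<subseteq> cball X r1" by (rule subset_cball) (simp add: r_def)
        ultimately show ?thesis using that[OF X(1)] by blast
      next
        case True
        obtain z Y where zY: "top_minor J0 z" "Y \<in> K" "cball Y r2 \<subseteq> cball X r1"
          "\<forall>Z\<in>cball Y r2. c2 * height J0 (b J0) \<le> \<bar>pluecker J0 (\<lambda>i. flow 1 Z (b J0 i)) z\<bar>"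
          using 2(3)[OF K(1) True X(1,2)] by blast
        have "cball Y r \<subseteq> cball Y r2" by (rule subset_cball) (simp add: r_def)
        moreover have "c * height J0 (b J0) \<le> c2 * height J0 (b J0)"
          using True by (intro mult_right_mono) (auto simp: c_def)
        ultimately show ?thesis using that[OF zY(2)] zY by (meson order_trans subsetD)
      qed
      show "\<exists>Y\<in>K. cball Y r \<subseteq> cball 0 1 \<and> (\<forall>J\<in>insert J0 F. 0 < height J (b J) \<longrightarrow>
        (\<exists>z. top_minor J z \<and> (\<forall>Z\<in>cball Y r. c * height J (b J) \<le> \<bar>pluecker J (\<lambda>i. flow 1 Z (b J i)) z\<bar>)))"
      proof (intro bexI[OF _ Y(1)] conjI ballI impI)
        show "cball Y r \<subseteq> cball 0 1" using Y(2) X(2) by blast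
        fix J assume J: "J \<in> insert J0 F" "0 < height J (b J)"
        show "\<exists>z. top_minor J z \<and> (\<forall>Z\<in>cball Y r. c * height J (b J) \<le> \<bar>pluecker J (\<lambda>i. flow 1 Z (b J i)) z\<bar>)"
        proof (cases "J = J0")
          case True
          then show ?thesis using Y(3) J by blast
        next
          case False
          have "c * height J (b J) \<le> c1 * height J (b J)"
            using J(2) by (intro mult_right_mono) (auto simp: c_def)
          moreover obtain z where "top_minor J z"
              "\<forall>Z\<in>cball X r1. c1 * height J (b J) \<le> \<bar>pluecker J (\<lambda>i. flow 1 Z (b J i)) z\<bar>"
            using X(3) J False by blast
          ultimately show ?thesis using Y(2) by (meson order_trans subsetD)
        qed
      qed
    qed
  qed
  from this[of UNIV] obtain c r where cr: "0 < c" "0 < r" "r \<le> 1"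
     "\<And>(K :: (real ^ 'n ^ 'm) set) b. diffuse \<gamma> K \<Longrightarrow> 0 \<in> K \<Longrightarrow>
      (\<exists>Y\<in>K. cball Y r \<subseteq> cball 0 1 \<and> (\<forall>J. 0 < height J (b J) \<longrightarrow>
        (\<exists>z. top_minor J z \<and> (\<forall>Z\<in>cball Y r. c * height J (b J) \<le> \<bar>pluecker J (\<lambda>i. flow 1 Z (b J i)) z\<bar>))))"
    by auto
  show ?thesis
  \<comment> \<open>Halving the radius makes \<alpha> strictly smaller than 1.\<close>
  proof (rule that[of "r / 2" "min 1 c"])
    show "0 < r / 2" "r / 2 < 1" "0 < min 1 c" "min 1 c \<le> 1" using cr by auto
    fix K :: "(real ^ 'n ^ 'm) set" and b assume "diffuse \<gamma> K" "0 \<in> K"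
    then obtain Y where Y: "Y \<in> K" "cball Y r \<subseteq> cball 0 1" "\<And>J. 0 < height J (b J) \<Longrightarrow>
        (\<exists>z. top_minor J z \<and> (\<forall>Z\<in>cball Y r. c * height J (b J) \<le> \<bar>pluecker J (\<lambda>i. flow 1 Z (b J i)) z\<bar>))"
      using cr(4) by blast
    have sub: "cball Y (r / 2) \<subseteq> cball Y r" by (rule subset_cball) (use cr in simp)
    have "min 1 c * height J (b J) \<le> c * height J (b J)" for J
      by (intro mult_right_mono height_nonneg) simp
    then have "\<exists>z. top_minor J z \<and> (\<forall>Z\<in>cball Y (r / 2). min 1 c * height J (b J) \<le> \<bar>pluecker J (\<lambda>i. flow 1 Z (b J i)) z\<bar>)"
      if "0 < height J (b J)" for J
      using Y(3)[OF that] sub by (meson order_trans subsetD)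
    then show "\<exists>Y\<in>K. cball Y (r / 2) \<subseteq> cball 0 1 \<and> (\<forall>J. 0 < height J (b J) \<longrightarrow>
        (\<exists>z. top_minor J z \<and> (\<forall>Z\<in>cball Y (r / 2). min 1 c * height J (b J) \<le> \<bar>pluecker J (\<lambda>i. flow 1 Z (b J i)) z\<bar>)))"
      using Y(1,2) sub by blast
  qed
qed

section \<open>Supports of absolutely friendly measures\<close>

lemma null_off_support:
  fixes \<tau> :: "'a::euclidean_space measure"
  assumes "sets \<tau> = sets borel" "compact E" "E \<inter> measure_supp \<tau> = {}"
  shows "emeasure \<tau> E = 0"
proof -
  have "\<exists>U. open U \<and> x \<in> U \<and> emeasure \<tau> U = 0" if "x \<in> E" for x
    using that assms(3) unfolding measure_supp_def by (auto simp: zero_less_iff_neq_zero)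
  then obtain U where U: "\<And>x. x \<in> E \<Longrightarrow> open (U x) \<and> x \<in> U x \<and> emeasure \<tau> (U x) = 0" by metis
  obtain D where D: "D \<subseteq> E" "finite D" "E \<subseteq> (\<Union>x\<in>D. U x)"
    using compactE_image[OF assms(2), of E U] U by blast
  have null: "U x \<in> null_sets \<tau>" if "x \<in> D" for x
    using U[of x] D(1) that assms(1) by (auto simp: null_sets_def)
  have "(\<Union>x\<in>D. U x) \<in> null_sets \<tau>" by (rule null_sets.finite_UN[OF D(2) null])
  moreover have "E \<in> sets \<tau>" using assms(1,2) by (simp add: borel_compact)
  ultimately have "E \<in> null_sets \<tau>" using D(3) by (rule null_sets_subset)
  then show ?thesis by (rule null_setsD1)
qed

lemma open_nbhd_hyperplane:
  fixes v :: "'a::euclidean_space"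
  assumes "v \<noteq> 0" "\<bar>v \<bullet> y - c\<bar> < \<epsilon> * norm v"
  shows "y \<in> open_nbhd \<epsilon> {y. v \<bullet> y = c}"
proof -
  define p where "p = y - ((v \<bullet> y - c) / (v \<bullet> v)) *\<^sub>R v"
  have "p \<in> {y. v \<bullet> y = c}" using assms(1) by (simp add: p_def inner_diff_right)
  then have "infdist y {y. v \<bullet> y = c} \<le> dist y p" by (rule infdist_le)
  also have "\<dots> = \<bar>v \<bullet> y - c\<bar> / norm v"
    using assms(1) by (simp add: p_def dist_norm dot_square_norm power2_eq_square)
  also have "\<dots> < \<epsilon>" using assms by (simp add: field_simps)
  finally show ?thesis by (simp add: open_nbhd_def)
qed

text \<open>If a strip around the hyperplane does not carry the full mass of the ball, the rest of
  the ball is a compact set of positive measure and thus meets the support.\<close>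

lemma friendly_escape:
  fixes \<tau> :: "'a::euclidean_space measure"
  assumes "absolutely_friendly \<tau>"
  obtains \<rho>0 \<gamma> where "0 < \<rho>0" "0 < \<gamma>" "\<gamma> \<le> 1"
    "\<And>x \<rho> v c. x \<in> measure_supp \<tau> \<Longrightarrow> 0 < \<rho> \<Longrightarrow> \<rho> \<le> \<rho>0 \<Longrightarrow>
      \<exists>y\<in>measure_supp \<tau>. dist x y \<le> \<rho> \<and> \<gamma> * \<rho> * norm v \<le> \<bar>v \<bullet> y - c\<bar>"
proof -
  have fin: "finite_measure \<tau>" and sets: "sets \<tau> = sets borel"
    using assms by (auto simp: absolutely_friendly_def)
  interpret finite_measure \<tau> by (rule fin)
  obtain \<rho>0 C a where *: "0 < \<rho>0" "0 < C" "0 < a"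
    "\<And>\<rho> x \<epsilon> P. 0 < \<rho> \<Longrightarrow> \<rho> \<le> \<rho>0 \<Longrightarrow> x \<in> measure_supp \<tau> \<Longrightarrow> 0 < \<epsilon> \<Longrightarrow> \<epsilon> \<le> \<rho> \<Longrightarrow> affine_hyperplane P \<Longrightarrow>
       measure \<tau> (cball x \<rho> \<inter> open_nbhd \<epsilon> P) < C * (\<epsilon> / \<rho>) powr a * measure \<tau> (cball x \<rho>)"
    using assms unfolding absolutely_friendly_def by metis
  \<comment> \<open>Chosen so that \<open>C * \<gamma> powr a \<le> 1\<close>; the strict inequality
    of friendliness then leaves mass outside the strip.\<close>
  define \<gamma> where "\<gamma> = min 1 ((1 / C) powr (1 / a))"
  have \<gamma>: "0 < \<gamma>" "\<gamma> \<le> 1" using *(2) by (auto simp: \<gamma>_def)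
  have "\<gamma> powr a \<le> ((1 / C) powr (1 / a)) powr a" using \<gamma> *(3) by (intro powr_mono2) (auto simp: \<gamma>_def)
  also have "\<dots> = 1 / C" using *(2,3) by (simp add: powr_powr)
  finally have C1: "C * \<gamma> powr a \<le> 1" using *(2) by (simp add: field_simps)
  show ?thesis
  proof (rule that[OF *(1) \<gamma>])
    fix x \<rho> v c assume x: "x \<in> measure_supp \<tau>" and \<rho>: "0 < \<rho>" "\<rho> \<le> \<rho>0"
    show "\<exists>y\<in>measure_supp \<tau>. dist x y \<le> \<rho> \<and> \<gamma> * \<rho> * norm v \<le> \<bar>v \<bullet> y - c\<bar>"
    proof (cases "v = 0")
      case True
      then show ?thesis using x \<rho> by (intro bexI[OF _ x]) auto
    next
      case False
      define P where "P = {y. v \<bullet> y = c}"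
      define N where "N = open_nbhd (\<gamma> * \<rho>) P"
      have "affine_hyperplane P" unfolding affine_hyperplane_def P_def using False by blast
      then have "measure \<tau> (cball x \<rho> \<inter> N) < C * (\<gamma> * \<rho> / \<rho>) powr a * measure \<tau> (cball x \<rho>)"
        unfolding N_def using x \<rho> \<gamma> by (intro *(4)) (auto simp: mult_le_cancel_right1)
      also have "\<dots> \<le> 1 * measure \<tau> (cball x \<rho>)"
        using C1 \<rho> by (intro mult_right_mono) auto
      finally have less: "measure \<tau> (cball x \<rho> \<inter> N) < measure \<tau> (cball x \<rho>)" by simp
      have "open N" unfolding N_def open_nbhd_def
        by (intro open_Collect_less continuous_intros)
      then have "compact (cball x \<rho> - N)" by (simp add: compact_diff)
      have "cball x \<rho> \<inter> N \<in> sets \<tau>" "cball x \<rho> \<in> sets \<tau>" using \<open>open N\<close> sets by auto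
      then have "measure \<tau> (cball x \<rho> - N) = measure \<tau> (cball x \<rho>) - measure \<tau> (cball x \<rho> \<inter> N)"
        using finite_measure_Diff[of "cball x \<rho>" "cball x \<rho> \<inter> N"] by (simp add: Diff_Int)
      then have "emeasure \<tau> (cball x \<rho> - N) \<noteq> 0" using less by (auto simp: measure_def)
      then obtain y where y: "y \<in> cball x \<rho> - N" "y \<in> measure_supp \<tau>"
        using null_off_support[OF sets \<open>compact (cball x \<rho> - N)\<close>] by blast
      then have "\<gamma> * \<rho> * norm v \<le> \<bar>v \<bullet> y - c\<bar>"
        using open_nbhd_hyperplane[OF False, of y c "\<gamma> * \<rho>"] unfolding N_def P_def by force
      then show ?thesis using y by auto
    qed
  qed
qed

text \<open>Friendliness controls radii up to \<open>\<rho>0\<close>, while Black may open with any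
  radius up to the diameter. All scales are therefore reduced by the factor
  \<open>\<rho>0 / R'\<close>, which is paid for in \<gamma>.\<close>

lemma friendly_diffuse:
  fixes \<tau> :: "'a::euclidean_space measure"
  assumes "absolutely_friendly \<tau>" "K = measure_supp \<tau>"
  obtains \<gamma> where "0 < \<gamma>" "\<gamma> \<le> 1"
    "\<And>\<rho> A. 0 < \<rho> \<Longrightarrow> \<rho> \<le> R \<Longrightarrow> diffuse \<gamma> ((\<lambda>X. (1 / \<rho>) *\<^sub>R (X - A)) ` K)"
proof -
  obtain \<rho>0 \<gamma> where *: "0 < \<rho>0" "0 < \<gamma>" "\<gamma> \<le> 1"
    "\<And>x \<rho> v c. x \<in> K \<Longrightarrow> 0 < \<rho> \<Longrightarrow> \<rho> \<le> \<rho>0 \<Longrightarrow> \<exists>y\<in>K. dist x y \<le> \<rho> \<and> \<gamma> * \<rho> * norm v \<le> \<bar>v \<bullet> y - c\<bar>"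
    using friendly_escape[OF assms(1)] unfolding assms(2) by metis
  define R' where "R' = max \<rho>0 R"
  have R': "0 < R'" "\<rho>0 \<le> R'" "R \<le> R'" using *(1) by (auto simp: R'_def)
  show ?thesis
  proof (rule that[of "\<gamma> * (\<rho>0 / R')"])
    show "0 < \<gamma> * (\<rho>0 / R')" using * R' by simp
    have "\<gamma> * (\<rho>0 / R') \<le> 1 * 1" using * R' by (intro mult_mono) auto
    then show "\<gamma> * (\<rho>0 / R') \<le> 1" by simp
    fix \<rho> A assume \<rho>: "0 < \<rho>" "\<rho> \<le> R"
    show "diffuse (\<gamma> * (\<rho>0 / R')) ((\<lambda>X. (1 / \<rho>) *\<^sub>R (X - A)) ` K)"
      unfolding diffuse_def
    proof (clarify)
      fix X v :: 'a and s c :: real assume X: "X \<in> K" and s: "0 < s" "s \<le> 1"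
      define t where "t = \<rho> * s * (\<rho>0 / R')"
      have t: "0 < t" using \<rho> s * R' by (simp add: t_def)
      have "\<rho> * s * (\<rho>0 / R') \<le> R' * 1 * (\<rho>0 / R')" using \<rho> s * R' by (intro mult_mono) auto
      then have t0: "t \<le> \<rho>0" using R' by (simp add: t_def)
      have "\<rho> * s * (\<rho>0 / R') \<le> \<rho> * s * 1" using \<rho> s * R' by (intro mult_left_mono) auto
      then have t1: "t \<le> \<rho> * s" by (simp add: t_def)
      obtain Y where Y: "Y \<in> K" "dist X Y \<le> t" "\<gamma> * t * norm v \<le> \<bar>v \<bullet> Y - (v \<bullet> A + \<rho> * c)\<bar>"
        using *(4)[OF X t t0] by blast
      show "\<exists>Z\<in>(\<lambda>X. (1 / \<rho>) *\<^sub>R (X - A)) ` K. dist ((1 / \<rho>) *\<^sub>R (X - A)) Z \<le> s \<and>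
          \<gamma> * (\<rho>0 / R') * s * norm v \<le> \<bar>v \<bullet> Z - c\<bar>"
      proof (intro bexI[of _ "(1 / \<rho>) *\<^sub>R (Y - A)"] conjI)
        have "dist ((1 / \<rho>) *\<^sub>R (X - A)) ((1 / \<rho>) *\<^sub>R (Y - A)) = dist X Y / \<rho>"
          using \<rho> by (simp add: dist_norm scaleR_right_diff_distrib[symmetric])
        also have "\<dots> \<le> (\<rho> * s) / \<rho>" using Y(2) t1 \<rho> by (intro divide_right_mono) auto
        finally show "dist ((1 / \<rho>) *\<^sub>R (X - A)) ((1 / \<rho>) *\<^sub>R (Y - A)) \<le> s" using \<rho> by simp
        have "\<bar>v \<bullet> ((1 / \<rho>) *\<^sub>R (Y - A)) - c\<bar> = \<bar>(v \<bullet> Y - (v \<bullet> A + \<rho> * c)) / \<rho>\<bar>"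
          using \<rho> by (simp add: inner_diff_right field_simps)
        also have "\<dots> = \<bar>v \<bullet> Y - (v \<bullet> A + \<rho> * c)\<bar> / \<rho>" using \<rho> by simp
        also have "\<dots> \<ge> (\<gamma> * t * norm v) / \<rho>" using Y(3) \<rho> by (intro divide_right_mono) auto
        also have "(\<gamma> * t * norm v) / \<rho> = \<gamma> * (\<rho>0 / R') * s * norm v" using \<rho> by (simp add: t_def)
        finally show "\<gamma> * (\<rho>0 / R') * s * norm v \<le> \<bar>v \<bullet> ((1 / \<rho>) *\<^sub>R (Y - A)) - c\<bar>" .
      qed (use Y in auto)
    qed
  qed
qed

section \<open>The play\<close>

lemma height_flow_pos_iff:
  assumes "0 < s"
  shows "0 < height J (\<lambda>i. flow s X (x i)) \<longleftrightarrow> 0 < height J x"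
proof
  assume "0 < height J (\<lambda>i. flow s X (x i))"
  then have "0 < height J (\<lambda>i. flow (1 / s) (- (1 / s) *\<^sub>R X) (flow s X (x i)))"
    by (rule height_flow_pos[rotated]) (use assms in simp)
  then show "0 < height J x" unfolding flow_inverse(1)[OF assms] .
qed (rule height_flow_pos[OF assms])

text \<open>Positive height encodes linear independence: this is a basis of a sublattice of the
  integer lattice, not necessarily a primitive one.\<close>

definition integral_frame :: "'k set \<Rightarrow> ('k \<Rightarrow> real ^ 'k) \<Rightarrow> bool" where
  "integral_frame J v \<longleftrightarrow> (\<forall>i\<in>J. integral_vec (v i)) \<and> 0 < height J v"

text \<open>The thresholds \<open>\<kappa> ^ (j * (d - j))\<close> are log-convex in the rank \<open>j\<close>; by submodularity of the height,
  at any time the frames of a given rank below the threshold all span the same subspace.\<close>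

definition threshold :: "real \<Rightarrow> 'k::finite set \<Rightarrow> real" where
  "threshold \<kappa> J = \<kappa> ^ (card J * (CARD('k) - card J))"

text \<open>The second difference of j(d - j) at step \<open>s\<close> is exactly
  \<open>- 2 * s * s\<close>.\<close>

lemma threshold_exchange:
  fixes J I J' :: "'k::finite set"
  assumes "card I + s = card J" "card J' = card J + s"
  shows "\<kappa> ^ (2 * s * s) * (threshold \<kappa> I * threshold \<kappa> J') = threshold \<kappa> J * threshold \<kappa> J"
proof -
  have "card J' \<le> CARD('k)" by (rule card_mono) auto
  then obtain t where t: "CARD('k) = card J' + t" using le_Suc_ex by blast
  define i where "i = card I"
  have c: "CARD('k) = i + 2 * s + t" "card J = i + s" "card J' = i + 2 * s" "card I = i"
    using t assms by (auto simp: i_def)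
  have "2 * s * s + (i * (2 * s + t) + (i + 2 * s) * t) = (i + s) * (s + t) + (i + s) * (s + t)"
    by (simp add: algebra_simps)
  then show ?thesis unfolding threshold_def c power_add[symmetric] by simp
qed

text \<open>If some \<open>w i\<close> were outside the span of \<open>v\<close>, intersection and
  sum would have ranks lower and higher by some s \<ge> 1. By \<open>bound\<close> the product of
  their heights is at least \<epsilon>^2 times that of their thresholds; by submodularity it is at
  most a constant times the square of \<open>threshold \<kappa> J\<close>, which is \<kappa>^(2 s^2)
  times that same product. The condition on \<kappa> excludes this.\<close>

lemma small_frames_same_span:
  fixes T :: "real ^ 'k \<Rightarrow> real ^ 'k::finite"
  assumes T: "linear T" "inj T" "\<And>I x. 0 < height I (\<lambda>i. T (x i)) \<longleftrightarrow> 0 < height I x"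
    and bound: "\<And>I u. integral_frame I u \<Longrightarrow> \<epsilon> * threshold \<kappa> I \<le> height I (\<lambda>i. T (u i))"
    and \<kappa>: "0 < \<kappa>" "\<kappa> \<le> 1" "0 < \<epsilon>" "fun_count TYPE('k) ^ CARD('k) * \<kappa>\<^sup>2 < \<epsilon>\<^sup>2"
    and v: "integral_frame J v" "height J (\<lambda>i. T (v i)) < threshold \<kappa> J"
    and w: "integral_frame J w" "height J (\<lambda>i. T (w i)) < threshold \<kappa> J"
    and J: "J \<noteq> UNIV" and i: "i \<in> J"
  shows "w i \<in> span (v ` J)"
proof (rule ccontr)
  define C where "C = fun_count TYPE('k) ^ CARD('k)"
  have C: "0 < C" unfolding C_def using fun_count_ge_1[where 'k = 'k] by simp
  assume "w i \<notin> span (v ` J)"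
  then obtain I J' v' w' s where *: "card I + s = card J" "card J' = card J + s" "0 < s"
    "\<And>i. i \<in> I \<Longrightarrow> integral_vec (w' i)" "\<And>i. i \<in> J' \<Longrightarrow> integral_vec (v' i)"
    "0 < height I (\<lambda>i. T (w' i))" "0 < height J' (\<lambda>i. T (v' i))"
    "height I (\<lambda>i. T (w' i)) * height J' (\<lambda>i. T (v' i)) \<le>
      C * (height J (\<lambda>i. T (v i)) * height J (\<lambda>i. T (w i)))"
    using height_exchange[of J v w T i] v(1) w(1) T J i unfolding integral_frame_def C_def by metis
  have frames: "integral_frame I w'" "integral_frame J' v'"
    using * T(3) by (auto simp: integral_frame_def)
  define P where "P = threshold \<kappa> I * threshold \<kappa> J'"
  have P: "0 < P" using \<kappa>(1) by (simp add: P_def threshold_def)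
  have "\<epsilon>\<^sup>2 * P = (\<epsilon> * threshold \<kappa> I) * (\<epsilon> * threshold \<kappa> J')" by (simp add: P_def power2_eq_square)
  also have "\<dots> \<le> height I (\<lambda>i. T (w' i)) * height J' (\<lambda>i. T (v' i))"
    using bound frames \<kappa> by (intro mult_mono) (auto simp: height_nonneg threshold_def)
  also have "\<dots> \<le> C * (threshold \<kappa> J * threshold \<kappa> J)"
    using *(8) v(2) w(2) C
    by (elim order_trans, intro mult_left_mono mult_mono) (auto simp: height_nonneg threshold_def \<kappa> less_imp_le)
  also have "threshold \<kappa> J * threshold \<kappa> J = \<kappa> ^ (2 * s * s) * P"
    unfolding P_def by (rule threshold_exchange[OF *(1,2), symmetric])
  also have "C * (\<kappa> ^ (2 * s * s) * P) \<le> C * (\<kappa>\<^sup>2 * P)"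
  proof -
    have "1 \<le> s * s" using *(3) by (simp add: Suc_leI)
    then have "\<kappa> ^ (2 * s * s) \<le> \<kappa>\<^sup>2" using \<kappa> by (intro power_decreasing) auto
    then show ?thesis using C P by (intro mult_left_mono mult_right_mono) auto
  qed
  finally have "\<epsilon>\<^sup>2 * P \<le> (C * \<kappa>\<^sup>2) * P" by simp
  then show False using \<kappa>(4) P unfolding C_def by (simp add: mult_le_cancel_right)
qed

lemma height_empty_ge_1: "1 \<le> height {} (x :: 'k::finite \<Rightarrow> real ^ 'k)"
proof (rule height_ge_1)
  have "pluecker {} x id = det (mat 1 :: real ^ 'k ^ 'k)"
    unfolding pluecker_def by (rule arg_cong[where f = det]) (auto simp: vec_eq_iff mat_def axis_def)
  then show "0 < height {} x" unfolding height_pos_iff by (metis det_I zero_neq_one)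
qed simp

text \<open>Induction on the round, over all ranks at once, since uniqueness of the small subspace
  in one rank uses the lower bounds in other ranks. A round costs at most the factor
  \<open>cs\<close>, so a height that has just passed below its threshold is still at least
  \<open>cs\<close> times the threshold; the move made at that moment secures a top minor, which
  never decreases afterwards by more than the factor already granted in \<open>c\<close>.\<close>

lemma frame_heights_bounded:
  fixes A :: "nat \<Rightarrow> real ^ 'n ^ 'm"
  assumes \<rho>: "\<And>k. 0 < \<rho> k" "\<And>k. \<rho> (Suc k) \<le> \<rho> k"
    and c: "0 < c" "c \<le> 1" and cs: "0 < cs" "cs \<le> 1"
    and \<kappa>: "0 < \<kappa>" "\<kappa> \<le> 1" "fun_count TYPE('m + 'n) ^ CARD('m + 'n) * \<kappa>\<^sup>2 < (c * cs)\<^sup>2"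
    and step: "\<And>k J x. cs * height J (\<lambda>i. flow (\<rho> k) (A k) (x i)) \<le> height J (\<lambda>i. flow (\<rho> (Suc k)) (A (Suc k)) (x i))"
    and init: "\<And>J v. integral_frame J v \<Longrightarrow> J \<noteq> {} \<Longrightarrow> J \<noteq> UNIV \<Longrightarrow>
      threshold \<kappa> J \<le> height J (\<lambda>i. flow (\<rho> 0) (A 0) (v i))"
    and moves: "\<And>k J v. integral_frame J v \<Longrightarrow> height J (\<lambda>i. flow (\<rho> k) (A k) (v i)) < threshold \<kappa> J \<Longrightarrow>
      \<exists>v. integral_frame J v \<and> height J (\<lambda>i. flow (\<rho> k) (A k) (v i)) < threshold \<kappa> J \<and>
        (\<exists>z. top_minor J z \<and> (\<forall>l>k. c * height J (\<lambda>i. flow (\<rho> k) (A k) (v i)) \<le>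
           \<bar>pluecker J (\<lambda>i. flow (\<rho> k) (A l) (v i)) z\<bar>))"
    and v: "integral_frame J v"
  shows "c * cs * threshold \<kappa> J \<le> height J (\<lambda>i. flow (\<rho> k) (A k) (v i))"
proof -
  define H where "H k J v = height J (\<lambda>i. flow (\<rho> k) (A k) (v i))" for k J and v :: "'m + 'n \<Rightarrow> real ^ ('m + 'n)"
  \<comment> \<open>Some past round \<open>k1\<close> secured a top minor of this frame for all
    later centres \<open>A l\<close>, at a time when the height was still at least \<open>cs\<close>
    times the threshold.\<close>
  define handled where "handled k J v \<longleftrightarrow> (\<exists>k1<k. cs * threshold \<kappa> J \<le> H k1 J v \<and> (\<exists>z. top_minor J z \<and>
    (\<forall>l>k1. c * H k1 J v \<le> \<bar>pluecker J (\<lambda>i. flow (\<rho> k1) (A l) (v i)) z\<bar>)))"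
    for k J and v :: "'m + 'n \<Rightarrow> real ^ ('m + 'n)"
  have th: "0 < threshold \<kappa> J" for J :: "('m + 'n) set" using \<kappa> by (simp add: threshold_def)
  have anti: "\<rho> l \<le> \<rho> k" if "k \<le> l" for k l using lift_Suc_antimono_le[of \<rho>] \<rho>(2) that by blast
  \<comment> \<open>In ranks 0 and d the threshold is 1 and the height is at least 1 at all
    times.\<close>
  have trivial: "threshold \<kappa> J \<le> H k J v" if "integral_frame J v" "J = {} \<or> J = UNIV" for k J v
  proof -
    have "1 \<le> H k J v"
    proof (cases "J = {}")
      case True
      then show ?thesis unfolding H_def using height_empty_ge_1 by simp
    next
      case False
      then have "J = UNIV" using that(2) by simp
      then show ?thesis using that(1) height_ge_1[of UNIV v] \<rho>(1)
        by (simp add: H_def height_UNIV_flow integral_frame_def)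
    qed
    moreover have "threshold \<kappa> J = 1" using that(2) by (auto simp: threshold_def)
    ultimately show ?thesis by simp
  qed
  have handledD: "c * cs * threshold \<kappa> J \<le> H k J v" if "handled k J v" for k J v
  proof -
    obtain k1 z where k1: "k1 < k" "cs * threshold \<kappa> J \<le> H k1 J v" "top_minor J z"
       "c * H k1 J v \<le> \<bar>pluecker J (\<lambda>i. flow (\<rho> k1) (A k) (v i)) z\<bar>"
      using \<open>handled k J v\<close> unfolding handled_def by blast
    have "c * cs * threshold \<kappa> J \<le> c * H k1 J v" using k1(2) c by simp
    also have "\<dots> \<le> \<bar>pluecker J (\<lambda>i. flow (\<rho> k1) (A k) (v i)) z\<bar>" by fact
    \<comment> \<open>The centre \<open>A k\<close> is kept and only the scale changes from
      \<open>\<rho> k1\<close> to \<open>\<rho> k\<close>, so the two flows differ by a purely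
      diagonal one.\<close>
    also have "\<dots> \<le> \<bar>pluecker J (\<lambda>i. flow (\<rho> k / \<rho> k1) 0 (flow (\<rho> k1) (A k) (v i))) z\<bar>"
      using \<rho>(1)[of k] \<rho>(1)[of k1] anti[of k1 k] k1 by (intro pluecker_flow_mono) auto
    also have "\<dots> = \<bar>pluecker J (\<lambda>i. flow (\<rho> k) (A k) (v i)) z\<bar>"
      using \<rho>(1)[of k] \<rho>(1)[of k1] by (simp add: flow_flow)
    also have "\<dots> \<le> H k J v" unfolding H_def by (rule pluecker_le_height)
    finally show ?thesis .
  qed
  have "\<forall>J v. integral_frame J v \<longrightarrow> handled k J v \<or> cs * threshold \<kappa> J \<le> H k J v" for k
  proof (induction k)
    case 0
    have "cs * threshold \<kappa> J \<le> H 0 J v" if "integral_frame J v" for J v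
    proof -
      have "threshold \<kappa> J \<le> H 0 J v"
        using that init[of J v] trivial[of J v 0] unfolding H_def by blast
      moreover have "cs * threshold \<kappa> J \<le> 1 * threshold \<kappa> J" using cs th[of J] by (intro mult_right_mono) auto
      ultimately show ?thesis by simp
    qed
    then show ?case by blast
  next
    case (Suc k)
    have all: "c * cs * threshold \<kappa> J \<le> H k J v" if "integral_frame J v" for J v
    proof -
      have "c * (cs * threshold \<kappa> J) \<le> 1 * (cs * threshold \<kappa> J)"
        using c cs th[of J] by (intro mult_right_mono) auto
      then show ?thesis using Suc.IH handledD that by fastforce
    qed
    show ?case
    proof (intro allI impI)
      fix J and v :: "'m + 'n \<Rightarrow> real ^ ('m + 'n)" assume v: "integral_frame J v"
      consider "handled k J v" | "threshold \<kappa> J \<le> H k J v"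
        | "cs * threshold \<kappa> J \<le> H k J v" "H k J v < threshold \<kappa> J"
        using Suc.IH v by fastforce
      then show "handled (Suc k) J v \<or> cs * threshold \<kappa> J \<le> H (Suc k) J v"
      proof cases
        case 1
        then show ?thesis unfolding handled_def using less_SucI by blast
      next
        case 2
        then have "cs * threshold \<kappa> J \<le> cs * H k J v" using cs by simp
        also have "\<dots> \<le> H (Suc k) J v" unfolding H_def by (rule step)
        finally show ?thesis ..
      next
        case 3
        then have J: "J \<noteq> UNIV" using trivial[OF v, of k] by force
        obtain u z where u: "integral_frame J u" "H k J u < threshold \<kappa> J" "top_minor J z"
          "\<forall>l>k. c * H k J u \<le> \<bar>pluecker J (\<lambda>i. flow (\<rho> k) (A l) (u i)) z\<bar>"
          using moves[OF v, of k] 3(2) unfolding H_def by blast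
        \<comment> \<open>The move refers to some small frame \<open>u\<close> on \<open>J\<close>,
          not to \<open>v\<close>. As both span the same subspace, their coordinates differ by one
          factor \<open>q\<close>, and the bound carries over.\<close>
        have "v i \<in> span (u ` J)" if "i \<in> J" for i
          by (rule small_frames_same_span[of "flow (\<rho> k) (A k)" "c * cs" \<kappa> J u v i])
            (use \<rho>(1)[of k] all c cs \<kappa> u(1,2) v 3(2) J that in
              \<open>simp_all add: linear_flow inj_flow height_flow_pos_iff H_def\<close>)
        then obtain q where q: "\<And>T z. linear T \<Longrightarrow> pluecker J (\<lambda>i. T (v i)) z = q * pluecker J (\<lambda>i. T (u i)) z"
          using pluecker_span_proportional by blast
        have Hq: "H k J v \<le> \<bar>q\<bar> * H k J u"
          unfolding H_def by (rule height_leI) (simp add: q linear_flow abs_mult mult_left_mono pluecker_le_height)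
        have "c * H k J v \<le> \<bar>pluecker J (\<lambda>i. flow (\<rho> k) (A l) (v i)) z\<bar>" if "k < l" for l
        proof -
          have "c * H k J v \<le> c * (\<bar>q\<bar> * H k J u)" using Hq c by (intro mult_left_mono) auto
          also have "\<dots> = \<bar>q\<bar> * (c * H k J u)" by simp
          also have "\<dots> \<le> \<bar>q\<bar> * \<bar>pluecker J (\<lambda>i. flow (\<rho> k) (A l) (u i)) z\<bar>"
            using u(4) that by (intro mult_left_mono) auto
          also have "\<dots> = \<bar>pluecker J (\<lambda>i. flow (\<rho> k) (A l) (v i)) z\<bar>"
            by (simp add: q linear_flow abs_mult)
          finally show ?thesis .
        qed
        then show ?thesis unfolding handled_def using u(3) 3(1) by blast
      qed
    qed
  qed
  then have "handled k J v \<or> cs * threshold \<kappa> J \<le> H k J v" using v by blast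
  moreover have "c * (cs * threshold \<kappa> J) \<le> 1 * (cs * threshold \<kappa> J)"
    using c cs th[of J] by (intro mult_right_mono) auto
  ultimately show ?thesis using handledD[of k J v] unfolding H_def by fastforce
qed

section \<open>From the flow to Diophantine approximation\<close>

text \<open>The rank one case of the height bound, moved from the centres \<open>A k\<close> to a
  point \<open>B\<close> common to all the balls: at scale \<open>\<rho> k\<close> the two differ by
  a unipotent map with parameter of norm at most 1, which costs a constant factor.\<close>

lemma flow_coordinate_bounded_below:
  fixes B :: "real ^ 'n ^ 'm" and A :: "nat \<Rightarrow> real ^ 'n ^ 'm"
  assumes \<rho>: "\<And>k. 0 < \<rho> k" and B: "\<And>k. dist B (A k) \<le> \<rho> k" and e: "0 < e"
    and bound: "\<And>k (J :: ('m + 'n) set) v. card J = 1 \<Longrightarrow> integral_frame J v \<Longrightarrow>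
      e \<le> height J (\<lambda>i. flow (\<rho> k) (A k) (v i))"
  shows "\<exists>\<theta>>0. \<forall>k w. integral_vec w \<longrightarrow> w \<noteq> 0 \<longrightarrow> (\<exists>q. \<theta> \<le> \<bar>flow (\<rho> k) B w $ q\<bar>)"
proof -
  obtain c where c: "0 < c" "\<And>J x (X :: real ^ 'n ^ 'm). norm X \<le> 1 \<Longrightarrow>
      c * height J x \<le> height J (\<lambda>i. flow 1 X (x i))"
    using height_flow_ge[of 1 1] by auto
  define C where "C = fun_count TYPE('m + 'n)"
  define h where "h = height {} (\<lambda>_ :: 'm + 'n. 0)"
  have h: "height {} x = h" for x :: "'m + 'n \<Rightarrow> real ^ ('m + 'n)"
    unfolding h_def by (rule height_cong) simp
  have C: "1 \<le> C" unfolding C_def by (rule fun_count_ge_1)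
  have h1: "1 \<le> h" unfolding h_def by (rule height_empty_ge_1)
  define \<theta> where "\<theta> = c * e / (2 * C * h)"
  have "0 < \<theta>" using c e C h1 by (simp add: \<theta>_def)
  moreover have "\<forall>k w. integral_vec w \<longrightarrow> w \<noteq> 0 \<longrightarrow> (\<exists>q. \<theta> \<le> \<bar>flow (\<rho> k) B w $ q\<bar>)"
  proof (intro allI impI)
    fix k and w :: "real ^ ('m + 'n)" assume w: "integral_vec w" "w \<noteq> 0"
    show "\<exists>q. \<theta> \<le> \<bar>flow (\<rho> k) B w $ q\<bar>"
    proof (rule ccontr)
      assume "\<not> ?thesis"
      then have small: "\<bar>flow (\<rho> k) B w $ q\<bar> \<le> \<theta>" for q by (meson linear)
      \<comment> \<open>The slot that carries a single vector is arbitrary.\<close>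
      define p where "p = (undefined :: 'm + 'n)"
      have "0 < height (insert p {}) ((\<lambda>_. w)(p := w))"
        using w(2) by (intro height_insert_pos) (use height_empty_ge_1[of "\<lambda>_ :: 'm + 'n. w"] in auto)
      then have "integral_frame {p} (\<lambda>_. w)" using w(1) by (simp add: integral_frame_def fun_upd_idem)
      then have "c * e \<le> c * height {p} (\<lambda>i. flow (\<rho> k) (A k) w)" using bound[of "{p}"] c(1) by simp
      also have "\<dots> \<le> height {p} (\<lambda>i. flow 1 ((1 / \<rho> k) *\<^sub>R (B - A k)) (flow (\<rho> k) (A k) w))"
        using B[of k] \<rho>(1)[of k] by (intro c(2)) (simp add: dist_norm)
      also have "\<dots> = height (insert p {}) (\<lambda>i. flow (\<rho> k) B w)"
        by (simp add: flow_rebase[OF \<rho>(1)[of k], of B _ "A k", symmetric])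
      also have "\<dots> \<le> C * \<theta> * height {} (\<lambda>i. flow (\<rho> k) B w)"
        unfolding C_def by (rule height_insert_le[where p = 0]) (use small in auto)
      also have "\<dots> = c * e / 2" unfolding h \<theta>_def using C h1 by simp
      finally show False using c e by simp
    qed
  qed
  ultimately show ?thesis by blast
qed

text \<open>One direction of Dani's correspondence. For given \<open>x\<close>, let \<open>k\<close>
  be the first time at which the bound for the contracted block is below \<theta>; then the other
  block, hence the distance to the integers, is bounded below in terms of \<open>\<rho> k\<close>.
  If \<open>k\<close> is positive, its minimality bounds \<open>\<rho> k\<close> below by a power of
  \<open>infnorm x\<close>.\<close>

lemma badly_approximable_of_flow:
  fixes B :: "real ^ 'n ^ 'm"
  assumes \<rho>: "\<And>k. \<rho> k = \<delta> ^ k * r" and r: "0 < r" and \<delta>: "0 < \<delta>" "\<delta> < 1" and \<theta>: "0 < \<theta>"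
    and low: "\<And>k w. integral_vec w \<Longrightarrow> w \<noteq> 0 \<Longrightarrow> \<exists>q. \<theta> \<le> \<bar>flow (\<rho> k) B w $ q\<bar>"
  shows "B \<in> BA"
proof -
  define D where "D = real CARD('m) + real CARD('n)"
  define M where "M = real CARD('m)"
  define N where "N = real CARD('n)"
  have MN: "0 < M" "0 < N" "D = M + N" "0 < D" by (simp_all add: M_def N_def D_def add_pos_pos)
  \<comment> \<open>The two terms belong to \<open>k = 0\<close> and \<open>k = Suc l\<close>; half
    of the minimum makes the final inequality strict.\<close>
  define C where "C = min (\<theta> * r powr (N / D)) (\<theta> * (\<delta> powr (N / D) * \<theta> powr (N / M))) / 2"
  have C: "0 < C" unfolding C_def using \<theta> r \<delta> by simp
  have "dist_int_lattice (B *v x) > C * infnorm x powr (- (N / M))"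
    if x: "x \<noteq> 0" "\<forall>j. x $ j \<in> \<int>" for x :: "real ^ 'n"
  proof -
    define X where "X = infnorm x"
    define d where "d = dist_int_lattice (B *v x)"
    have Xj: "\<bar>x $ j\<bar> \<le> X" for j unfolding X_def by (rule component_le_infnorm_cart)
    obtain j where j: "x $ j \<noteq> 0" using x(1) by (auto simp: vec_eq_iff)
    then have "1 \<le> \<bar>x $ j\<bar>" using x(2) Ints_nonzero_abs_ge1 by blast
    then have X1: "1 \<le> X" using Xj[of j] by linarith
    have "\<exists>y\<in>\<int>. infdist ((B *v x) $ i) \<int> = dist ((B *v x) $ i) y" for i
      by (metis Ints_0 closed_Ints empty_iff infdist_attains_inf)
    then obtain y where y: "\<And>i. y i \<in> \<int>" "\<And>i. infdist ((B *v x) $ i) \<int> = dist ((B *v x) $ i) (y i)" by metis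
    have di: "\<bar>(B *v x) $ i - y i\<bar> \<le> d" for i
    proof -
      have "dist_nearest_int ((B *v x) $ i) \<le> d" unfolding d_def dist_int_lattice_def by (intro Max_ge) auto
      then show ?thesis using y(2)[of i] by (simp add: dist_nearest_int_def dist_real_def)
    qed
    \<comment> \<open>With \<open>y\<close> the nearest integers to \<open>B *v x\<close>, the
      expanded coordinates are the approximation errors.\<close>
    define w :: "real ^ ('m + 'n)" where "w = (\<chi> k. case k of Inl i \<Rightarrow> - y i | Inr j \<Rightarrow> x $ j)"
    have wint: "integral_vec w" using y(1) x(2) by (auto simp: integral_vec_def w_def split: sum.split)
    have "w $ Inr j \<noteq> 0" using j by (simp add: w_def)
    then have w0: "w \<noteq> 0" by auto
    have alt: "\<theta> \<le> \<rho> k powr (- (N / D)) * d \<or> \<theta> \<le> \<rho> k powr (M / D) * X" for k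
    proof -
      obtain q where q: "\<theta> \<le> \<bar>flow (\<rho> k) B w $ q\<bar>" using low[OF wint w0] by blast
      show ?thesis
      proof (cases q)
        case (Inl i)
        have "flow (\<rho> k) B w $ q = \<rho> k powr (- (N / D)) * ((B *v x) $ i - y i)"
          unfolding flow_def by (simp add: Inl w_def N_def D_def matrix_vector_mult_def)
        then have "\<bar>flow (\<rho> k) B w $ q\<bar> \<le> \<rho> k powr (- (N / D)) * d"
          using di[of i] by (simp add: abs_mult mult_left_mono)
        then show ?thesis using q by linarith
      next
        case (Inr j)
        have "flow (\<rho> k) B w $ q = \<rho> k powr (M / D) * x $ j"
          unfolding flow_def by (simp add: Inr w_def M_def D_def)
        then have "\<bar>flow (\<rho> k) B w $ q\<bar> \<le> \<rho> k powr (M / D) * X"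
          using Xj[of j] by (simp add: abs_mult mult_left_mono)
        then show ?thesis using q by linarith
      qed
    qed
    have \<rho>pos: "0 < \<rho> k" for k using \<rho> \<delta> r by simp
    have "(\<lambda>k. \<rho> k) \<longlonglongrightarrow> 0 * r"
      unfolding \<rho> using \<delta> by (intro tendsto_mult LIMSEQ_realpow_zero tendsto_const) auto
    then have "(\<lambda>k. \<rho> k) \<longlonglongrightarrow> 0" by simp
    then have "(\<lambda>k. \<rho> k powr (M / D) * X) \<longlonglongrightarrow> 0 powr (M / D) * X"
      using MN \<rho>pos by (intro tendsto_mult tendsto_const tendsto_powr') (auto simp: less_imp_le)
    then have "eventually (\<lambda>k. \<rho> k powr (M / D) * X < \<theta>) sequentially"
      using MN \<theta> by (intro order_tendstoD(2)) auto
    then have ex: "\<exists>k. \<rho> k powr (M / D) * X < \<theta>" by (auto simp: eventually_sequentially)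
    define k where "k = (LEAST k. \<rho> k powr (M / D) * X < \<theta>)"
    have k: "\<rho> k powr (M / D) * X < \<theta>" unfolding k_def using ex by (rule LeastI_ex)
    then have "\<theta> \<le> \<rho> k powr (- (N / D)) * d" using alt[of k] by linarith
    then have "\<rho> k powr (N / D) * \<theta> \<le> \<rho> k powr (N / D) * (\<rho> k powr (- (N / D)) * d)"
      by (intro mult_left_mono) auto
    also have "\<dots> = d" using \<rho>pos[of k] by (simp add: powr_minus field_simps)
    finally have d: "\<theta> * \<rho> k powr (N / D) \<le> d" by (simp add: mult.commute)
    have "2 * C * X powr (- (N / M)) \<le> d"
    proof (cases k)
      case 0
      have "2 * C * X powr (- (N / M)) \<le> (\<theta> * r powr (N / D)) * 1"
      proof (rule mult_mono)
        show "2 * C \<le> \<theta> * r powr (N / D)" by (simp add: C_def)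
        show "X powr (- (N / M)) \<le> 1" using X1 MN powr_mono[of "- (N / M)" 0 X] by simp
      qed (use \<theta> in auto)
      then show ?thesis using d 0 \<rho> by simp
    next
      case (Suc l)
      have "\<not> \<rho> l powr (M / D) * X < \<theta>"
        using not_less_Least[of l "\<lambda>k. \<rho> k powr (M / D) * X < \<theta>"] Suc unfolding k_def by simp
      then have "\<theta> / X \<le> \<rho> l powr (M / D)" using X1 by (simp add: field_simps)
      then have "(\<theta> / X) powr (N / M) \<le> (\<rho> l powr (M / D)) powr (N / M)"
        using \<theta> X1 MN by (intro powr_mono2) auto
      also have "\<dots> = \<rho> l powr (N / D)" using MN by (simp add: powr_powr)
      also have "(\<theta> / X) powr (N / M) = \<theta> powr (N / M) * X powr (- (N / M))"
        using \<theta> X1 by (simp add: powr_divide powr_minus_divide)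
      finally have l: "\<theta> powr (N / M) * X powr (- (N / M)) \<le> \<rho> l powr (N / D)" .
      have "2 * C * X powr (- (N / M)) \<le> \<theta> * (\<delta> powr (N / D) * \<theta> powr (N / M)) * X powr (- (N / M))"
        by (intro mult_right_mono) (simp_all add: C_def)
      also have "\<dots> = \<theta> * \<delta> powr (N / D) * (\<theta> powr (N / M) * X powr (- (N / M)))" by simp
      also have "\<dots> \<le> \<theta> * \<delta> powr (N / D) * \<rho> l powr (N / D)" using l \<theta> by (intro mult_left_mono) auto
      also have "\<dots> = \<theta> * \<rho> k powr (N / D)"
      proof -
        have "\<rho> k = \<delta> * \<rho> l" using Suc \<rho> by simp
        then show ?thesis using \<delta> \<rho>pos[of l] by (simp add: powr_mult)
      qed
      finally show ?thesis using d by linarith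
    qed
    moreover have "0 < C * X powr (- (N / M))" using C X1 by simp
    ultimately show ?thesis unfolding d_def X_def by simp
  qed
  then show ?thesis unfolding BA_def M_def N_def using C by blast
qed

section \<open>White's strategy\<close>

text \<open>White rescales the ball to the unit ball and applies the simultaneous escape to one
  small frame for each \<open>J\<close>. One frame is enough, since
  \<open>small_frames_same_span\<close> will transfer the bound to the others.\<close>

lemma white_response:
  fixes K :: "(real ^ 'n ^ 'm) set"
  assumes move: "\<And>(K :: (real ^ 'n ^ 'm) set) b. diffuse \<gamma> K \<Longrightarrow> 0 \<in> K \<Longrightarrow>
      \<exists>Y\<in>K. cball Y \<alpha> \<subseteq> cball 0 1 \<and> (\<forall>J. 0 < height J (b J) \<longrightarrow>
        (\<exists>z. top_minor J z \<and> (\<forall>Z\<in>cball Y \<alpha>. c * height J (b J) \<le> \<bar>pluecker J (\<lambda>i. flow 1 Z (b J i)) z\<bar>)))"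
    and diffuse: "diffuse \<gamma> ((\<lambda>X. (1 / \<rho>) *\<^sub>R (X - A)) ` K)" and A: "A \<in> K" and \<rho>: "0 < \<rho>"
  shows "\<exists>A'\<in>K. cball A' (\<alpha> * \<rho>) \<subseteq> cball A \<rho> \<and>
    (\<forall>J v. integral_frame J v \<longrightarrow> height J (\<lambda>i. flow \<rho> A (v i)) < threshold \<kappa> J \<longrightarrow>
      (\<exists>v. integral_frame J v \<and> height J (\<lambda>i. flow \<rho> A (v i)) < threshold \<kappa> J \<and>
        (\<exists>z. top_minor J z \<and> (\<forall>Z\<in>cball A' (\<alpha> * \<rho>). c * height J (\<lambda>i. flow \<rho> A (v i)) \<le>
           \<bar>pluecker J (\<lambda>i. flow \<rho> Z (v i)) z\<bar>))))"
proof -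
  define small where "small J v \<longleftrightarrow> integral_frame J v \<and> height J (\<lambda>i. flow \<rho> A (v i)) < threshold \<kappa> J" for J v
  \<comment> \<open>Where no small frame exists, \<open>u J\<close> is an arbitrary value about
    which nothing is claimed.\<close>
  define u where "u J = (SOME v. small J v)" for J
  have u: "small J (u J)" if "small J v" for J v
    unfolding u_def using someI[of "small J", OF that] .
  have "(1 / \<rho>) *\<^sub>R (A - A) \<in> (\<lambda>X. (1 / \<rho>) *\<^sub>R (X - A)) ` K" using A by blast
  then have "0 \<in> (\<lambda>X. (1 / \<rho>) *\<^sub>R (X - A)) ` K" by simp
  from move[OF diffuse this, of "\<lambda>J i. flow \<rho> A (u J i)"] obtain A' where A': "A' \<in> K"
    "cball ((1 / \<rho>) *\<^sub>R (A' - A)) \<alpha> \<subseteq> cball 0 1"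
    "\<And>J. 0 < height J (\<lambda>i. flow \<rho> A (u J i)) \<Longrightarrow> \<exists>z. top_minor J z \<and> (\<forall>Z\<in>cball ((1 / \<rho>) *\<^sub>R (A' - A)) \<alpha>.
        c * height J (\<lambda>i. flow \<rho> A (u J i)) \<le> \<bar>pluecker J (\<lambda>i. flow 1 Z (flow \<rho> A (u J i))) z\<bar>)"
    by blast
  have scale: "(1 / \<rho>) *\<^sub>R (Z - A) \<in> cball ((1 / \<rho>) *\<^sub>R (A' - A)) \<alpha>" if "Z \<in> cball A' (\<alpha> * \<rho>)" for Z
  proof -
    have "dist ((1 / \<rho>) *\<^sub>R (A' - A)) ((1 / \<rho>) *\<^sub>R (Z - A)) = dist A' Z / \<rho>"
      using \<rho> by (simp add: dist_norm scaleR_right_diff_distrib[symmetric])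
    then show ?thesis using that \<rho> unfolding mem_cball by (simp only: pos_divide_le_eq)
  qed
  show ?thesis
  proof (intro bexI[OF _ A'(1)] conjI allI impI)
    show "cball A' (\<alpha> * \<rho>) \<subseteq> cball A \<rho>"
    proof
      fix Z assume "Z \<in> cball A' (\<alpha> * \<rho>)"
      then have "(1 / \<rho>) *\<^sub>R (Z - A) \<in> cball 0 1" using scale A'(2) by blast
      then have "norm (Z - A) / \<rho> \<le> 1" using \<rho> by simp
      then show "Z \<in> cball A \<rho>" using \<rho> by (simp add: dist_norm norm_minus_commute)
    qed
    fix J v assume "integral_frame J v" "height J (\<lambda>i. flow \<rho> A (v i)) < threshold \<kappa> J"
    then have uJ: "small J (u J)" using u[of J v] by (simp add: small_def)
    then have "0 < height J (\<lambda>i. flow \<rho> A (u J i))"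
      using \<rho> by (simp add: small_def integral_frame_def height_flow_pos_iff)
    then obtain z where z: "top_minor J z" "\<forall>Z\<in>cball ((1 / \<rho>) *\<^sub>R (A' - A)) \<alpha>.
        c * height J (\<lambda>i. flow \<rho> A (u J i)) \<le> \<bar>pluecker J (\<lambda>i. flow 1 Z (flow \<rho> A (u J i))) z\<bar>"
      using A'(3) by blast
    have "c * height J (\<lambda>i. flow \<rho> A (u J i)) \<le> \<bar>pluecker J (\<lambda>i. flow \<rho> Z (u J i)) z\<bar>"
      if "Z \<in> cball A' (\<alpha> * \<rho>)" for Z
      using z(2) scale[OF that] by (simp add: flow_rebase[OF \<rho>, of Z _ A])
    then show "\<exists>v. integral_frame J v \<and> height J (\<lambda>i. flow \<rho> A (v i)) < threshold \<kappa> J \<and>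
        (\<exists>z. top_minor J z \<and> (\<forall>Z\<in>cball A' (\<alpha> * \<rho>). c * height J (\<lambda>i. flow \<rho> A (v i)) \<le>
           \<bar>pluecker J (\<lambda>i. flow \<rho> Z (v i)) z\<bar>))"
      using uJ z(1) unfolding small_def by blast
  qed
qed

text \<open>An integral frame has height at least 1, so its height at the opening position is at
  least \<open>c\<close>. Thresholds of ranks strictly between 0 and d are at most \<kappa>, so a
  small \<kappa> suffices.\<close>

lemma initial_threshold:
  fixes A :: "real ^ 'n ^ 'm"
  assumes "0 < \<rho>" "0 < \<epsilon>"
  shows "\<exists>\<kappa>. 0 < \<kappa> \<and> \<kappa> \<le> 1 \<and> fun_count TYPE('m + 'n) ^ CARD('m + 'n) * \<kappa>\<^sup>2 < \<epsilon>\<^sup>2 \<and>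
    (\<forall>J v. integral_frame J v \<longrightarrow> J \<noteq> {} \<longrightarrow> J \<noteq> UNIV \<longrightarrow> threshold \<kappa> J \<le> height J (\<lambda>i. flow \<rho> A (v i)))"
proof -
  obtain c where c: "0 < c" "\<And>J x. c * height J x \<le> height J (\<lambda>i. flow \<rho> A (x i))"
    using height_flow_ge[OF assms(1), of "norm A"] by (metis order_refl)
  define C where "C = fun_count TYPE('m + 'n) ^ CARD('m + 'n)"
  have C: "1 \<le> C" unfolding C_def by (intro one_le_power fun_count_ge_1)
  \<comment> \<open>\<open>c\<close> takes care of the opening position, the last term of the
    condition for unique small subspaces.\<close>
  define \<kappa> where "\<kappa> = min 1 (min c (\<epsilon> / (2 * C)))"
  have \<kappa>: "0 < \<kappa>" "\<kappa> \<le> 1" "\<kappa> \<le> c" "\<kappa> \<le> \<epsilon> / (2 * C)" using c(1) assms C by (auto simp: \<kappa>_def)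
  have "\<epsilon> / (2 * C) \<le> \<epsilon> / 1" using C assms by (intro divide_left_mono) auto
  then have "\<kappa> \<le> \<epsilon>" using \<kappa> by simp
  have "C * \<kappa>\<^sup>2 \<le> C * (\<epsilon> / (2 * C) * \<epsilon>)"
    unfolding power2_eq_square using \<kappa> \<open>\<kappa> \<le> \<epsilon>\<close> C assms by (intro mult_left_mono mult_mono) auto
  also have "\<dots> = \<epsilon>\<^sup>2 / 2" using C by (simp add: power2_eq_square)
  also have "\<dots> < \<epsilon>\<^sup>2" using assms by simp
  finally have "C * \<kappa>\<^sup>2 < \<epsilon>\<^sup>2" .
  moreover have "threshold \<kappa> J \<le> height J (\<lambda>i. flow \<rho> A (v i))"
    if "integral_frame J v" "J \<noteq> {}" "J \<noteq> UNIV" for J v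
  proof -
    have "card J < CARD('m + 'n)" using that(3) by (intro psubset_card_mono) auto
    moreover have "0 < card J" using that(2) by (simp add: card_gt_0_iff)
    ultimately have "1 \<le> card J * (CARD('m + 'n) - card J)" by (simp add: Suc_leI)
    then have "threshold \<kappa> J \<le> \<kappa> ^ 1" unfolding threshold_def using \<kappa> by (intro power_decreasing) auto
    also have "\<dots> \<le> c * 1" using \<kappa> by simp
    also have "\<dots> \<le> c * height J v"
      using that(1) height_ge_1[of J v] c(1) by (intro mult_left_mono) (auto simp: integral_frame_def)
    also have "\<dots> \<le> height J (\<lambda>i. flow \<rho> A (v i))" by (rule c(2))
    finally show ?thesis .
  qed
  ultimately show ?thesis using \<kappa> unfolding C_def by blast
qed

theorem theorem1:
  fixes \<tau> :: "(real ^ 'n ^ 'm) measure"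
    and K :: "(real ^ 'n ^ 'm) set"
  assumes "finite_measure \<tau>"
    and "sets \<tau> = sets borel"
    and "absolutely_friendly \<tau>"
    and "K = measure_supp \<tau>"
    and "compact K"
  shows "schmidt_winning K (K \<inter> BA)"
proof -
  \<comment> \<open>All radii in a play are at most \<open>diameter K\<close>, the bound on Black's
    opening.\<close>
  obtain \<gamma> where \<gamma>: "0 < \<gamma>" "\<gamma> \<le> 1"
    "\<And>\<rho> A. 0 < \<rho> \<Longrightarrow> \<rho> \<le> diameter K \<Longrightarrow> diffuse \<gamma> ((\<lambda>X. (1 / \<rho>) *\<^sub>R (X - A)) ` K)"
    using friendly_diffuse[OF assms(3,4), where R = "diameter K"] by blast
  \<comment> \<open>\<alpha> and \<open>c\<close> are fixed here; \<delta>, \<open>cs\<close> and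
    \<kappa>, which depend on \<beta>, are chosen afterwards.\<close>
  obtain \<alpha> c where \<alpha>: "0 < \<alpha>" "\<alpha> < 1" and c: "0 < c" "c \<le> 1" and move:
    "\<And>(K :: (real ^ 'n ^ 'm) set) b. diffuse \<gamma> K \<Longrightarrow> 0 \<in> K \<Longrightarrow>
      \<exists>Y\<in>K. cball Y \<alpha> \<subseteq> cball 0 1 \<and> (\<forall>J. 0 < height J (b J) \<longrightarrow>
        (\<exists>z. top_minor J z \<and> (\<forall>Z\<in>cball Y \<alpha>. c * height J (b J) \<le> \<bar>pluecker J (\<lambda>i. flow 1 Z (b J i)) z\<bar>)))"
    using top_minor_simultaneous[OF \<gamma>(1,2), where 'm = 'm and 'n = 'n] by blast
  have "schmidt_winning_pair \<alpha> \<beta> K (K \<inter> BA)" if \<beta>: "\<beta> \<in> {0<..<1}" for \<beta>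
  proof -
    define \<delta> where "\<delta> = \<alpha> * \<beta>"
    have "\<alpha> * \<beta> < 1 * 1" using \<alpha> \<beta> by (intro mult_strict_mono) auto
    then have \<delta>: "0 < \<delta>" "\<delta> < 1" using \<alpha> \<beta> by (auto simp: \<delta>_def)
    \<comment> \<open>\<open>c1\<close> bounds the loss of height in one full round, in which the
      scale shrinks by \<delta> and the centre moves by at most one radius.\<close>
    obtain c1 where c1: "0 < c1" "\<And>J x (X :: real ^ 'n ^ 'm). norm X \<le> 1 \<Longrightarrow>
        c1 * height J x \<le> height J (\<lambda>i. flow \<delta> X (x i))"
      using height_flow_ge[OF \<delta>(1), of 1] by blast
    define cs where "cs = min 1 c1"
    have cs: "0 < cs" "cs \<le> 1" using c1(1) by (auto simp: cs_def)
    \<comment> \<open>\<kappa> depends on the opening ball, as the thresholds must lie below all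
      initial heights. White may use it because the strategy sees all of Black's balls.\<close>
    have "\<forall>B :: (real ^ 'n ^ 'm) gball. \<exists>\<kappa>. 0 < snd B \<longrightarrow> 0 < \<kappa> \<and> \<kappa> \<le> 1 \<and>
       fun_count TYPE('m + 'n) ^ CARD('m + 'n) * \<kappa>\<^sup>2 < (c * cs)\<^sup>2 \<and>
       (\<forall>J v. integral_frame J v \<longrightarrow> J \<noteq> {} \<longrightarrow> J \<noteq> UNIV \<longrightarrow>
         threshold \<kappa> J \<le> height J (\<lambda>i. flow (snd B) (fst B) (v i)))"
      using initial_threshold[where \<epsilon> = "c * cs" and 'm = 'm and 'n = 'n] c cs by simp
    then obtain \<kappa> :: "(real ^ 'n ^ 'm) gball \<Rightarrow> real" where \<kappa>: "\<And>B. 0 < snd B \<Longrightarrow> 0 < \<kappa> B \<and> \<kappa> B \<le> 1 \<and>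
       fun_count TYPE('m + 'n) ^ CARD('m + 'n) * (\<kappa> B)\<^sup>2 < (c * cs)\<^sup>2 \<and>
       (\<forall>J v. integral_frame J v \<longrightarrow> J \<noteq> {} \<longrightarrow> J \<noteq> UNIV \<longrightarrow>
         threshold (\<kappa> B) J \<le> height J (\<lambda>i. flow (snd B) (fst B) (v i)))"
      by metis
    define good where "good B0 B W \<longleftrightarrow> fst W \<in> K \<and> snd W = \<alpha> * snd B \<and>
      cball (fst W) (snd W) \<subseteq> cball (fst B) (snd B) \<and>
      (\<forall>J v. integral_frame J v \<longrightarrow> height J (\<lambda>i. flow (snd B) (fst B) (v i)) < threshold (\<kappa> B0) J \<longrightarrow>
      (\<exists>v. integral_frame J v \<and> height J (\<lambda>i. flow (snd B) (fst B) (v i)) < threshold (\<kappa> B0) J \<and>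
        (\<exists>z. top_minor J z \<and> (\<forall>Z\<in>cball (fst W) (snd W). c * height J (\<lambda>i. flow (snd B) (fst B) (v i)) \<le>
           \<bar>pluecker J (\<lambda>i. flow (snd B) Z (v i)) z\<bar>))))" for B0 B W :: "(real ^ 'n ^ 'm) gball"
    have good_ex: "\<exists>W. good B0 B W" if B: "fst B \<in> K" "0 < snd B" "snd B \<le> diameter K" for B0 B
    proof -
      obtain A' where "A' \<in> K" "cball A' (\<alpha> * snd B) \<subseteq> cball (fst B) (snd B)"
        "\<forall>J v. integral_frame J v \<longrightarrow> height J (\<lambda>i. flow (snd B) (fst B) (v i)) < threshold (\<kappa> B0) J \<longrightarrow>
      (\<exists>v. integral_frame J v \<and> height J (\<lambda>i. flow (snd B) (fst B) (v i)) < threshold (\<kappa> B0) J \<and>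
        (\<exists>z. top_minor J z \<and> (\<forall>Z\<in>cball A' (\<alpha> * snd B). c * height J (\<lambda>i. flow (snd B) (fst B) (v i)) \<le>
           \<bar>pluecker J (\<lambda>i. flow (snd B) Z (v i)) z\<bar>)))"
        using white_response[OF move \<gamma>(3)[OF B(2,3)] B(1,2), where \<kappa> = "\<kappa> B0"] by blast
      then have "good B0 B (A', \<alpha> * snd B)" unfolding good_def by simp
      then show ?thesis ..
    qed
    \<comment> \<open>The opening ball determines \<kappa>, the current ball the position; nothing
      else of the history enters.\<close>
    define \<sigma> where "\<sigma> Bs = (SOME W. good (hd Bs) (last Bs) W)" for Bs
    have white: "white_ball \<sigma> U k = (SOME W. good (U 0) (U k) W)" for U k
      by (simp add: white_ball_def \<sigma>_def hd_map del: upt_Suc) (simp add: upt_Suc)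
    have legal: "fst (U k) \<in> K \<and> snd (U k) = \<delta> ^ k * snd (U 0) \<and> 0 < snd (U 0) \<and> snd (U k) \<le> diameter K \<and>
        good (U 0) (U k) (white_ball \<sigma> U k)" if "black_legal_upto K \<beta> \<sigma> U k" for U k
      using that
    proof (induction k)
      case 0
      then have *: "fst (U 0) \<in> K" "0 < snd (U 0)" "snd (U 0) \<le> diameter K"
        by (auto simp: black_legal_upto_def legal_opening_def)
      have "good (U 0) (U 0) (white_ball \<sigma> U 0)" unfolding white by (rule someI_ex[OF good_ex[OF *]])
      then show ?case using * by simp
    next
      case (Suc k)
      then have IH: "snd (U k) = \<delta> ^ k * snd (U 0)" "0 < snd (U 0)" "snd (U k) \<le> diameter K"
          "good (U 0) (U k) (white_ball \<sigma> U k)" and reply: "legal_reply K \<beta> (white_ball \<sigma> U k) (U (Suc k))"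
        by (auto simp: black_legal_upto_def)
      have eq: "snd (U (Suc k)) = \<delta> * snd (U k)" and "fst (U (Suc k)) \<in> K"
        using IH(4) reply by (auto simp: legal_reply_def good_def \<delta>_def)
      have pos: "0 < snd (U k)" using IH \<delta> by simp
      then have "\<delta> * snd (U k) \<le> snd (U k)" using \<delta> by simp
      then have "\<delta> * snd (U k) \<le> diameter K" using IH(3) by (rule order_trans)
      then have *: "fst (U (Suc k)) \<in> K" "0 < snd (U (Suc k))" "snd (U (Suc k)) \<le> diameter K"
        using \<open>fst (U (Suc k)) \<in> K\<close> \<delta> pos unfolding eq by auto
      have "good (U 0) (U (Suc k)) (white_ball \<sigma> U (Suc k))"
        unfolding white[of U "Suc k"] by (rule someI_ex[OF good_ex[OF *]])
      then show ?case using * eq IH by simp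
    qed
    have "white_winning_strategy \<alpha> \<beta> K (K \<inter> BA) \<sigma>"
      unfolding white_winning_strategy_def
    proof (intro conjI allI impI)
      fix U k assume "black_legal_upto K \<beta> \<sigma> U k"
      then have "good (U 0) (U k) (white_ball \<sigma> U k)" using legal by blast
      then show "legal_reply K \<alpha> (U k) (white_ball \<sigma> U k)"
        by (auto simp: legal_reply_def good_def set_of_ball_def)
    next
      fix U assume all: "\<forall>k. black_legal_upto K \<beta> \<sigma> U k"
      define A where "A k = fst (U k)" for k
      define \<rho> where "\<rho> k = snd (U k)" for k
      define W where "W k = white_ball \<sigma> U k" for k
      have AK: "A k \<in> K" and \<rho>: "\<rho> k = \<delta> ^ k * \<rho> 0" and \<rho>0: "0 < \<rho> 0" and good: "good (U 0) (U k) (W k)" for k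
        using legal[of U k] all by (auto simp: A_def \<rho>_def W_def)
      have \<rho>pos: "0 < \<rho> k" for k using \<rho>[of k] \<rho>0 \<delta> by simp
      have \<rho>Suc: "\<rho> (Suc k) = \<delta> * \<rho> k" for k using \<rho>[of k] \<rho>[of "Suc k"] by simp
      have ball: "set_of_ball (U k) = cball (A k) (\<rho> k)" for k by (simp add: set_of_ball_def A_def \<rho>_def)
      have inW: "set_of_ball (U (Suc k)) \<subseteq> cball (fst (W k)) (snd (W k))" for k
        using all unfolding black_legal_upto_def legal_reply_def set_of_ball_def W_def by blast
      have Win: "cball (fst (W k)) (snd (W k)) \<subseteq> set_of_ball (U k)" for k
        using good[of k] unfolding good_def set_of_ball_def by blast
      have nested: "set_of_ball (U l) \<subseteq> set_of_ball (U k)" if "k \<le> l" for k l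
        using lift_Suc_antimono_le[of "\<lambda>k. set_of_ball (U k)" k l] inW Win that by (meson order_trans)
      have A_in: "A k \<in> set_of_ball (U k)" for k using \<rho>pos[of k] by (simp add: ball less_imp_le)
      \<comment> \<open>White's bounds hold on all of \<open>W k\<close>, so they remain valid at
        every later centre.\<close>
      have AW: "A l \<in> cball (fst (W k)) (snd (W k))" if "k < l" for k l
        using A_in[of l] nested[of "Suc k" l] inW[of k] that by (auto simp: Suc_le_eq)
      have \<rho>lim: "\<rho> \<longlonglongrightarrow> 0"
      proof -
        have "(\<lambda>k. \<delta> ^ k * \<rho> 0) \<longlonglongrightarrow> 0 * \<rho> 0"
          using \<delta> by (intro tendsto_mult LIMSEQ_realpow_zero tendsto_const) auto
        moreover have "\<rho> = (\<lambda>k. \<delta> ^ k * \<rho> 0)" using \<rho> by blast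
        ultimately show ?thesis by simp
      qed
      have "\<exists>p. \<Inter>(range (\<lambda>k. set_of_ball (U k))) = {p}"
      proof (rule decreasing_closed_nest_sing)
        show "closed (set_of_ball (U k))" for k by (simp add: ball)
        show "set_of_ball (U k) \<noteq> {}" for k using A_in by blast
        show "set_of_ball (U l) \<subseteq> set_of_ball (U k)" if "k \<le> l" for k l by (rule nested[OF that])
        fix e :: real assume "0 < e"
        then obtain k where k: "\<rho> k < e / 2"
          using order_tendstoD(2)[OF \<rho>lim, of "e / 2"] by (auto simp: eventually_sequentially)
        have "dist x y < e" if "x \<in> set_of_ball (U k)" "y \<in> set_of_ball (U k)" for x y
          using dist_triangle3[of x y "A k"] that k by (simp add: ball)
        then show "\<exists>k. \<forall>x\<in>set_of_ball (U k). \<forall>y\<in>set_of_ball (U k). dist x y < e" by blast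
      qed
      then obtain p where p: "(\<Inter>k. set_of_ball (U k)) = {p}" by blast
      have pA: "dist p (A k) \<le> \<rho> k" for k
        using p by (metis INT_E UNIV_I ball dist_commute insertI1 mem_cball)
      have "A \<longlonglongrightarrow> p"
        by (rule iffD2[OF tendsto_dist_iff], rule tendsto_sandwich[OF _ _ tendsto_const \<rho>lim])
          (use pA in \<open>simp_all add: dist_commute\<close>)
      then have "p \<in> K" using closed_sequentially[OF compact_imp_closed[OF assms(5)]] AK by blast
      have bound: "c * cs * threshold (\<kappa> (U 0)) J \<le> height J (\<lambda>i. flow (\<rho> k) (A k) (v i))"
        if "integral_frame J v" for k J v
      proof (rule frame_heights_bounded[OF \<rho>pos _ c cs _ _ _ _ _ _ that])
        show "\<rho> (Suc k) \<le> \<rho> k" for k using \<delta> \<rho>pos[of k] by (simp add: \<rho>Suc)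
        have U0: "0 < snd (U 0)" using \<rho>0 by (simp add: \<rho>_def)
        show "0 < \<kappa> (U 0)" "\<kappa> (U 0) \<le> 1"
          "fun_count TYPE('m + 'n) ^ CARD('m + 'n) * (\<kappa> (U 0))\<^sup>2 < (c * cs)\<^sup>2"
          using \<kappa>[OF U0] by auto
        show "threshold (\<kappa> (U 0)) J \<le> height J (\<lambda>i. flow (\<rho> 0) (A 0) (v i))"
          if "integral_frame J v" "J \<noteq> {}" "J \<noteq> UNIV" for J v
          using \<kappa>[OF U0] that by (simp add: A_def \<rho>_def)
        show "cs * height J (\<lambda>i. flow (\<rho> k) (A k) (x i)) \<le>
            height J (\<lambda>i. flow (\<rho> (Suc k)) (A (Suc k)) (x i))" for k J x
        proof -
          define X where "X = (1 / \<rho> k) *\<^sub>R (A (Suc k) - A k)"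
          have "A (Suc k) \<in> set_of_ball (U k)" using A_in nested[of k "Suc k"] by auto
          then have "norm X \<le> 1"
            using \<rho>pos[of k] by (simp add: X_def ball dist_norm norm_minus_commute)
          have "cs * height J (\<lambda>i. flow (\<rho> k) (A k) (x i)) \<le> c1 * height J (\<lambda>i. flow (\<rho> k) (A k) (x i))"
            by (intro mult_right_mono height_nonneg) (simp add: cs_def)
          also have "\<dots> \<le> height J (\<lambda>i. flow \<delta> X (flow (\<rho> k) (A k) (x i)))" by (rule c1(2)) fact
          also have "\<dots> = height J (\<lambda>i. flow (\<rho> (Suc k)) (A (Suc k)) (x i))"
            using \<delta>(1) \<rho>pos[of k] by (simp add: flow_flow \<rho>Suc X_def)
          finally show ?thesis .
        qed
        show "\<exists>v. integral_frame J v \<and> height J (\<lambda>i. flow (\<rho> k) (A k) (v i)) < threshold (\<kappa> (U 0)) J \<and>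
          (\<exists>z. top_minor J z \<and> (\<forall>l>k. c * height J (\<lambda>i. flow (\<rho> k) (A k) (v i)) \<le>
             \<bar>pluecker J (\<lambda>i. flow (\<rho> k) (A l) (v i)) z\<bar>))"
          if small: "integral_frame J v" "height J (\<lambda>i. flow (\<rho> k) (A k) (v i)) < threshold (\<kappa> (U 0)) J" for k J v
        proof -
          obtain v z where "integral_frame J v" "height J (\<lambda>i. flow (\<rho> k) (A k) (v i)) < threshold (\<kappa> (U 0)) J"
            "top_minor J z" "\<forall>Z\<in>cball (fst (W k)) (snd (W k)). c * height J (\<lambda>i. flow (\<rho> k) (A k) (v i)) \<le>
             \<bar>pluecker J (\<lambda>i. flow (\<rho> k) Z (v i)) z\<bar>"
            using good[of k] small unfolding good_def A_def \<rho>_def by blast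
          then show ?thesis using AW by blast
        qed
      qed
      \<comment> \<open>The power of \<kappa> is the threshold in rank 1, the rank of single lattice
        vectors.\<close>
      define e where "e = c * cs * \<kappa> (U 0) ^ (CARD('m + 'n) - 1)"
      have "0 < \<kappa> (U 0)" using \<kappa>[of "U 0"] \<rho>0 by (simp add: \<rho>_def)
      then have e: "0 < e" using c cs by (simp add: e_def)
      have eb: "e \<le> height J (\<lambda>i. flow (\<rho> k) (A k) (v i))" if "card J = 1" "integral_frame J v" for k J v
        using bound[OF that(2), of k] that(1) by (simp add: e_def threshold_def)
      obtain \<theta> where \<theta>: "0 < \<theta>"
        "\<And>k w. integral_vec w \<Longrightarrow> w \<noteq> 0 \<Longrightarrow> \<exists>q. \<theta> \<le> \<bar>flow (\<rho> k) p w $ q\<bar>"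
        using flow_coordinate_bounded_below[where \<rho> = \<rho> and A = A, OF \<rho>pos pA e eb] by blast
      have "p \<in> BA" by (rule badly_approximable_of_flow[where \<rho> = \<rho> and r = "\<rho> 0", OF \<rho> \<rho>0 \<delta> \<theta>])
      then show "\<exists>p\<in>K \<inter> BA. (\<Inter>k. set_of_ball (U k)) = {p}" using \<open>p \<in> K\<close> p by blast
    qed
    then show ?thesis unfolding schmidt_winning_pair_def by blast
  qed
  then have "schmidt_alpha_winning \<alpha> K (K \<inter> BA)" unfolding schmidt_alpha_winning_def by blast
  then show ?thesis using \<alpha> unfolding schmidt_winning_def by auto
qed

end
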